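(* Let $\Theta=(\Gamma,(x_{k,i}))$ be a patch framework with $\Gamma$ connected and with every view affinely non-degenerate, and let $S$ be a perfect alignment. If the realization $\Theta(S)$ is affinely rigid then $S$ is a non-degenerate and unique perfect alignment. The converse does not hold: there is such a framework and a perfect alignment $S$ that is non-degenerate and unique but for which $\Theta(S)$ is not affinely rigid.
   Context: Patch framework. $\Gamma$ is a bipartite graph on $n+m$ vertices; vertex $k\in\{1,\dots,n\}$ represents the $k$th point and vertex $n+i$, $i\in\{1,\dots,m\}$, the $i$th view; $(k,i)\in E(\Gamma)$ means that point $k$ is in view $i$, with local coordinates $x_{k,i}\in\mathbb{R}^d$. The tuple $\Theta=(\Gamma,(x_{k,i}))$ is a patch framework. A view $i$ is affinely non-degenerate if it has at least $d+1$ points and the affine span of $\{x_{k,i}:(k,i)\in E(\Gamma)\}$ has dimension $d$. Put $e_{ki}=e_k-e_{n+i}\in\mathbb{R}^{n+m}$, $\varepsilon_i$ the $i$th standard basis vector of $\mathbb{R}^m$, $\mathcal{L}_\Gamma=\sum_{(k,i)\in E(\Gamma)}e_{ki}e_{ki}^T$, $B=\sum_{(k,i)\in E(\Gamma)}(\varepsilon_i\otimes I_d)x_{k,i}e_{ki}^T$, $D=\sum_{(k,i)\in E(\Gamma)}(\varepsilon_i\otimes I_d)x_{k,i}x_{k,i}^T(\varepsilon_i\otimes I_d)^T$, and $C=D-B\mathcal{L}_\Gamma^\dagger B^T\in\mathbb{R}^{md\times md}$ (positive semi-definite), where $\dagger$ is the Moore–Penrose pseudoinverse. An alignment is an element $S=[S_i]_1^m$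 (vertical stack) of $\mathbb{O}(d)^m\subseteq\mathbb{R}^{md\times d}$; $F(S)=\mathrm{Tr}(CSS^T)$; $S$ is perfect if $F(S)=0$ (hence optimal, i.e. a global minimizer of $F$). An optimal alignment $S$ is unique if every other optimal alignment $O$ is of the form $O=SQ$ for some $Q\in\mathbb{O}(d)$. Let $\pi:\mathbb{O}(d)^m\to\mathbb{O}(d)^{m-1}$, $\pi(S)=[S_{i+1}S_1^T]_{i=1}^{m-1}$ (identifying $\mathbb{O}(d)^m/_\sim$, $S\sim SQ$ for $Q\in\mathbb{O}(d)$, with $\mathbb{O}(d)^{m-1}$), and $\widetilde F:\mathbb{O}(d)^{m-1}\to\mathbb{R}$, $\widetilde F(\widetilde S)=\mathrm{Tr}\left(C\begin{bmatrix}I_d\\ \widetilde S\end{bmatrix}\begin{bmatrix}I_d\\ \widetilde S\end{bmatrix}^T\right)$. $S$ is non-degenerate if $\pi(S)$ is a local minimizer of $\widetilde F$ at which the Hessian is non-singular (at a critical point this does not depend on the Riemannian metric). Realization. For an alignment $S$, $\Theta(S)=S^TB\,\mathcal{L}_\Gamma^\dagger(:,1{:}n)\,(I_n-n^{-1}\mathbf{1}_n\mathbf{1}_n^T)\in\mathbb{R}^{d\times n}$, where $(:,1{:}n)$ denotes the first $n$ columns and $\mathbf{1}_n$ the all-ones vector. For a perfect alignment $S$, $\Theta(S)$ is affinely rigid if for every $Y\in\mathbb{R}^{d\times n}$ with columns $Y_k$ such that for each $i\in\{1,\dots,m\}$ there is an affine transform $A_i:\mathbb{R}^d\to\mathbb{R}^d$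 with $Y_k=A_i(x_{k,i})$ for all $(k,i)\in E(\Gamma)$, there is an affine transform $A$ of $\mathbb{R}^d$ with $Y=A\Theta(S)$ (applied columnwise). *)

theory Defs
  imports Complex_Main "Jordan_Normal_Form.Matrix" "Jordan_Normal_Form.VS_Connect"
begin

text \<open>
  Sizes are natural numbers and matrices are the explicitly sized ones of Jordan_Normal_Form.
  Indices are 0-based: points are \<open>0, \<dots>, n - 1\<close>, views are \<open>0, \<dots>, m - 1\<close>.
\<close>

subsection \<open>Matrices\<close>

definition mtrace :: "real mat \<Rightarrow> real" where
  "mtrace A = (\<Sum>i<dim_row A. A $$ (i, i))"

definition outer :: "real vec \<Rightarrow> real vec \<Rightarrow> real mat" where
  "outer v w = mat (dim_vec v) (dim_vec w) (\<lambda>(a, b). v $ a * w $ b)"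

definition kronecker :: "real mat \<Rightarrow> real mat \<Rightarrow> real mat" where
  "kronecker A B = mat (dim_row A * dim_row B) (dim_col A * dim_col B)
     (\<lambda>(r, c). A $$ (r div dim_row B, c div dim_col B) * B $$ (r mod dim_row B, c mod dim_col B))"

text \<open>Sum of a finite family of \<open>r \<times> c\<close> matrices.\<close>

definition msum :: "nat \<Rightarrow> nat \<Rightarrow> 'e set \<Rightarrow> ('e \<Rightarrow> real mat) \<Rightarrow> real mat" where
  "msum r c I f = mat r c (\<lambda>(a, b). \<Sum>e\<in>I. f e $$ (a, b))"

definition is_pinv :: "real mat \<Rightarrow> real mat \<Rightarrow> bool" where
  "is_pinv A X \<longleftrightarrow> X \<in> carrier_mat (dim_col A) (dim_row A) \<and>
     A * X * A = A \<and> X * A * X = X \<and>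
     transpose_mat (A * X) = A * X \<and> transpose_mat (X * A) = X * A"

definition pinv :: "real mat \<Rightarrow> real mat" where
  "pinv A = (THE X. is_pinv A X)"

definition first_cols :: "nat \<Rightarrow> real mat \<Rightarrow> real mat" where
  "first_cols n A = mat (dim_row A) n (\<lambda>(a, b). A $$ (a, b))"

definition orthogonal_group :: "nat \<Rightarrow> real mat set" where
  "orthogonal_group d = {Q \<in> carrier_mat d d. transpose_mat Q * Q = 1\<^sub>m d}"

definition block :: "nat \<Rightarrow> real mat \<Rightarrow> nat \<Rightarrow> real mat" where
  "block d S i = mat d d (\<lambda>(a, b). S $$ (i * d + a, b))"

definition vstack :: "nat \<Rightarrow> nat \<Rightarrow> (nat \<Rightarrow> real mat) \<Rightarrow> real mat" where
  "vstack d m f = mat (m * d) d (\<lambda>(r, c). f (r div d) $$ (r mod d, c))"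

text \<open>\<open>\<O>(d)\<^sup>m\<close> as a subset of the \<open>md \<times> d\<close> matrices.\<close>

definition orthogonal_power :: "nat \<Rightarrow> nat \<Rightarrow> real mat set" where
  "orthogonal_power d m =
     {S \<in> carrier_mat (m * d) d. \<forall>i<m. block d S i \<in> orthogonal_group d}"


subsection \<open>Affine geometry of column vectors\<close>

definition affine_span :: "nat \<Rightarrow> real vec set \<Rightarrow> real vec set" where
  "affine_span d X = {vec d (\<lambda>a. \<Sum>v\<in>U. c v * v $ a) | U c.
     finite U \<and> U \<subseteq> X \<and> (\<Sum>v\<in>U. c v) = 1}"

text \<open>The dimension of an affine subspace \<open>A\<close> of \<open>\<real>\<^sup>d\<close> is that of its space of differences.\<close>

definition affine_dim :: "nat \<Rightarrow> real vec set \<Rightarrow> nat" where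
  "affine_dim d A = vectorspace.dim (class_ring :: real ring)
     ((module_vec TYPE(real) d)\<lparr>carrier := {p - q | p q. p \<in> A \<and> q \<in> A}\<rparr>)"

text \<open>The linear part is not required to be invertible.\<close>

definition affine_transform :: "nat \<Rightarrow> (real vec \<Rightarrow> real vec) \<Rightarrow> bool" where
  "affine_transform d A \<longleftrightarrow> (\<exists>M \<in> carrier_mat d d. \<exists>t \<in> carrier_vec d.
     \<forall>v \<in> carrier_vec d. A v = M *\<^sub>v v + t)"


subsection \<open>Riemannian Hessian on a submanifold of a matrix space\<close>

text \<open>
  \<open>M\<close> is meant to be an embedded submanifold of the \<open>r \<times> c\<close> matrices, with the Riemannian metric
  induced by the Frobenius inner product. The matrix type carries no topology, so curves are
  differentiated entrywise.
\<close>

definition frob_inner :: "real mat \<Rightarrow> real mat \<Rightarrow> real" where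
  "frob_inner A B = mtrace (transpose_mat A * B)"

definition frob_norm :: "real mat \<Rightarrow> real" where
  "frob_norm A = sqrt (frob_inner A A)"

definition has_mat_derivative :: "(real \<Rightarrow> real mat) \<Rightarrow> real mat \<Rightarrow> real \<Rightarrow> bool" where
  "has_mat_derivative \<gamma> V t \<longleftrightarrow> V \<in> carrier_mat (dim_row (\<gamma> t)) (dim_col (\<gamma> t)) \<and>
     (\<forall>a<dim_row V. \<forall>b<dim_col V.
        ((\<lambda>s. \<gamma> s $$ (a, b)) has_real_derivative V $$ (a, b)) (at t))"

definition curve_through :: "real mat set \<Rightarrow> real mat \<Rightarrow> real mat \<Rightarrow> (real \<Rightarrow> real mat) \<Rightarrow> bool" where
  "curve_through M p V \<gamma> \<longleftrightarrow> (\<forall>t. \<gamma> t \<in> M) \<and> \<gamma> 0 = p \<and> has_mat_derivative \<gamma> V 0"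

text \<open>
  On a submanifold, curves that are merely differentiable at 0 have the same velocities as smooth
  ones.
\<close>

definition tangent_space :: "real mat set \<Rightarrow> real mat \<Rightarrow> real mat set" where
  "tangent_space M p = {V. \<exists>\<gamma>. curve_through M p V \<gamma>}"

definition riem_grad :: "real mat set \<Rightarrow> (real mat \<Rightarrow> real) \<Rightarrow> real mat \<Rightarrow> real mat" where
  "riem_grad M f p = (THE G. G \<in> tangent_space M p \<and>
     (\<forall>V \<gamma>. curve_through M p V \<gamma> \<longrightarrow>
        ((\<lambda>t. f (\<gamma> t)) has_real_derivative frob_inner G V) (at 0)))"

text \<open>
  \<open>Hess f(p)[V] = \<nabla>\<^sub>V grad f\<close>, where the Levi-Civita connection of the induced metric is the
  derivative in the ambient space followed by orthogonal projection onto the tangent space.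
  The condition on all tangent vectors \<open>W\<close> says that \<open>H\<close> is the projection of \<open>G'\<close>.
\<close>

definition riem_hess :: "real mat set \<Rightarrow> (real mat \<Rightarrow> real) \<Rightarrow> real mat \<Rightarrow> real mat \<Rightarrow> real mat" where
  "riem_hess M f p V = (THE H. H \<in> tangent_space M p \<and>
     (\<forall>\<gamma>. curve_through M p V \<gamma> \<longrightarrow>
        (\<exists>G'. has_mat_derivative (\<lambda>t. riem_grad M f (\<gamma> t)) G' 0 \<and>
              (\<forall>W \<in> tangent_space M p. frob_inner H W = frob_inner G' W))))"

definition nonsingular_hessian :: "real mat set \<Rightarrow> (real mat \<Rightarrow> real) \<Rightarrow> real mat \<Rightarrow> bool" where
  "nonsingular_hessian M f p \<longleftrightarrow> (\<forall>V \<in> tangent_space M p.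
     riem_hess M f p V = 0\<^sub>m (dim_row p) (dim_col p) \<longrightarrow> V = 0\<^sub>m (dim_row p) (dim_col p))"

definition local_minimizer :: "real mat set \<Rightarrow> (real mat \<Rightarrow> real) \<Rightarrow> real mat \<Rightarrow> bool" where
  "local_minimizer M f p \<longleftrightarrow> p \<in> M \<and> (\<exists>\<epsilon>>0. \<forall>q \<in> M. frob_norm (q - p) < \<epsilon> \<longrightarrow> f p \<le> f q)"


subsection \<open>Patch frameworks\<close>

text \<open>
  The bipartite graph is given by the set of pairs (point, view). As a graph vertex, view \<open>i\<close> is
  numbered \<open>n + i\<close>.
\<close>

record patch_frame =
  pf_dim :: nat
  pf_points :: nat
  pf_views :: nat
  pf_edges :: "(nat \<times> nat) set"
  pf_coords :: "nat \<Rightarrow> nat \<Rightarrow> real vec"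

definition patch_framework :: "patch_frame \<Rightarrow> bool" where
  "patch_framework \<Theta> \<longleftrightarrow> pf_dim \<Theta> \<ge> 1 \<and> pf_points \<Theta> \<ge> 1 \<and> pf_views \<Theta> \<ge> 1 \<and>
     pf_edges \<Theta> \<subseteq> {..<pf_points \<Theta>} \<times> {..<pf_views \<Theta>} \<and>
     (\<forall>(k, i) \<in> pf_edges \<Theta>. pf_coords \<Theta> k i \<in> carrier_vec (pf_dim \<Theta>))"

definition pf_arcs :: "patch_frame \<Rightarrow> (nat \<times> nat) set" where
  "pf_arcs \<Theta> = {(k, pf_points \<Theta> + i) | k i. (k, i) \<in> pf_edges \<Theta>}"

definition pf_connected :: "patch_frame \<Rightarrow> bool" where
  "pf_connected \<Theta> \<longleftrightarrow> (\<forall>u < pf_points \<Theta> + pf_views \<Theta>. \<forall>v < pf_points \<Theta> + pf_views \<Theta>.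
     (u, v) \<in> (pf_arcs \<Theta> \<union> (pf_arcs \<Theta>)\<inverse>)\<^sup>*)"

definition affinely_nondegenerate_view :: "patch_frame \<Rightarrow> nat \<Rightarrow> bool" where
  "affinely_nondegenerate_view \<Theta> i \<longleftrightarrow>
     card {k. (k, i) \<in> pf_edges \<Theta>} \<ge> pf_dim \<Theta> + 1 \<and>
     affine_dim (pf_dim \<Theta>)
       (affine_span (pf_dim \<Theta>) {pf_coords \<Theta> k i | k. (k, i) \<in> pf_edges \<Theta>}) = pf_dim \<Theta>"

definition edge_vec :: "patch_frame \<Rightarrow> nat \<Rightarrow> nat \<Rightarrow> real vec" where
  "edge_vec \<Theta> k i = unit_vec (pf_points \<Theta> + pf_views \<Theta>) k
     - unit_vec (pf_points \<Theta> + pf_views \<Theta>) (pf_points \<Theta> + i)"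

text \<open>\<open>(\<epsilon>\<^sub>i \<otimes> I\<^sub>d) x\<^sub>k\<^sub>,\<^sub>i\<close>\<close>

definition lifted_coord :: "patch_frame \<Rightarrow> nat \<Rightarrow> nat \<Rightarrow> real vec" where
  "lifted_coord \<Theta> k i =
     kronecker (mat_of_cols (pf_views \<Theta>) [unit_vec (pf_views \<Theta>) i]) (1\<^sub>m (pf_dim \<Theta>))
       *\<^sub>v pf_coords \<Theta> k i"

definition laplacian :: "patch_frame \<Rightarrow> real mat" where
  "laplacian \<Theta> = msum (pf_points \<Theta> + pf_views \<Theta>) (pf_points \<Theta> + pf_views \<Theta>) (pf_edges \<Theta>)
     (\<lambda>(k, i). outer (edge_vec \<Theta> k i) (edge_vec \<Theta> k i))"

definition matB :: "patch_frame \<Rightarrow> real mat" where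
  "matB \<Theta> = msum (pf_views \<Theta> * pf_dim \<Theta>) (pf_points \<Theta> + pf_views \<Theta>) (pf_edges \<Theta>)
     (\<lambda>(k, i). outer (lifted_coord \<Theta> k i) (edge_vec \<Theta> k i))"

definition matD :: "patch_frame \<Rightarrow> real mat" where
  "matD \<Theta> = msum (pf_views \<Theta> * pf_dim \<Theta>) (pf_views \<Theta> * pf_dim \<Theta>) (pf_edges \<Theta>)
     (\<lambda>(k, i). outer (lifted_coord \<Theta> k i) (lifted_coord \<Theta> k i))"

definition matC :: "patch_frame \<Rightarrow> real mat" where
  "matC \<Theta> = matD \<Theta> - matB \<Theta> * pinv (laplacian \<Theta>) * transpose_mat (matB \<Theta>)"


subsection \<open>Alignments\<close>

definition alignment :: "patch_frame \<Rightarrow> real mat \<Rightarrow> bool" where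
  "alignment \<Theta> S \<longleftrightarrow> S \<in> orthogonal_power (pf_dim \<Theta>) (pf_views \<Theta>)"

definition align_error :: "patch_frame \<Rightarrow> real mat \<Rightarrow> real" where
  "align_error \<Theta> S = mtrace (matC \<Theta> * (S * transpose_mat S))"

definition perfect_alignment :: "patch_frame \<Rightarrow> real mat \<Rightarrow> bool" where
  "perfect_alignment \<Theta> S \<longleftrightarrow> alignment \<Theta> S \<and> align_error \<Theta> S = 0"

definition optimal_alignment :: "patch_frame \<Rightarrow> real mat \<Rightarrow> bool" where
  "optimal_alignment \<Theta> S \<longleftrightarrow> alignment \<Theta> S \<and>
     (\<forall>T. alignment \<Theta> T \<longrightarrow> align_error \<Theta> S \<le> align_error \<Theta> T)"

definition unique_alignment :: "patch_frame \<Rightarrow> real mat \<Rightarrow> bool" where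
  "unique_alignment \<Theta> S \<longleftrightarrow> optimal_alignment \<Theta> S \<and>
     (\<forall>T. optimal_alignment \<Theta> T \<longrightarrow> (\<exists>Q \<in> orthogonal_group (pf_dim \<Theta>). T = S * Q))"

definition quotient_proj :: "patch_frame \<Rightarrow> real mat \<Rightarrow> real mat" where
  "quotient_proj \<Theta> S = vstack (pf_dim \<Theta>) (pf_views \<Theta> - 1)
     (\<lambda>i. block (pf_dim \<Theta>) S (i + 1) * transpose_mat (block (pf_dim \<Theta>) S 0))"

definition reduced_error :: "patch_frame \<Rightarrow> real mat \<Rightarrow> real" where
  "reduced_error \<Theta> T = mtrace (matC \<Theta> *
     ((1\<^sub>m (pf_dim \<Theta>) @\<^sub>r T) * transpose_mat (1\<^sub>m (pf_dim \<Theta>) @\<^sub>r T)))"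

definition nondegenerate_alignment :: "patch_frame \<Rightarrow> real mat \<Rightarrow> bool" where
  "nondegenerate_alignment \<Theta> S \<longleftrightarrow> alignment \<Theta> S \<and>
     local_minimizer (orthogonal_power (pf_dim \<Theta>) (pf_views \<Theta> - 1)) (reduced_error \<Theta>)
       (quotient_proj \<Theta> S) \<and>
     nonsingular_hessian (orthogonal_power (pf_dim \<Theta>) (pf_views \<Theta> - 1)) (reduced_error \<Theta>)
       (quotient_proj \<Theta> S)"

definition realization :: "patch_frame \<Rightarrow> real mat \<Rightarrow> real mat" where
  "realization \<Theta> S = transpose_mat S * matB \<Theta> * first_cols (pf_points \<Theta>) (pinv (laplacian \<Theta>)) *
     (1\<^sub>m (pf_points \<Theta>) - (1 / real (pf_points \<Theta>)) \<cdot>\<^sub>m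
        outer (vec (pf_points \<Theta>) (\<lambda>_. 1)) (vec (pf_points \<Theta>) (\<lambda>_. 1)))"

definition affinely_rigid :: "patch_frame \<Rightarrow> real mat \<Rightarrow> bool" where
  "affinely_rigid \<Theta> X \<longleftrightarrow> (\<forall>Y \<in> carrier_mat (pf_dim \<Theta>) (pf_points \<Theta>).
     (\<forall>i < pf_views \<Theta>. \<exists>A. affine_transform (pf_dim \<Theta>) A \<and>
        (\<forall>k. (k, i) \<in> pf_edges \<Theta> \<longrightarrow> col Y k = A (pf_coords \<Theta> k i))) \<longrightarrow>
     (\<exists>A. affine_transform (pf_dim \<Theta>) A \<and> (\<forall>k < pf_points \<Theta>. col Y k = A (col X k))))"

end

theory Submission
  imports Defs "Jordan_Normal_Form.Determinant"
begin

text \<open>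
  For a column \<open>w\<close> of an alignment put \<open>z = L\<^sup>\<dagger>B\<^sup>Tw\<close>. Then \<open>w \<bullet> Cw\<close> is the sum over the edges of
  \<open>(w \<bullet> x\<^sub>k\<^sub>,\<^sub>i - (z\<^sub>k - z\<^sub>n\<^sub>+\<^sub>i))\<^sup>2\<close>, so \<open>Cw = 0\<close> means that on each view the point potentials \<open>z\<^sub>k\<close> are an
  affine function of the local coordinates. If \<open>\<Theta>(S)\<close> is affinely rigid, such a family of affine
  functions comes from a single affine map applied to \<open>\<Theta>(S)\<close>, and affine non-degeneracy of the
  views turns this into: every matrix killed by \<open>C\<close> has the form \<open>SM\<close>. An optimal alignment is killed
  by \<open>C\<close>, whence uniqueness. At \<open>\<pi>(S)\<close> the Euclidean gradient of the reduced error vanishes, so its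
  Hessian is twice the compression of \<open>C\<close> to the tangent space; a degenerate direction \<open>V\<close> would give
  \<open>[0; V] = SM\<close>, and the zero block forces \<open>M = 0\<close>.

  For the converse take \<open>d = 1\<close>, where the orthogonal groups are discrete and non-degeneracy is void.
\<close>

subsection \<open>Affine spans\<close>

text \<open>The pseudoinverse, the gradient and the Hessian are definite descriptions, so nothing
  can be computed from them before existence and uniqueness are shown. For the Laplacian,
  connectedness makes the kernel consist of the constant vectors, and adding the projector onto them
  gives an invertible matrix. The two Riemannian objects quantify over curves that stay in the
  manifold for all times, so every tangent direction needs an explicit curve of this kind; the
  Cayley transform supplies it with nothing beyond the inversion of a matrix. In general a Hessian
  also carries a curvature term. At a perfect alignment the whole vector \<open>Cw\<close> vanishes,
  not merely its tangential part, and this removes the term. Positive semidefiniteness is what lets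
  one factorization serve both claims: the error and the second variation are sums of non-negative
  forms of single columns, so when either is zero every column is isotropic for
  \<open>C\<close>.\<close>

lemma (in vec_space) submodule_full_dim:
  assumes W: "submodule class_ring W V"
    and dim: "vectorspace.dim class_ring (vs W) = n"
  shows "W = carrier_vec n"
proof -
  interpret w: vectorspace class_ring "vs W"
    using W by (intro subspace_is_vs) (simp add: subspace_def vec_vs)
  have WV: "W \<subseteq> carrier V" using W by (simp add: submodule_def)
  \<comment> \<open>Independence inside \<open>W\<close> is independence in the whole space, which
    caps the cardinality at \<open>n\<close>. The cap makes a maximal independent set exist before
    anything is known about bases of \<open>vs W\<close>.\<close>
  have bound: "finite A \<and> card A \<le> n" if "A \<subseteq> W \<and> w.lin_indpt A" for A
  proof -
    have "lin_indpt A" using span_li_not_depend(2)[OF _ W, of A] that by auto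
    then show ?thesis using li_le_dim[OF fin_dim _ \<open>lin_indpt A\<close>] that WV dim_is_n by auto
  qed
  have "w.lin_indpt {}" unfolding w.lin_dep_def by auto
  then obtain A where A: "finite A" "maximal A (\<lambda>A. A \<subseteq> carrier (vs W) \<and> w.lin_indpt A)"
    using maximal_exists[of "\<lambda>A. A \<subseteq> W \<and> w.lin_indpt A" n "{}"] bound by auto
  from w.max_li_is_basis[OF A(2)] have bas: "w.basis A" .
  have card: "card A = n" using w.dim_basis[OF A(1) bas] dim by simp
  have AW: "A \<subseteq> W" and li: "w.lin_indpt A" using bas unfolding w.basis_def by auto
  have "lin_indpt A" using li span_li_not_depend(2)[OF AW W] by simp
  then have "basis A"
    using A(1) AW WV card by (intro dim_li_is_basis) (auto simp: dim_is_n)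
  then have "span A = carrier V" unfolding basis_def by simp
  moreover have "span A \<subseteq> W" using span_is_subset[OF AW W] .
  ultimately show ?thesis using WV by auto
qed

text \<open>Extending coefficients by zero lets all combinations range over the same set
  \<open>X\<close>, so that two of them can be subtracted coefficientwise.\<close>

lemma affine_span_finite:
  assumes "finite X"
  shows "affine_span d X = {vec d (\<lambda>a. \<Sum>v\<in>X. c v * v $ a) | c. (\<Sum>v\<in>X. c v) = 1}"
proof (intro equalityI subsetI)
  fix y assume "y \<in> affine_span d X"
  then obtain U c where y: "y = vec d (\<lambda>a. \<Sum>v\<in>U. c v * v $ a)"
    and U: "U \<subseteq> X" "(\<Sum>v\<in>U. c v) = 1"
    unfolding affine_span_def by auto
  define c' where "c' v = (if v \<in> U then c v else 0)" for v
  have "(\<Sum>v\<in>X. c' v) = 1" "(\<Sum>v\<in>X. c' v * v $ a) = (\<Sum>v\<in>U. c v * v $ a)" for a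
    using U assms by (auto simp: c'_def if_distrib[of "\<lambda>t. t * _"] sum.If_cases Int_absorb1 Int_absorb2 Int_commute cong: if_cong)
  then show "y \<in> {vec d (\<lambda>a. \<Sum>v\<in>X. c v * v $ a) | c. (\<Sum>v\<in>X. c v) = 1}"
    unfolding y by (intro CollectI exI[of _ c']) auto
qed (use assms in \<open>auto simp: affine_span_def\<close>)

lemma affine_span_differences:
  assumes "finite X" "X \<noteq> {}"
  shows "{p - q | p q. p \<in> affine_span d X \<and> q \<in> affine_span d X}
    = {vec d (\<lambda>a. \<Sum>v\<in>X. c v * v $ a) | c. (\<Sum>v\<in>X. c v) = 0}" (is "?L = ?R")
proof (intro equalityI subsetI)
  fix y assume "y \<in> ?L"
  then obtain c c' where "y = vec d (\<lambda>a. \<Sum>v\<in>X. c v * v $ a) - vec d (\<lambda>a. \<Sum>v\<in>X. c' v * v $ a)"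
    "(\<Sum>v\<in>X. c v) = 1" "(\<Sum>v\<in>X. c' v) = 1"
    unfolding affine_span_finite[OF assms(1)] by auto
  then show "y \<in> ?R"
    by (intro CollectI exI[of _ "\<lambda>v. c v - c' v"])
      (auto simp: sum_subtractf left_diff_distrib)
next
  fix y assume "y \<in> ?R"
  then obtain c where y: "y = vec d (\<lambda>a. \<Sum>v\<in>X. c v * v $ a)" and c: "(\<Sum>v\<in>X. c v) = 0" by auto
  obtain x where x: "x \<in> X" using assms by auto
  \<comment> \<open>A unit mass at \<open>x\<close>: adding it to weights of total 0 gives weights
    of total 1, and \<open>y\<close> is the difference between the combination so obtained and the
    point \<open>x\<close> itself.\<close>
  define e where "e v = (if v = x then 1 else 0 :: real)" for v
  have e: "(\<Sum>v\<in>X. e v) = 1" using assms x by (simp add: e_def)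
  have "vec d (\<lambda>a. \<Sum>v\<in>X. (c v + e v) * v $ a) \<in> affine_span d X"
    unfolding affine_span_finite[OF assms(1)]
    by (intro CollectI exI[of _ "\<lambda>v. c v + e v"]) (simp add: sum.distrib c e)
  moreover have "vec d (\<lambda>a. \<Sum>v\<in>X. e v * v $ a) \<in> affine_span d X"
    unfolding affine_span_finite[OF assms(1)] using e by auto
  moreover have "y = vec d (\<lambda>a. \<Sum>v\<in>X. (c v + e v) * v $ a) - vec d (\<lambda>a. \<Sum>v\<in>X. e v * v $ a)"
    unfolding y by (auto simp: sum.distrib distrib_right)
  ultimately show "y \<in> ?L" by blast
qed

text \<open>A linear functional that is constant on \<open>X\<close> vanishes on every zero-sum
  combination of \<open>X\<close>. Full dimension makes these combinations all of the space, so the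
  functional may be evaluated on a unit vector. This is the form in which affine non-degeneracy of a
  view is used.\<close>

lemma affine_dim_full_annihilator:
  assumes finX: "finite X" and ne: "X \<noteq> {}"
    and dim: "affine_dim d (affine_span d X) = d"
    and const: "\<And>v. v \<in> X \<Longrightarrow> (\<Sum>a<d. u a * v $ a) = c0"
    and a: "a < d"
  shows "u a = 0"
proof -
  interpret vec_space "TYPE(real)" d .
  define W where "W = {vec d (\<lambda>a. \<Sum>v\<in>X. c v * v $ a) | c. (\<Sum>v\<in>X. c v) = 0}"
  have "submodule class_ring W V"
  proof (unfold_locales)
    show "W \<subseteq> carrier V" by (auto simp: W_def)
    show "v \<oplus>\<^bsub>V\<^esub> w \<in> W" if "v \<in> W" "w \<in> W" for v w
    proof -
      from that obtain c c' where "v = vec d (\<lambda>a. \<Sum>v\<in>X. c v * v $ a)" "w = vec d (\<lambda>a. \<Sum>v\<in>X. c' v * v $ a)"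
        "(\<Sum>v\<in>X. c v) = 0" "(\<Sum>v\<in>X. c' v) = 0" unfolding W_def by auto
      then show ?thesis unfolding W_def
        by (intro CollectI exI[of _ "\<lambda>v. c v + c' v"]) (auto simp: sum.distrib distrib_right module_vec_simps)
    qed
    show "\<zero>\<^bsub>V\<^esub> \<in> W" unfolding W_def by (intro CollectI exI[of _ "\<lambda>v. 0"]) (auto simp: module_vec_simps)
    show "r \<odot>\<^bsub>V\<^esub> v \<in> W" if "r \<in> carrier class_ring" "v \<in> W" for r v
    proof -
      from that obtain c where "v = vec d (\<lambda>a. \<Sum>v\<in>X. c v * v $ a)" 
        "(\<Sum>v\<in>X. c v) = 0" unfolding W_def by auto
      then show ?thesis unfolding W_def
        by (intro CollectI exI[of _ "\<lambda>v. r * c v"])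
          (auto simp: sum_distrib_left[symmetric] module_vec_simps mult.assoc)
    qed
  qed
  moreover have "vectorspace.dim class_ring (vs W) = d"
    using dim unfolding affine_dim_def affine_span_differences[OF finX ne, of d, folded W_def] .
  ultimately have "W = carrier_vec d" by (rule submodule_full_dim)
  then have "unit_vec d a \<in> W" by simp
  then obtain c where c: "unit_vec d a = vec d (\<lambda>a. \<Sum>v\<in>X. c v * v $ a)" and c0: "(\<Sum>v\<in>X. c v) = 0"
    unfolding W_def by blast
  have "u a = (\<Sum>b<d. u b * unit_vec d a $ b)" using a by (simp add: unit_vec_def if_distrib cong: if_cong)
  also have "\<dots> = (\<Sum>b<d. \<Sum>v\<in>X. u b * (c v * v $ b))" unfolding c by (simp add: sum_distrib_left)
  also have "\<dots> = (\<Sum>v\<in>X. c v * (\<Sum>b<d. u b * v $ b))"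
    by (subst sum.swap) (simp add: sum_distrib_left mult.left_commute)
  also have "\<dots> = (\<Sum>v\<in>X. c v * c0)" using const by simp
  also have "\<dots> = 0" by (simp add: sum_distrib_right[symmetric] c0)
  finally show ?thesis .
qed

text \<open>Weights \<open>s\<close> and \<open>- s\<close> at two points with distinct coordinates
  give \<open>s\<close> times their difference, which is an arbitrary vector of the line.\<close>

lemma affine_dim_line:
  fixes X :: "real vec set"
  assumes "finite X" "x \<in> X" "y \<in> X" "x $ 0 \<noteq> y $ 0"
  shows "affine_dim 1 (affine_span 1 X) = 1"
proof -
  interpret vec_space "TYPE(real)" 1 .
  have "{p - q | p q. p \<in> affine_span 1 X \<and> q \<in> affine_span 1 X} = carrier_vec 1"
    (is "?W = _")
  proof (intro equalityI subsetI)
    fix v :: "real vec" assume v: "v \<in> carrier_vec 1"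
    define s :: real where "s = v $ 0 / (x $ 0 - y $ 0)"
    define c where "c p = (if p = x then s else 0) - (if p = y then s else 0)" for p
    have "(\<Sum>p\<in>X. c p) = 0" using assms by (simp add: c_def sum_subtractf)
    moreover have "(\<Sum>p\<in>X. c p * p $ 0) = s * x $ 0 - s * y $ 0"
      using assms by (simp add: c_def left_diff_distrib sum_subtractf if_distrib[of "\<lambda>t. t * _"] cong: if_cong)
    moreover have "\<dots> = v $ 0" using assms by (simp add: s_def diff_divide_distrib[symmetric] right_diff_distrib[symmetric])
    ultimately have "(\<Sum>p\<in>X. c p) = 0 \<and> v = vec 1 (\<lambda>a. \<Sum>p\<in>X. c p * p $ a)" using v by auto
    moreover have "X \<noteq> {}" using assms by auto
    ultimately show "v \<in> ?W" unfolding affine_span_differences[OF assms(1) \<open>X \<noteq> {}\<close>] by blast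
  qed (auto simp: affine_span_def)
  then show ?thesis unfolding affine_dim_def using dim_is_n by (simp add: module_vec_def)
qed

subsection \<open>Sums of outer products and pseudoinverses\<close>

lemma sum_blocks:
  fixes g :: "nat \<Rightarrow> real"
  shows "(\<Sum>r<m * d. g r) = (\<Sum>i<m. \<Sum>a<d. g (i * d + a))"
  by (simp add: sum.nat_group[symmetric] sum.atLeastLessThan_shift_0[of g "_ * d"] atLeast0LessThan)

lemma block_index_less: "i < m \<Longrightarrow> a < d \<Longrightarrow> i * d + a < m * (d::nat)"
proof -
  assume "i < m" "a < d"
  then have "i * d + a < Suc i * d" by simp
  also have "\<dots> \<le> m * d" using \<open>i < m\<close> by (intro mult_le_mono1) simp
  finally show ?thesis .
qed

lemma scalar_prod_sum: "w \<in> carrier_vec k \<Longrightarrow> v \<in> carrier_vec k \<Longrightarrow> v \<bullet> w = (\<Sum>a<k. v $ a * w $ a)"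
  by (simp add: scalar_prod_def atLeast0LessThan)

text \<open>The Laplacian, \<open>B\<close> and \<open>D\<close> are all sums of this shape, so as
  bilinear forms they become sums over the edges.\<close>

lemma scalar_prod_msum_outer:
  assumes "\<And>k i. (k, i) \<in> I \<Longrightarrow> f k i \<in> carrier_vec r" "\<And>k i. (k, i) \<in> I \<Longrightarrow> g k i \<in> carrier_vec c"
    and w: "w \<in> carrier_vec r" and z: "z \<in> carrier_vec c"
  shows "w \<bullet> (msum r c I (\<lambda>(k, i). outer (f k i) (g k i)) *\<^sub>v z)
    = (\<Sum>(k, i)\<in>I. (f k i \<bullet> w) * (g k i \<bullet> z))"
proof -
  have "w \<bullet> (msum r c I (\<lambda>(k, i). outer (f k i) (g k i)) *\<^sub>v z)
    = (\<Sum>a<r. \<Sum>b<c. \<Sum>e\<in>I. w $ a * ((case e of (k, i) \<Rightarrow> outer (f k i) (g k i)) $$ (a, b) * z $ b))"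
    using w z by (simp add: scalar_prod_def msum_def sum_distrib_left sum_distrib_right atLeast0LessThan)
  also have "\<dots> = (\<Sum>e\<in>I. \<Sum>a<r. \<Sum>b<c. w $ a * ((case e of (k, i) \<Rightarrow> outer (f k i) (g k i)) $$ (a, b) * z $ b))"
    by (simp only: sum.swap[of _ I])
  also have "\<dots> = (\<Sum>(k, i)\<in>I. (f k i \<bullet> w) * (g k i \<bullet> z))"
  proof (intro sum.cong refl)
    fix e assume "e \<in> I"
    moreover obtain k i where "e = (k, i)" by force
    ultimately have f: "f k i \<in> carrier_vec r" and g: "g k i \<in> carrier_vec c" and e: "e = (k, i)"
      using assms(1,2) by auto
    have "(f k i \<bullet> w) * (g k i \<bullet> z) = (\<Sum>a<r. \<Sum>b<c. (f k i $ a * w $ a) * (g k i $ b * z $ b))"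
      unfolding scalar_prod_sum[OF w f] scalar_prod_sum[OF z g] by (rule sum_product)
    also have "\<dots> = (\<Sum>a<r. \<Sum>b<c. w $ a * (outer (f k i) (g k i) $$ (a, b) * z $ b))"
      using f g by (intro sum.cong refl) (simp add: outer_def)
    finally show "(\<Sum>a<r. \<Sum>b<c. w $ a * ((case e of (k, i) \<Rightarrow> outer (f k i) (g k i)) $$ (a, b) * z $ b))
      = (case e of (k, i) \<Rightarrow> (f k i \<bullet> w) * (g k i \<bullet> z))"
      by (simp add: e)
  qed
  finally show ?thesis .
qed

lemma msum_carrier [simp]: "msum r c I f \<in> carrier_mat r c"
  by (simp add: msum_def)

lemma transpose_msum_outer:
  assumes "\<And>k i. (k, i) \<in> I \<Longrightarrow> f k i \<in> carrier_vec r" "\<And>k i. (k, i) \<in> I \<Longrightarrow> g k i \<in> carrier_vec c"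
  shows "transpose_mat (msum r c I (\<lambda>(k, i). outer (f k i) (g k i)))
    = msum c r I (\<lambda>(k, i). outer (g k i) (f k i))"
proof (rule eq_matI)
  fix a b assume ab: "a < dim_row (msum c r I (\<lambda>(k, i). outer (g k i) (f k i)))"
    "b < dim_col (msum c r I (\<lambda>(k, i). outer (g k i) (f k i)))"
  have "(case e of (k, i) \<Rightarrow> outer (f k i) (g k i)) $$ (b, a) = (case e of (k, i) \<Rightarrow> outer (g k i) (f k i)) $$ (a, b)"
    if "e \<in> I" for e
  proof -
    obtain k i where e: "e = (k, i)" by force
    show ?thesis using assms[of k i] that ab unfolding e by (auto simp: outer_def msum_def)
  qed
  then show "transpose_mat (msum r c I (\<lambda>(k, i). outer (f k i) (g k i))) $$ (a, b)
    = msum c r I (\<lambda>(k, i). outer (g k i) (f k i)) $$ (a, b)"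
    using ab by (simp add: msum_def)
qed (simp_all add: msum_def)

text \<open>Penrose's argument: \<open>A * X\<close> and \<open>A * Y\<close> are both the
  orthogonal projector onto the range of \<open>A\<close>, hence equal, and likewise
  \<open>X * A = Y * A\<close>. Then
  \<open>X = X * A * X = Y * A * X = Y * A * Y = Y\<close>.\<close>

lemma is_pinv_unique:
  assumes "is_pinv A X" "is_pinv A Y"
  shows "X = Y"
proof -
  obtain r c where A: "A \<in> carrier_mat r c" by blast
  then have X: "X \<in> carrier_mat c r" and Y: "Y \<in> carrier_mat c r"
    using assms by (auto simp: is_pinv_def)
  have 1: "A * P = A * Q" if "is_pinv A P" "is_pinv A Q" for P Q
  proof -
    have P: "P \<in> carrier_mat c r" and Q: "Q \<in> carrier_mat c r" using that A by (auto simp: is_pinv_def)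
    have "A * P = A * Q * A * P" using that by (simp add: is_pinv_def)
    also have "\<dots> = (A * Q) * (A * P)" using A P Q by (intro assoc_mult_mat[of _ r r _ c _ r]) auto
    also have "\<dots> = transpose_mat (A * Q) * transpose_mat (A * P)" using that by (simp add: is_pinv_def)
    also have "\<dots> = transpose_mat (A * P * (A * Q))"
      using A P Q by (intro transpose_mult[symmetric]) auto
    also have "A * P * (A * Q) = A * P * A * Q"
      using A P Q by (intro assoc_mult_mat[of _ r r _ c _ r, symmetric]) auto
    also have "\<dots> = A * Q" using that by (simp add: is_pinv_def)
    also have "transpose_mat (A * Q) = A * Q" using that by (simp add: is_pinv_def)
    finally show ?thesis .
  qed
  have 2: "X * A = Y * A"
  proof -
    have "X * A = X * (A * Y * A)" using assms by (simp add: is_pinv_def)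
    also have "\<dots> = X * A * (Y * A)" using A X Y
      by (simp add: assoc_mult_mat[OF A Y A] assoc_mult_mat[OF X A, of _ c])
    also have "\<dots> = transpose_mat (X * A) * transpose_mat (Y * A)" using assms by (simp add: is_pinv_def)
    also have "\<dots> = transpose_mat (Y * A * (X * A))"
      using A X Y by (intro transpose_mult[symmetric]) auto
    also have "Y * A * (X * A) = Y * (A * X * A)" using A X Y
      by (simp add: assoc_mult_mat[OF A X A] assoc_mult_mat[OF Y A, of _ c])
    also have "\<dots> = Y * A" using assms by (simp add: is_pinv_def)
    also have "transpose_mat (Y * A) = Y * A" using assms by (simp add: is_pinv_def)
    finally show ?thesis .
  qed
  have "X = X * A * X" using assms by (simp add: is_pinv_def)
  also have "\<dots> = Y * (A * X)" unfolding 2 by (rule assoc_mult_mat[OF Y A X])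
  also have "\<dots> = Y * A * Y" unfolding 1[OF assms] by (rule assoc_mult_mat[OF Y A Y, symmetric])
  also have "\<dots> = Y" using assms by (simp add: is_pinv_def)
  finally show ?thesis .
qed

lemma pinv_eqI: "is_pinv A X \<Longrightarrow> pinv A = X"
  unfolding pinv_def using is_pinv_unique by blast

text \<open>The four Penrose equations are permuted by transposition. Together with uniqueness this
  makes the pseudoinverse of the symmetric Laplacian symmetric.\<close>

lemma is_pinv_transpose:
  assumes "is_pinv A X"
  shows "is_pinv (transpose_mat A) (transpose_mat X)"
proof -
  obtain r c where A: "A \<in> carrier_mat r c" by blast
  then have X: "X \<in> carrier_mat c r"
    using assms by (auto simp: is_pinv_def)
  have AX: "transpose_mat A * transpose_mat X = transpose_mat (X * A)"
    and XA: "transpose_mat X * transpose_mat A = transpose_mat (A * X)"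
    using A X by (simp_all add: transpose_mult)
  have "transpose_mat (X * A) * transpose_mat A = transpose_mat (A * (X * A))"
    using A X by (subst transpose_mult[of A r c]) auto
  moreover have "transpose_mat (A * X) * transpose_mat X = transpose_mat (X * (A * X))"
    using A X by (subst transpose_mult[of X c r]) auto
  ultimately show ?thesis using assms A X unfolding is_pinv_def AX XA
    by (simp add: assoc_mult_mat[OF A X A] assoc_mult_mat[OF X A X])
qed

lemma eq_vec_scalar_prodI:
  fixes u v :: "real vec"
  assumes u: "u \<in> carrier_vec k" and v: "v \<in> carrier_vec k" and eq: "\<And>w. w \<in> carrier_vec k \<Longrightarrow> w \<bullet> u = w \<bullet> v"
  shows "u = v"
proof (rule eq_vecI)
  fix a assume "a < dim_vec v"
  then show "u $ a = v $ a" using eq[of "unit_vec k a"] u v by simp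
qed (use u v in simp)

lemma minus_zero_mat [simp]:
  fixes A :: "real mat"
  assumes "A \<in> carrier_mat r c" shows "A - 0\<^sub>m r c = A"
  using assms by (intro eq_matI) auto

text \<open>The error decouples into one quadratic form per column, so \<open>C\<close> can be
  studied on single vectors.\<close>

lemma mtrace_gram:
  assumes C: "C \<in> carrier_mat r r" and S: "S \<in> carrier_mat r c"
  shows "mtrace (C * (S * transpose_mat S)) = (\<Sum>b<c. col S b \<bullet> (C *\<^sub>v col S b))"
proof -
  have "mtrace (C * (S * transpose_mat S)) = (\<Sum>i<r. \<Sum>j<r. \<Sum>b<c. C $$ (i, j) * (S $$ (j, b) * S $$ (i, b)))"
    using C S by (simp add: mtrace_def scalar_prod_def atLeast0LessThan sum_distrib_left)
  also have "\<dots> = (\<Sum>b<c. \<Sum>i<r. \<Sum>j<r. C $$ (i, j) * (S $$ (j, b) * S $$ (i, b)))"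
    by (simp only: sum.swap[of _ "{..<c}"])
  also have "\<dots> = (\<Sum>b<c. col S b \<bullet> (C *\<^sub>v col S b))"
    using C S by (simp add: scalar_prod_def atLeast0LessThan sum_distrib_left ac_simps)
  finally show ?thesis .
qed

subsection \<open>The error form of a connected framework\<close>

locale connected_patch_framework =
  fixes \<Theta> :: patch_frame
  assumes framework: "patch_framework \<Theta>" and connected: "pf_connected \<Theta>"
begin

abbreviation "d \<equiv> pf_dim \<Theta>"
abbreviation "n \<equiv> pf_points \<Theta>"
abbreviation "m \<equiv> pf_views \<Theta>"
abbreviation "E \<equiv> pf_edges \<Theta>"
abbreviation "x \<equiv> pf_coords \<Theta>"
abbreviation "X \<equiv> pinv (laplacian \<Theta>)"

lemma pos: "d \<ge> 1" "n \<ge> 1" "m \<ge> 1"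
  and edgeD: "(k, i) \<in> E \<Longrightarrow> k < n" "(k, i) \<in> E \<Longrightarrow> i < m"
  and coords_carrier: "(k, i) \<in> E \<Longrightarrow> x k i \<in> carrier_vec d"
  and finite_edges: "finite E"
proof -
  have sub: "E \<subseteq> {..<n} \<times> {..<m}" using framework by (simp add: patch_framework_def)
  show "finite E" using finite_subset[OF sub] by simp
  show "d \<ge> 1" "n \<ge> 1" "m \<ge> 1" using framework by (simp_all only: patch_framework_def)
  show "k < n" "i < m" if "(k, i) \<in> E" using subsetD[OF sub that] by auto
  have "\<forall>(k, i) \<in> E. x k i \<in> carrier_vec d" using framework unfolding patch_framework_def by blast
  from bspec[OF this] show "x k i \<in> carrier_vec d" if "(k, i) \<in> E" using that by fastforce
qed

lemma edge_vec_carrier [simp]: "edge_vec \<Theta> k i \<in> carrier_vec (n + m)"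
  by (simp add: edge_vec_def)

lemma edge_vec_scalar_prod:
  assumes "(k, i) \<in> E" "z \<in> carrier_vec (n + m)"
  shows "edge_vec \<Theta> k i \<bullet> z = z $ k - z $ (n + i)"
  using assms edgeD[OF assms(1)]
  by (simp add: edge_vec_def minus_scalar_prod_distrib[of _ "n + m"])

lemma lifted_coord_index:
  assumes "(k, i) \<in> E" "r < m * d"
  shows "lifted_coord \<Theta> k i $ r = (if r div d = i then x k i $ (r mod d) else 0)"
proof -
  have r: "r div d < m" "r mod d < d" using assms(2) pos(1) by (simp_all add: less_mult_imp_div_less)
  have i: "i < m" and xc: "x k i \<in> carrier_vec d" using edgeD coords_carrier assms(1) by auto
  \<comment> \<open>The left Kronecker factor has a single column, so a column index
    \<open>c < d\<close> has \<open>c div d = 0\<close> and \<open>c mod d = c\<close>; only the row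
    index selects the block.\<close>
  have "lifted_coord \<Theta> k i $ r = (\<Sum>c<d. (if r div d = i then 1 else 0) * (if r mod d = c then 1 else 0) * x k i $ c)"
    using assms(2) r i xc
    by (simp add: lifted_coord_def kronecker_def scalar_prod_def unit_vec_def mat_of_cols_def atLeast0LessThan)
  also have "\<dots> = (\<Sum>c<d. if r mod d = c then (if r div d = i then x k i $ c else 0) else 0)"
    by (intro sum.cong) auto
  also have "\<dots> = (if r div d = i then x k i $ (r mod d) else 0)"
    using r by simp
  finally show ?thesis .
qed

lemma lifted_coord_carrier [simp]: "lifted_coord \<Theta> k i \<in> carrier_vec (m * d)"
  by (rule carrier_vecI) (simp add: lifted_coord_def kronecker_def)

lemma lifted_coord_scalar_prod:
  assumes "(k, i) \<in> E" "w \<in> carrier_vec (m * d)"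
  shows "lifted_coord \<Theta> k i \<bullet> w = (\<Sum>a<d. x k i $ a * w $ (i * d + a))"
proof -
  have "lifted_coord \<Theta> k i \<bullet> w = (\<Sum>r<m * d. (if r div d = i then x k i $ (r mod d) else 0) * w $ r)"
    unfolding scalar_prod_sum[OF assms(2) lifted_coord_carrier] by (intro sum.cong refl) (simp add: lifted_coord_index[OF assms(1)])
  also have "\<dots> = (\<Sum>j<m. \<Sum>a<d. if j = i then x k i $ a * w $ (j * d + a) else 0)"
    unfolding sum_blocks by (intro sum.cong) auto
  also have "\<dots> = (\<Sum>j<m. if j = i then \<Sum>a<d. x k i $ a * w $ (j * d + a) else 0)"
    by (intro sum.cong) auto
  also have "\<dots> = (\<Sum>a<d. x k i $ a * w $ (i * d + a))"
    using edgeD[OF assms(1)] by simp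
  finally show ?thesis .
qed

section \<open>The Laplacian, \<open>B\<close> and \<open>D\<close> as forms on the graph\<close>

lemma laplacian_carrier [simp]: "laplacian \<Theta> \<in> carrier_mat (n + m) (n + m)"
  and matB_carrier [simp]: "matB \<Theta> \<in> carrier_mat (m * d) (n + m)"
  and matD_carrier [simp]: "matD \<Theta> \<in> carrier_mat (m * d) (m * d)"
  by (simp_all add: laplacian_def matB_def matD_def)

lemma transpose_laplacian: "transpose_mat (laplacian \<Theta>) = laplacian \<Theta>"
  unfolding laplacian_def by (rule transpose_msum_outer) simp_all

lemma laplacian_form:
  assumes "w \<in> carrier_vec (n + m)" "z \<in> carrier_vec (n + m)"
  shows "w \<bullet> (laplacian \<Theta> *\<^sub>v z) = (\<Sum>(k, i)\<in>E. (edge_vec \<Theta> k i \<bullet> w) * (edge_vec \<Theta> k i \<bullet> z))"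
  unfolding laplacian_def by (rule scalar_prod_msum_outer) (use assms in simp_all)

lemma matB_form:
  assumes "w \<in> carrier_vec (m * d)" "z \<in> carrier_vec (n + m)"
  shows "w \<bullet> (matB \<Theta> *\<^sub>v z) = (\<Sum>(k, i)\<in>E. (lifted_coord \<Theta> k i \<bullet> w) * (edge_vec \<Theta> k i \<bullet> z))"
  unfolding matB_def by (rule scalar_prod_msum_outer) (use assms in simp_all)

lemma matD_form:
  assumes "w \<in> carrier_vec (m * d)" "z \<in> carrier_vec (m * d)"
  shows "w \<bullet> (matD \<Theta> *\<^sub>v z) = (\<Sum>(k, i)\<in>E. (lifted_coord \<Theta> k i \<bullet> w) * (lifted_coord \<Theta> k i \<bullet> z))"
  unfolding matD_def by (rule scalar_prod_msum_outer) (use assms in simp_all)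

text \<open>Connectedness enters here, by induction along a walk. It is what restricts the kernel of
  the Laplacian to the constant vectors.\<close>

lemma constant_if_edges_agree:
  assumes "\<And>k i. (k, i) \<in> E \<Longrightarrow> f k = f (n + i)" and "u < n + m" "v < n + m"
  shows "f u = f v"
proof -
  have "(u, v) \<in> (pf_arcs \<Theta> \<union> (pf_arcs \<Theta>)\<inverse>)\<^sup>*"
    using connected assms by (auto simp: pf_connected_def)
  then show ?thesis
  proof (induction rule: rtrancl_induct)
    case (step y z)
    then have "f y = f z" using assms(1) by (auto simp: pf_arcs_def)
    with step show ?case by simp
  qed simp
qed


text \<open>\<open>P\<close> is the orthogonal projector onto the constant vectors, the kernel of
  the Laplacian. Hence \<open>K\<close>, the Laplacian plus \<open>P\<close>, is invertible; its
  inverse minus \<open>P\<close> inverts the Laplacian on the complement of the constants and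
  annihilates the constants. Both products with the Laplacian are then \<open>1 - P\<close>, from
  which the Penrose equations follow.\<close>

lemma laplacian_pinv: "is_pinv (laplacian \<Theta>) X"
proof -
  let ?N = "n + m" let ?L = "laplacian \<Theta>"
  have N: "?N \<noteq> 0" using pos by simp
  define P where "P = mat ?N ?N (\<lambda>_. 1 / real ?N)"
  have P [simp]: "P \<in> carrier_mat ?N ?N" by (simp add: P_def)
  have PT: "transpose_mat P = P" by (intro eq_matI) (auto simp: P_def)
  have PP: "P * P = P" using N by (intro eq_matI) (auto simp: P_def scalar_prod_def)
  have Pz: "(P *\<^sub>v z) $ a = (\<Sum>j<?N. z $ j) / real ?N" if "z \<in> carrier_vec ?N" "a < ?N" for z a
    using that by (simp add: P_def scalar_prod_def atLeast0LessThan sum_divide_distrib)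
  have LP: "?L * P = 0\<^sub>m ?N ?N"
  proof (rule eq_matI)
    fix a b assume ab: "a < dim_row (0\<^sub>m ?N ?N :: real mat)" "b < dim_col (0\<^sub>m ?N ?N :: real mat)"
    have "col P b \<in> carrier_vec ?N" by (rule carrier_vecI) (simp add: P_def)
    moreover have "edge_vec \<Theta> k i \<bullet> col P b = 0" if "(k, i) \<in> E" for k i
      using that ab edgeD[OF that] by (subst edge_vec_scalar_prod) (auto simp: P_def)
    ultimately have "unit_vec ?N a \<bullet> (?L *\<^sub>v col P b) = 0"
      by (subst laplacian_form) (auto intro!: sum.neutral)
    moreover have "unit_vec ?N a \<bullet> (?L *\<^sub>v col P b) = (?L * P) $$ (a, b)"
      using ab P laplacian_carrier by (subst scalar_prod_left_unit) (auto simp del: P laplacian_carrier)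
    ultimately show "(?L * P) $$ (a, b) = 0\<^sub>m ?N ?N $$ (a, b)" using ab by simp
  qed (use P laplacian_carrier in \<open>auto simp del: P laplacian_carrier\<close>)
  have PL: "P * ?L = 0\<^sub>m ?N ?N"
    using arg_cong[OF LP, of transpose_mat] transpose_mult[OF laplacian_carrier P]
    by (simp add: PT transpose_laplacian)
  define K where "K = ?L + P"
  have K [simp]: "K \<in> carrier_mat ?N ?N" by (simp add: K_def)
  \<comment> \<open>For a null vector \<open>v\<close> of \<open>K\<close>, the forms of the
    Laplacian and of \<open>P\<close> at \<open>v\<close> are non-negative and add up to 0. The
    first makes \<open>v\<close> constant, the second makes its entries sum to 0.\<close>
  have "det K \<noteq> 0"
  proof
    assume "det K = 0"
    then obtain v where v: "v \<in> carrier_vec ?N" "v \<noteq> 0\<^sub>v ?N" "K *\<^sub>v v = 0\<^sub>v ?N"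
      using det_0_iff_vec_prod_zero_field[OF K] by auto
    have "K *\<^sub>v v = ?L *\<^sub>v v + P *\<^sub>v v" unfolding K_def
      by (rule add_mult_distrib_mat_vec[OF laplacian_carrier P v(1)])
    then have "0 = v \<bullet> (?L *\<^sub>v v) + v \<bullet> (P *\<^sub>v v)"
      using v by (metis P laplacian_carrier mult_mat_vec_carrier scalar_prod_add_distrib scalar_prod_right_zero)
    moreover have "v \<bullet> (P *\<^sub>v v) = (\<Sum>j<?N. v $ j)\<^sup>2 / ?N"
    proof -
      have "v \<bullet> (P *\<^sub>v v) = (\<Sum>a<?N. v $ a * (P *\<^sub>v v) $ a)"
        by (rule scalar_prod_sum[OF mult_mat_vec_carrier[OF P v(1)] v(1)])
      also have "\<dots> = (\<Sum>a<?N. v $ a * ((\<Sum>j<?N. v $ j) / real ?N))" using Pz[OF v(1)] by simp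
      also have "\<dots> = (\<Sum>j<?N. v $ j) * ((\<Sum>j<?N. v $ j) / real ?N)" by (rule sum_distrib_right[symmetric])
      finally show ?thesis by (simp add: power2_eq_square)
    qed
    moreover have "v \<bullet> (?L *\<^sub>v v) = (\<Sum>(k, i)\<in>E. (edge_vec \<Theta> k i \<bullet> v)\<^sup>2)"
      using laplacian_form[OF v(1) v(1)] by (simp add: power2_eq_square)
    ultimately have zero: "0 = (\<Sum>(k, i)\<in>E. (edge_vec \<Theta> k i \<bullet> v)\<^sup>2) + (\<Sum>j<?N. v $ j)\<^sup>2 / ?N" by simp
    have ge: "(\<Sum>(k, i)\<in>E. (edge_vec \<Theta> k i \<bullet> v)\<^sup>2) \<ge> 0" "(\<Sum>j<?N. v $ j)\<^sup>2 / ?N \<ge> 0"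
      by (auto intro!: sum_nonneg divide_nonneg_nonneg)
    with zero have "(\<Sum>(k, i)\<in>E. (edge_vec \<Theta> k i \<bullet> v)\<^sup>2) = 0" "(\<Sum>j<?N. v $ j)\<^sup>2 / ?N = 0" by linarith+
    then have e: "\<forall>(k, i)\<in>E. (edge_vec \<Theta> k i \<bullet> v)\<^sup>2 = 0" and s: "(\<Sum>j<?N. v $ j) = 0"
      using N by (simp_all add: sum_nonneg_eq_0_iff finite_edges split_beta)
    have "v $ k = v $ (n + i)" if "(k, i) \<in> E" for k i
      using bspec[OF e that] edge_vec_scalar_prod[OF that v(1)] by simp
    then have const: "v $ j = v $ 0" if "j < ?N" for j
      using constant_if_edges_agree[of "\<lambda>j. v $ j" j 0] that N by auto
    then have "(\<Sum>j<?N. v $ j) = ?N * v $ 0" by simp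
    then have "v $ 0 = 0" using s N by simp
    then have "v = 0\<^sub>v ?N" using const v(1) by (intro eq_vecI) auto
    then show False using v(2) by simp
  qed
  then have "K \<in> Units (ring_mat TYPE(real) ?N ())" by (intro det_non_zero_imp_unit) auto
  then obtain Y where Y: "Y \<in> carrier_mat ?N ?N" and YK: "Y * K = 1\<^sub>m ?N" and KY: "K * Y = 1\<^sub>m ?N"
    unfolding Units_def ring_mat_def by auto
  \<comment> \<open>\<open>K\<close> acts on \<open>P\<close> as the identity from either side, and
    so does its inverse \<open>Y\<close>.\<close>
  have KP: "K * P = P" unfolding K_def
    by (simp add: add_mult_distrib_mat[OF laplacian_carrier P P] LP PP)
  have PK: "P * K = P" unfolding K_def
    by (simp add: mult_add_distrib_mat[OF P laplacian_carrier P] PL PP)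
  have YP: "Y * P = P" using assoc_mult_mat[OF Y K P] left_mult_one_mat[OF P] KP YK by simp
  have PY: "P * Y = P" using assoc_mult_mat[OF P K Y] right_mult_one_mat[OF P] PK KY by simp
  have LK: "?L = K - P" unfolding K_def by (intro eq_matI) (use P laplacian_carrier in \<open>auto simp del: P laplacian_carrier\<close>)
  have KmP: "K - P \<in> carrier_mat ?N ?N" using minus_carrier_mat[OF P] .
  define Z where "Z = Y - P"
  have Z: "Z \<in> carrier_mat ?N ?N" using minus_carrier_mat[OF P] by (simp add: Z_def)
  define I where "I = 1\<^sub>m ?N - P"
  have LZ: "?L * Z = I"
  proof -
    have "?L * Z = ?L * Y - ?L * P" unfolding Z_def by (rule mult_minus_distrib_mat[OF laplacian_carrier Y P])
    also have "?L * Y = K * Y - P * Y" unfolding LK by (rule minus_mult_distrib_mat[OF K P Y])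
    finally show ?thesis unfolding LP KY PY I_def using minus_carrier_mat[OF P] by simp
  qed
  have ZL: "Z * ?L = I"
  proof -
    have "Z * ?L = Y * ?L - P * ?L" unfolding Z_def by (rule minus_mult_distrib_mat[OF Y P laplacian_carrier])
    also have "Y * ?L = Y * K - Y * P" unfolding LK by (rule mult_minus_distrib_mat[OF Y K P])
    finally show ?thesis unfolding PL YK YP I_def using minus_carrier_mat[OF P] by simp
  qed
  have IL: "I * ?L = ?L"
    unfolding I_def minus_mult_distrib_mat[OF one_carrier_mat P laplacian_carrier] PL
    using left_mult_one_mat[OF laplacian_carrier] by simp
  have PZ: "P * Z = 0\<^sub>m ?N ?N" unfolding Z_def mult_minus_distrib_mat[OF P Y P] PY PP
    by (rule minus_r_inv_mat[OF P])
  have IZ: "I * Z = Z"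
    unfolding I_def minus_mult_distrib_mat[OF one_carrier_mat P Z] PZ
    using left_mult_one_mat[OF Z] Z by simp
  have IT: "transpose_mat I = I" unfolding I_def using PT by (simp add: transpose_minus[of _ ?N ?N])
  have "is_pinv ?L Z"
    unfolding is_pinv_def LZ ZL IL IZ IT using Z laplacian_carrier by (auto simp del: laplacian_carrier)
  then show ?thesis using pinv_eqI by simp
qed

lemma X_carrier [simp]: "X \<in> carrier_mat (n + m) (n + m)"
  and LXL: "laplacian \<Theta> * X * laplacian \<Theta> = laplacian \<Theta>"
  and XLX: "X * laplacian \<Theta> * X = X"
  using laplacian_pinv carrier_matD[OF laplacian_carrier] by (simp_all add: is_pinv_def)

lemma transpose_X: "transpose_mat X = X"
  using is_pinv_unique[OF is_pinv_transpose[OF laplacian_pinv, unfolded transpose_laplacian] laplacian_pinv] .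

section \<open>The error matrix and its residuals\<close>

lemma matC_carrier [simp]: "matC \<Theta> \<in> carrier_mat (m * d) (m * d)"
  unfolding matC_def by (rule minus_carrier_mat) (rule mult_carrier_mat[of _ _ "n + m"], rule mult_carrier_mat[of _ _ "n + m"], simp_all)

text \<open>The least-squares solution, of least norm, of the system
  \<open>z $ k - z $ (n + i) = lifted_coord \<Theta> k i \<bullet> w\<close> over the edges. For a
  column \<open>w\<close> of an alignment, its entries are one coordinate of the fitted point
  positions and of the translations of the views.\<close>

definition potential :: "real vec \<Rightarrow> real vec" where
  "potential w = X *\<^sub>v (transpose_mat (matB \<Theta>) *\<^sub>v w)"

lemma matBT_carrier [simp]: "w \<in> carrier_vec (m * d) \<Longrightarrow> transpose_mat (matB \<Theta>) *\<^sub>v w \<in> carrier_vec (n + m)"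
  by (rule mult_mat_vec_carrier[of _ _ "m * d"]) simp_all

lemma potential_carrier [simp]: "w \<in> carrier_vec (m * d) \<Longrightarrow> potential w \<in> carrier_vec (n + m)"
  unfolding potential_def by (rule mult_mat_vec_carrier[of _ _ "n + m"]) simp_all

lemma scalar_prod_X:
  "y \<in> carrier_vec (n + m) \<Longrightarrow> z \<in> carrier_vec (n + m) \<Longrightarrow> (X *\<^sub>v y) \<bullet> z = y \<bullet> (X *\<^sub>v z)"
  using transpose_vec_mult_scalar[OF X_carrier] by (simp add: transpose_X)

lemma scalar_prod_matBT:
  "w \<in> carrier_vec (m * d) \<Longrightarrow> z \<in> carrier_vec (n + m) \<Longrightarrow> (transpose_mat (matB \<Theta>) *\<^sub>v w) \<bullet> z = w \<bullet> (matB \<Theta> *\<^sub>v z)"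
  using transpose_vec_mult_scalar[OF matB_carrier] by simp

text \<open>The asymmetry is deliberate: the residual depends on \<open>w\<close> alone, so if all
  residuals vanish the form vanishes for every \<open>u\<close> at once.\<close>

lemma matC_form:
  assumes u: "u \<in> carrier_vec (m * d)" and w: "w \<in> carrier_vec (m * d)"
  shows "u \<bullet> (matC \<Theta> *\<^sub>v w) =
    (\<Sum>(k, i)\<in>E. (lifted_coord \<Theta> k i \<bullet> u) * (lifted_coord \<Theta> k i \<bullet> w - edge_vec \<Theta> k i \<bullet> potential w))"
proof -
  have BX: "matB \<Theta> * X \<in> carrier_mat (m * d) (n + m)"
    by (rule mult_carrier_mat[of _ _ "n + m"]) simp_all
  have BT: "transpose_mat (matB \<Theta>) \<in> carrier_mat (n + m) (m * d)" by simp
  have "matC \<Theta> *\<^sub>v w = matD \<Theta> *\<^sub>v w - (matB \<Theta> * X * transpose_mat (matB \<Theta>)) *\<^sub>v w"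
    unfolding matC_def by (rule minus_mult_distrib_mat_vec[OF matD_carrier mult_carrier_mat[OF BX BT] w])
  also have "(matB \<Theta> * X * transpose_mat (matB \<Theta>)) *\<^sub>v w = matB \<Theta> *\<^sub>v potential w"
    unfolding potential_def using assoc_mult_mat_vec[OF BX BT w] assoc_mult_mat_vec[OF matB_carrier X_carrier matBT_carrier[OF w]] by simp
  also have "u \<bullet> (matD \<Theta> *\<^sub>v w - matB \<Theta> *\<^sub>v potential w) = u \<bullet> (matD \<Theta> *\<^sub>v w) - u \<bullet> (matB \<Theta> *\<^sub>v potential w)"
    by (rule scalar_prod_minus_distrib[OF u mult_mat_vec_carrier[OF matD_carrier w] mult_mat_vec_carrier[OF matB_carrier potential_carrier[OF w]]])
  finally show ?thesis
    using u w by (simp add: matD_form matB_form sum_subtractf[symmetric] split_beta right_diff_distrib)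
qed

text \<open>The identity \<open>XLX\<close> makes the Laplacian form at \<open>potential w\<close>
  equal to the cross term with \<open>B\<close>. This is the normal equation tested against its own
  solution, and it completes the square in \<open>matC_form\<close>.\<close>

lemma matC_quadratic_form:
  assumes w: "w \<in> carrier_vec (m * d)"
  shows "w \<bullet> (matC \<Theta> *\<^sub>v w) = (\<Sum>(k, i)\<in>E. (lifted_coord \<Theta> k i \<bullet> w - edge_vec \<Theta> k i \<bullet> potential w)\<^sup>2)"
proof -
  let ?y = "transpose_mat (matB \<Theta>) *\<^sub>v w"
  have Xy: "X *\<^sub>v ?y \<in> carrier_vec (n + m)" using potential_carrier[OF w] by (simp add: potential_def)
  have LXy: "laplacian \<Theta> *\<^sub>v (X *\<^sub>v ?y) \<in> carrier_vec (n + m)" using mult_mat_vec_carrier[OF laplacian_carrier Xy] .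
  have "potential w \<bullet> (laplacian \<Theta> *\<^sub>v potential w) = ?y \<bullet> (X *\<^sub>v (laplacian \<Theta> *\<^sub>v (X *\<^sub>v ?y)))"
    unfolding potential_def by (rule scalar_prod_X[OF matBT_carrier[OF w] LXy])
  also have "X *\<^sub>v (laplacian \<Theta> *\<^sub>v (X *\<^sub>v ?y)) = (X * laplacian \<Theta> * X) *\<^sub>v ?y"
    using assoc_mult_mat_vec[OF X_carrier laplacian_carrier Xy]
      assoc_mult_mat_vec[OF mult_carrier_mat[OF X_carrier laplacian_carrier] X_carrier matBT_carrier[OF w]] by simp
  also have "\<dots> = potential w" by (simp add: XLX potential_def)
  also have "?y \<bullet> potential w = w \<bullet> (matB \<Theta> *\<^sub>v potential w)" by (rule scalar_prod_matBT[OF w potential_carrier[OF w]])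
  finally have eq: "(\<Sum>(k, i)\<in>E. (edge_vec \<Theta> k i \<bullet> potential w) * (edge_vec \<Theta> k i \<bullet> potential w))
     = (\<Sum>(k, i)\<in>E. (lifted_coord \<Theta> k i \<bullet> w) * (edge_vec \<Theta> k i \<bullet> potential w))"
    using w by (simp add: laplacian_form matB_form)
  have "(\<Sum>(k, i)\<in>E. (lifted_coord \<Theta> k i \<bullet> w - edge_vec \<Theta> k i \<bullet> potential w)\<^sup>2)
    = (\<Sum>(k, i)\<in>E. (lifted_coord \<Theta> k i \<bullet> w) * (lifted_coord \<Theta> k i \<bullet> w - edge_vec \<Theta> k i \<bullet> potential w))
      - (\<Sum>(k, i)\<in>E. (lifted_coord \<Theta> k i \<bullet> w) * (edge_vec \<Theta> k i \<bullet> potential w))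
      + (\<Sum>(k, i)\<in>E. (edge_vec \<Theta> k i \<bullet> potential w) * (edge_vec \<Theta> k i \<bullet> potential w))"
    unfolding sum_subtractf[symmetric] sum.distrib[symmetric]
    by (intro sum.cong) (auto simp: power2_eq_square algebra_simps)
  then show ?thesis unfolding eq by (simp add: matC_form[OF w w])
qed

lemma matC_psd: "w \<in> carrier_vec (m * d) \<Longrightarrow> w \<bullet> (matC \<Theta> *\<^sub>v w) \<ge> 0"
  by (auto simp: matC_quadratic_form intro!: sum_nonneg)

lemma matC_isotropic_edges:
  assumes w: "w \<in> carrier_vec (m * d)" and "w \<bullet> (matC \<Theta> *\<^sub>v w) = 0" and "(k, i) \<in> E"
  shows "lifted_coord \<Theta> k i \<bullet> w = edge_vec \<Theta> k i \<bullet> potential w"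
  using assms(2,3) unfolding matC_quadratic_form[OF w]
  by (subst (asm) sum_nonneg_eq_0_iff) (auto simp: finite_edges)

text \<open>An isotropic vector of a semidefinite form lies in its kernel. Here this is immediate:
  the residuals vanish and each summand of \<open>matC_form\<close> has one as a factor.\<close>

lemma matC_isotropic_kernel:
  assumes w: "w \<in> carrier_vec (m * d)" and "w \<bullet> (matC \<Theta> *\<^sub>v w) = 0"
  shows "matC \<Theta> *\<^sub>v w = 0\<^sub>v (m * d)"
proof (rule eq_vec_scalar_prodI[of _ "m * d"])
  fix u :: "real vec" assume u: "u \<in> carrier_vec (m * d)"
  have "u \<bullet> (matC \<Theta> *\<^sub>v w) = 0" unfolding matC_form[OF u w]
    using matC_isotropic_edges[OF assms] by (intro sum.neutral) auto
  then show "u \<bullet> (matC \<Theta> *\<^sub>v w) = u \<bullet> 0\<^sub>v (m * d)" using u by simp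
qed (use mult_mat_vec_carrier[OF matC_carrier w] in simp_all)

text \<open>Any exact solution \<open>z\<close> of the edge equations certifies isotropy, because by
  \<open>LXL\<close> it has the same image under the Laplacian as the potential. An alignment can
  thus be shown perfect by exhibiting point positions, with no pseudoinverse to compute.\<close>

lemma matC_isotropicI:
  assumes w: "w \<in> carrier_vec (m * d)" and z: "z \<in> carrier_vec (n + m)"
    and eq: "\<And>k i. (k, i) \<in> E \<Longrightarrow> lifted_coord \<Theta> k i \<bullet> w = edge_vec \<Theta> k i \<bullet> z"
  shows "w \<bullet> (matC \<Theta> *\<^sub>v w) = 0"
proof -
  have Lz: "laplacian \<Theta> *\<^sub>v z \<in> carrier_vec (n + m)" using mult_mat_vec_carrier[OF laplacian_carrier z] .
  have "transpose_mat (matB \<Theta>) *\<^sub>v w = laplacian \<Theta> *\<^sub>v z"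
  proof (rule eq_vec_scalar_prodI[of _ "n + m"])
    fix u :: "real vec" assume u: "u \<in> carrier_vec (n + m)"
    have "u \<bullet> (transpose_mat (matB \<Theta>) *\<^sub>v w) = w \<bullet> (matB \<Theta> *\<^sub>v u)"
      using comm_scalar_prod[OF u matBT_carrier[OF w]] scalar_prod_matBT[OF w u] by simp
    also have "\<dots> = u \<bullet> (laplacian \<Theta> *\<^sub>v z)"
      unfolding matB_form[OF w u] laplacian_form[OF u z] by (intro sum.cong) (auto simp: eq)
    finally show "u \<bullet> (transpose_mat (matB \<Theta>) *\<^sub>v w) = u \<bullet> (laplacian \<Theta> *\<^sub>v z)" .
  qed (use w Lz in simp_all)
  then have pot: "potential w = X *\<^sub>v (laplacian \<Theta> *\<^sub>v z)" by (simp add: potential_def)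
  have "laplacian \<Theta> *\<^sub>v potential w = (laplacian \<Theta> * X * laplacian \<Theta>) *\<^sub>v z"
    unfolding pot using assoc_mult_mat_vec[OF laplacian_carrier X_carrier Lz]
      assoc_mult_mat_vec[OF mult_carrier_mat[OF laplacian_carrier X_carrier] laplacian_carrier z] by simp
  then have L: "laplacian \<Theta> *\<^sub>v potential w = laplacian \<Theta> *\<^sub>v z" by (simp add: LXL)
  have "w \<bullet> (matC \<Theta> *\<^sub>v w) = (\<Sum>(k, i)\<in>E. (edge_vec \<Theta> k i \<bullet> z) * (edge_vec \<Theta> k i \<bullet> z) - (edge_vec \<Theta> k i \<bullet> z) * (edge_vec \<Theta> k i \<bullet> potential w))"
    unfolding matC_form[OF w w] by (intro sum.cong) (auto simp: eq right_diff_distrib)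
  also have "\<dots> = z \<bullet> (laplacian \<Theta> *\<^sub>v z) - z \<bullet> (laplacian \<Theta> *\<^sub>v potential w)"
    using w z by (simp add: laplacian_form sum_subtractf[symmetric] split_beta)
  finally show ?thesis by (simp add: L)
qed

lemma scalar_prod_matC_commute:
  assumes u: "u \<in> carrier_vec (m * d)" and w: "w \<in> carrier_vec (m * d)"
  shows "u \<bullet> (matC \<Theta> *\<^sub>v w) = w \<bullet> (matC \<Theta> *\<^sub>v u)"
proof -
  have "u \<bullet> (matB \<Theta> *\<^sub>v potential w) = w \<bullet> (matB \<Theta> *\<^sub>v potential u)"
    using scalar_prod_matBT[OF u potential_carrier[OF w]] scalar_prod_matBT[OF w potential_carrier[OF u]]
      scalar_prod_X[OF matBT_carrier[OF u] matBT_carrier[OF w]]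
      comm_scalar_prod[OF potential_carrier[OF u] matBT_carrier[OF w]]
    by (simp add: potential_def)
  moreover have "v \<bullet> (matC \<Theta> *\<^sub>v v') = v \<bullet> (matD \<Theta> *\<^sub>v v') - v \<bullet> (matB \<Theta> *\<^sub>v potential v')"
    if "v \<in> carrier_vec (m * d)" "v' \<in> carrier_vec (m * d)" for v v'
    using that by (simp add: matC_form matD_form matB_form sum_subtractf[symmetric] split_beta right_diff_distrib)
  moreover have "u \<bullet> (matD \<Theta> *\<^sub>v w) = w \<bullet> (matD \<Theta> *\<^sub>v u)"
    using u w by (simp add: matD_form mult.commute)
  ultimately show ?thesis using u w by simp
qed

lemma align_error_sum:
  "S \<in> carrier_mat (m * d) d \<Longrightarrow> align_error \<Theta> S = (\<Sum>b<d. col S b \<bullet> (matC \<Theta> *\<^sub>v col S b))"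
  unfolding align_error_def by (rule mtrace_gram) simp_all

lemma align_error_nonneg: "S \<in> carrier_mat (m * d) d \<Longrightarrow> align_error \<Theta> S \<ge> 0"
  by (auto simp: align_error_sum intro!: sum_nonneg matC_psd)

lemma align_error_zero_col:
  assumes S: "S \<in> carrier_mat (m * d) d" and le: "align_error \<Theta> S \<le> 0" and b: "b < d"
  shows "col S b \<bullet> (matC \<Theta> *\<^sub>v col S b) = 0"
proof -
  have ge: "col S c \<bullet> (matC \<Theta> *\<^sub>v col S c) \<ge> 0" for c using S by (intro matC_psd carrier_vecI) simp
  have "(\<Sum>b<d. col S b \<bullet> (matC \<Theta> *\<^sub>v col S b)) = 0"
    using align_error_nonneg[OF S] le align_error_sum[OF S] by simp
  then show ?thesis using b ge by (subst (asm) sum_nonneg_eq_0_iff) auto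
qed

end

subsection \<open>The orthogonal group\<close>

lemma frob_inner_sum:
  assumes "A \<in> carrier_mat r c" "B \<in> carrier_mat r c"
  shows "frob_inner A B = (\<Sum>b<c. \<Sum>a<r. A $$ (a, b) * B $$ (a, b))"
  using assms by (simp add: frob_inner_def mtrace_def scalar_prod_def atLeast0LessThan)

lemma frob_inner_transpose:
  assumes A: "A \<in> carrier_mat r c" and B: "B \<in> carrier_mat r c"
  shows "frob_inner (transpose_mat A) (transpose_mat B) = frob_inner A B"
proof -
  have "frob_inner (transpose_mat A) (transpose_mat B) = (\<Sum>b<r. \<Sum>a<c. A $$ (b, a) * B $$ (b, a))"
    using A B by (subst frob_inner_sum[of _ c r]) (auto intro!: sum.cong)
  also have "\<dots> = frob_inner A B" unfolding frob_inner_sum[OF A B] by (rule sum.swap)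
  finally show ?thesis .
qed

lemma frob_inner_mult:
  assumes "A \<in> carrier_mat r k" "B \<in> carrier_mat k c" "C \<in> carrier_mat r c"
  shows "frob_inner (A * B) C = frob_inner B (transpose_mat A * C)"
  using assms assoc_mult_mat[of "transpose_mat B" c k "transpose_mat A" r C c]
  by (simp add: frob_inner_def transpose_mult)

lemma frob_inner_minus_left:
  assumes "A \<in> carrier_mat r c" "B \<in> carrier_mat r c" "C \<in> carrier_mat r c"
  shows "frob_inner (A - B) C = frob_inner A C - frob_inner B C"
proof -
  have AB: "A - B \<in> carrier_mat r c" by (rule minus_carrier_mat[OF assms(2)])
  show ?thesis
    unfolding frob_inner_sum[OF AB assms(3)] frob_inner_sum[OF assms(1,3)] frob_inner_sum[OF assms(2,3)] sum_subtractf[symmetric]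
    using assms by (intro sum.cong refl) (auto simp: left_diff_distrib)
qed

lemma frob_inner_smult_left:
  assumes "A \<in> carrier_mat r c" "C \<in> carrier_mat r c"
  shows "frob_inner (k \<cdot>\<^sub>m A) C = k * frob_inner A C"
proof -
  have kA: "k \<cdot>\<^sub>m A \<in> carrier_mat r c" using assms(1) by simp
  show ?thesis unfolding frob_inner_sum[OF kA assms(2)] frob_inner_sum[OF assms] sum_distrib_left
    using assms by (intro sum.cong refl) auto
qed

lemma frob_inner_uminus_right:
  assumes "A \<in> carrier_mat r c" "C \<in> carrier_mat r c"
  shows "frob_inner A (- C) = - frob_inner A C"
proof -
  have C: "- C \<in> carrier_mat r c" using assms(2) by (rule uminus_carrier_mat)
  show ?thesis
    unfolding frob_inner_sum[OF assms(1) C] frob_inner_sum[OF assms] sum_negf[symmetric]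
    using assms by (intro sum.cong refl) auto
qed

lemma frob_inner_zero_left:
  "C \<in> carrier_mat r c \<Longrightarrow> frob_inner (0\<^sub>m r c) C = 0"
  by (simp add: frob_inner_sum[of _ r c])

lemma frob_inner_self_zero:
  assumes A: "A \<in> carrier_mat r c" and "frob_inner A A = 0"
  shows "A = 0\<^sub>m r c"
proof -
  have "\<forall>b<c. (\<Sum>a<r. A $$ (a, b) * A $$ (a, b)) = 0"
    using assms(2) unfolding frob_inner_sum[OF A A]
    by (subst (asm) sum_nonneg_eq_0_iff) (auto intro!: sum_nonneg)
  then have "A $$ (a, b) = 0" if "a < r" "b < c" for a b
    using that by (auto simp: sum_nonneg_eq_0_iff)
  then show ?thesis using A by (intro eq_matI) auto
qed

section \<open>Stacks of square blocks\<close>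

lemma block_carrier [simp]: "block d S i \<in> carrier_mat d d"
  by (simp add: block_def)

lemma block_index [simp]: "a < d \<Longrightarrow> b < d \<Longrightarrow> block d S i $$ (a, b) = S $$ (i * d + a, b)"
  by (simp add: block_def)

lemma dim_block [simp]: "dim_row (block d S i) = d" "dim_col (block d S i) = d"
  by (simp_all add: block_def)

lemma vstack_carrier [simp]: "vstack d N f \<in> carrier_mat (N * d) d"
  by (simp add: vstack_def)

lemma vstack_index:
  assumes "i < N" "a < d" "b < d"
  shows "vstack d N f $$ (i * d + a, b) = f i $$ (a, b)"
  using assms block_index_less[OF assms(1,2)] by (simp add: vstack_def)

lemma block_vstack:
  assumes "i < N" "f i \<in> carrier_mat d d"
  shows "block d (vstack d N f) i = f i"
  using assms by (intro eq_matI) (auto simp: vstack_index)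

lemma stacked_index_cases:
  assumes "r < N * (d::nat)"
  obtains i a where "i < N" "a < d" "r = i * d + a"
proof
  show "r div d < N" using assms by (simp add: less_mult_imp_div_less)
  show "r mod d < d" using assms by (intro mod_less_divisor) (cases d; simp)
qed simp

lemma stacked_eqI:
  assumes "S \<in> carrier_mat (N * d) d" "T \<in> carrier_mat (N * d) d"
    and "\<And>i. i < N \<Longrightarrow> block d S i = block d T i"
  shows "S = T"
proof (rule eq_matI)
  fix r b assume rb: "r < dim_row T" "b < dim_col T"
  then obtain i a where i: "i < N" "a < d" "r = i * d + a"
    using assms(2) by (auto elim: stacked_index_cases)
  have "block d S i $$ (a, b) = block d T i $$ (a, b)" using assms(3)[OF i(1)] by simp
  then show "S $$ (r, b) = T $$ (r, b)" using i rb assms(2) by simp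
qed (use assms in auto)

lemma frob_inner_blocks:
  assumes A: "A \<in> carrier_mat (N * d) d" and B: "B \<in> carrier_mat (N * d) d"
  shows "frob_inner A B = (\<Sum>i<N. frob_inner (block d A i) (block d B i))"
proof -
  have "frob_inner A B = (\<Sum>b<d. \<Sum>i<N. \<Sum>a<d. A $$ (i * d + a, b) * B $$ (i * d + a, b))"
    unfolding frob_inner_sum[OF A B] sum_blocks ..
  also have "\<dots> = (\<Sum>i<N. \<Sum>b<d. \<Sum>a<d. A $$ (i * d + a, b) * B $$ (i * d + a, b))"
    by (rule sum.swap)
  also have "\<dots> = (\<Sum>i<N. frob_inner (block d A i) (block d B i))"
    by (simp add: frob_inner_sum[of _ d d])
  finally show ?thesis .
qed

section \<open>Orthogonal matrices\<close>

lemma orthogonal_group_carrier: "Q \<in> orthogonal_group d \<Longrightarrow> Q \<in> carrier_mat d d"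
  and orthogonal_group_transpose_mult: "Q \<in> orthogonal_group d \<Longrightarrow> transpose_mat Q * Q = 1\<^sub>m d"
  by (simp_all add: orthogonal_group_def)

lemma orthogonal_group_mult_transpose: "Q \<in> orthogonal_group d \<Longrightarrow> Q * transpose_mat Q = 1\<^sub>m d"
  unfolding orthogonal_group_def by (elim CollectE conjE) (rule mat_mult_left_right_inverse[of "transpose_mat Q" d], simp_all)

lemma orthogonal_group_mult:
  assumes "P \<in> orthogonal_group d" "Q \<in> orthogonal_group d"
  shows "P * Q \<in> orthogonal_group d"
proof -
  note [simp] = orthogonal_group_carrier[OF assms(1)] orthogonal_group_carrier[OF assms(2)]
  have PQ: "P * Q \<in> carrier_mat d d" by (rule mult_carrier_mat[of _ _ d]) simp_all
  have "transpose_mat (P * Q) * (P * Q) = transpose_mat Q * transpose_mat P * (P * Q)"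
    by (subst transpose_mult[of _ d d _ d]) simp_all
  also have "\<dots> = transpose_mat Q * (transpose_mat P * (P * Q))"
    by (rule assoc_mult_mat[of _ d d _ d _ d]) (simp_all add: PQ)
  also have "transpose_mat P * (P * Q) = (transpose_mat P * P) * Q"
    by (rule assoc_mult_mat[of _ d d _ d _ d, symmetric]) simp_all
  finally show ?thesis using assms left_mult_one_mat[of Q d d] PQ by (simp add: orthogonal_group_def)
qed

text \<open>With \<open>R\<close> half of \<open>A\<close>, the curve is the Cayley transform, the
  inverse of \<open>1 - t R\<close> times \<open>1 + t R\<close>, written as \<open>2 Y - 1\<close>
  where \<open>Y\<close> is that inverse. Unlike the exponential it needs no power series, only
  invertibility and the derivative of an inverse at 0.\<close>

lemma skew_curve:
  assumes A: "A \<in> carrier_mat d d" and skew: "transpose_mat A = - A"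
  shows "\<exists>Q. (\<forall>t. Q t \<in> orthogonal_group d) \<and> Q 0 = 1\<^sub>m d \<and>
    (\<forall>a<d. \<forall>b<d. ((\<lambda>t. Q t $$ (a, b)) has_real_derivative A $$ (a, b)) (at (0::real)))"
proof -
  \<comment> \<open>Halved because the derivative of \<open>2 Y - 1\<close> at 0 is
    \<open>2 R\<close>.\<close>
  define R where "R = (1/2) \<cdot>\<^sub>m A"
  have R: "R \<in> carrier_mat d d" using A by (simp add: R_def)
  have Aab: "A $$ (b, a) = - A $$ (a, b)" if "a < d" "b < d" for a b
    using arg_cong[OF skew, of "\<lambda>B. B $$ (a, b)"] that A by simp
  have RT: "transpose_mat R = - R"
  proof (rule eq_matI)
    fix a b assume "a < dim_row (- R)" "b < dim_col (- R)"
    then show "transpose_mat R $$ (a, b) = (- R) $$ (a, b)" using A Aab[of a b] by (simp add: R_def)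
  qed (use R in simp_all)
  have Rskew: "u \<bullet> (R *\<^sub>v v) = - (v \<bullet> (R *\<^sub>v u))" if u: "u \<in> carrier_vec d" and v: "v \<in> carrier_vec d" for u v
  proof -
    have Ru: "R *\<^sub>v u \<in> carrier_vec d" using mult_mat_vec_carrier[OF R u] .
    have "u \<bullet> (R *\<^sub>v v) = (- R *\<^sub>v u) \<bullet> v" using transpose_vec_mult_scalar[OF R v u] by (simp add: RT)
    also have "\<dots> = v \<bullet> (- R *\<^sub>v u)" using R by (intro comm_scalar_prod[OF _ v]) (simp add: mult_mat_vec_carrier[OF _ u])
    also have "- R *\<^sub>v u = - (R *\<^sub>v u)" using R u by (intro eq_vecI) (auto simp: scalar_prod_def sum_negf)
    also have "v \<bullet> (- (R *\<^sub>v u)) = - (v \<bullet> (R *\<^sub>v u))" using v Ru by (simp add: scalar_prod_def sum_negf)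
    finally show ?thesis .
  qed
  define M where "M t = 1\<^sub>m d - t \<cdot>\<^sub>m R" for t
  have M: "M t \<in> carrier_mat d d" for t using R by (auto simp: M_def)
  have Mv: "u \<bullet> (M t *\<^sub>v v) = u \<bullet> v - t * (u \<bullet> (R *\<^sub>v v))" if u: "u \<in> carrier_vec d" and v: "v \<in> carrier_vec d" for t u v
  proof -
    have Rv: "R *\<^sub>v v \<in> carrier_vec d" using mult_mat_vec_carrier[OF R v] .
    have "M t *\<^sub>v v = v - t \<cdot>\<^sub>v (R *\<^sub>v v)"
      unfolding M_def using R v by (subst minus_mult_distrib_mat_vec[of _ d d]) auto
    then show ?thesis using u v Rv by (simp add: scalar_prod_minus_distrib[of _ d])
  qed
  have "\<exists>Y. Y \<in> carrier_mat d d \<and> Y * M t = 1\<^sub>m d \<and> M t * Y = 1\<^sub>m d" for t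
  proof -
    \<comment> \<open>Skewness gives \<open>v \<bullet> (R *\<^sub>v v) = 0\<close>, so the form of
      \<open>M t\<close> at \<open>v\<close> is \<open>v \<bullet> v\<close> for every real
      \<open>t\<close>. The curve is therefore defined for all times, as
      \<open>curve_through\<close> demands.\<close>
    have "det (M t) \<noteq> 0"
    proof
      assume "det (M t) = 0"
      then obtain v where v: "v \<in> carrier_vec d" "v \<noteq> 0\<^sub>v d" "M t *\<^sub>v v = 0\<^sub>v d"
        using det_0_iff_vec_prod_zero_field[OF M] by auto
      have "v \<bullet> v = 0" using Mv[OF v(1) v(1), of t] Rskew[OF v(1) v(1)] v(1,3) by simp
      then have "v = 0\<^sub>v d" using v(1)
        by (intro eq_vecI) (auto simp: scalar_prod_def sum_nonneg_eq_0_iff)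
      then show False using v(2) by simp
    qed
    then have "M t \<in> Units (ring_mat TYPE(real) d ())" by (intro det_non_zero_imp_unit M)
    then show ?thesis unfolding Units_def ring_mat_def by auto
  qed
  then obtain Y where Y: "\<And>t. Y t \<in> carrier_mat d d" and YM: "\<And>t. Y t * M t = 1\<^sub>m d"
    and MY: "\<And>t. M t * Y t = 1\<^sub>m d" by metis
  have cY: "col (Y t) b \<in> carrier_vec d" for t b using Y by (intro carrier_vecI) (metis carrier_matD(1) dim_col)
  have MYcol: "M t *\<^sub>v col (Y t) b = unit_vec d b" if "b < d" for t b
    using that col_mult2[OF M Y, of b t t] MY by (metis col_one)
  have gram: "col (Y t) b \<bullet> col (Y t) c - t * (col (Y t) b \<bullet> (R *\<^sub>v col (Y t) c)) = Y t $$ (c, b)"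
    if "b < d" "c < d" for t b c
  proof -
    have "col (Y t) b \<bullet> (M t *\<^sub>v col (Y t) c) = Y t $$ (c, b)"
      unfolding MYcol[OF that(2)] using that Y[of t] cY by (simp add: scalar_prod_right_unit[of _ d])
    then show ?thesis using Mv[of "col (Y t) b" "col (Y t) c" t, OF cY cY] by simp
  qed
  \<comment> \<open>Adding \<open>gram\<close> to itself with \<open>b\<close> and \<open>c\<close>
    exchanged cancels the skew part. In matrix form twice \<open>Y\<close> transposed times
    \<open>Y\<close> is \<open>Y\<close> plus its transpose; this yields both the bound on
    \<open>Y\<close> and the orthogonality of \<open>2 Y - 1\<close>.\<close>
  have gram2: "2 * (col (Y t) b \<bullet> col (Y t) c) = Y t $$ (c, b) + Y t $$ (b, c)" if "b < d" "c < d" for t b c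
    using gram[OF that, of t] gram[OF that(2,1), of t] Rskew[of "col (Y t) b" "col (Y t) c", OF cY cY]
      comm_scalar_prod[of "col (Y t) b" d "col (Y t) c", OF cY cY] by simp
  \<comment> \<open>The diagonal case of \<open>gram2\<close> equates the squared length of column
    \<open>b\<close> with the entry \<open>Y t $$ (b, b)\<close>. That entry is then at most 1,
    since its square does not exceed it, and so are the squares of all entries of the
    column.\<close>
  have bound: "\<bar>Y t $$ (a, b)\<bar> \<le> 1" if "a < d" "b < d" for t a b
  proof -
    have "(\<Sum>a<d. (Y t $$ (a, b))\<^sup>2) = Y t $$ (b, b)"
      using gram2[OF that(2) that(2), of t] Y[of t] that by (simp add: scalar_prod_def power2_eq_square atLeast0LessThan)
    moreover have "(Y t $$ (c, b))\<^sup>2 \<le> (\<Sum>a<d. (Y t $$ (a, b))\<^sup>2)" if "c < d" for c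
      using that by (intro member_le_sum) auto
    ultimately have sq: "(Y t $$ (c, b))\<^sup>2 \<le> Y t $$ (b, b)" if "c < d" for c using that by simp
    have "Y t $$ (b, b) \<le> 1"
    proof (rule ccontr)
      assume "\<not> Y t $$ (b, b) \<le> 1"
      then have "Y t $$ (b, b) * 1 < Y t $$ (b, b) * Y t $$ (b, b)" by (intro mult_strict_left_mono) auto
      then show False using sq[OF that(2)] by (simp add: power2_eq_square)
    qed
    then have "(Y t $$ (a, b))\<^sup>2 \<le> 1" using sq[OF that(1)] by linarith
    then show ?thesis by (simp add: abs_square_le_1)
  qed
  \<comment> \<open>The identity \<open>Y = 1 + t R Y\<close>, read entrywise. With the bound
    uniform in \<open>t\<close> it gives continuity at 0, without any formula for the
    inverse.\<close>
  have expand: "Y t $$ (a, b) = 1\<^sub>m d $$ (a, b) + t * (\<Sum>c<d. R $$ (a, c) * Y t $$ (c, b))" if ab: "a < d" "b < d" for t a b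
  proof -
    have "unit_vec d a \<bullet> (M t *\<^sub>v col (Y t) b) = 1\<^sub>m d $$ (a, b)"
      unfolding MYcol[OF ab(2)] using ab by simp
    moreover have "unit_vec d a \<bullet> (M t *\<^sub>v col (Y t) b) = Y t $$ (a, b) - t * (\<Sum>c<d. R $$ (a, c) * Y t $$ (c, b))"
      using Mv[of "unit_vec d a" "col (Y t) b" t, OF unit_vec_carrier cY] ab cY Y[of t] R by (simp add: scalar_prod_def[of "row _ _"] atLeast0LessThan)
    ultimately show ?thesis by simp
  qed
  have Y0: "Y 0 $$ (a, b) = 1\<^sub>m d $$ (a, b)" if "a < d" "b < d" for a b using expand[OF that, of 0] by simp
  have cont: "isCont (\<lambda>t. Y t $$ (a, b)) 0" if ab: "a < d" "b < d" for a b
  proof -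
    have "((\<lambda>t. t * (\<Sum>c<d. R $$ (a, c) * Y t $$ (c, b))) \<longlongrightarrow> 0) (at 0)"
    proof (rule tendsto_0_le)
      show "\<forall>\<^sub>F t in at 0. norm (t * (\<Sum>c<d. R $$ (a, c) * Y t $$ (c, b))) \<le> norm t * (\<Sum>c<d. \<bar>R $$ (a, c)\<bar>)"
      proof (intro always_eventually allI)
        fix t
        have "\<bar>\<Sum>c<d. R $$ (a, c) * Y t $$ (c, b)\<bar> \<le> (\<Sum>c<d. \<bar>R $$ (a, c) * Y t $$ (c, b)\<bar>)" by (rule sum_abs)
        also have "\<dots> \<le> (\<Sum>c<d. \<bar>R $$ (a, c)\<bar>)"
          using bound ab by (intro sum_mono) (auto simp: abs_mult intro: mult_left_le)
        finally show "norm (t * (\<Sum>c<d. R $$ (a, c) * Y t $$ (c, b))) \<le> norm t * (\<Sum>c<d. \<bar>R $$ (a, c)\<bar>)"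
          by (simp add: abs_mult mult_left_mono)
      qed
      show "((\<lambda>t. t) \<longlongrightarrow> (0 :: real)) (at 0)" by (rule tendsto_ident_at)
    qed
    then have "((\<lambda>t. 1\<^sub>m d $$ (a, b) + t * (\<Sum>c<d. R $$ (a, c) * Y t $$ (c, b))) \<longlongrightarrow> 1\<^sub>m d $$ (a, b) + 0) (at 0)"
      by (intro tendsto_add tendsto_const)
    then show ?thesis unfolding isCont_def Y0[OF ab] using expand[OF ab, symmetric] by simp
  qed
  \<comment> \<open>Caratheodory's criterion: by \<open>expand\<close> the difference quotient is an
    entry of \<open>R Y\<close>, which is continuous at 0 with value the entry of
    \<open>R\<close>.\<close>
  have deriv: "((\<lambda>t. Y t $$ (a, b)) has_real_derivative R $$ (a, b)) (at 0)" if ab: "a < d" "b < d" for a b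
    unfolding CARAT_DERIV
  proof (intro exI conjI allI)
    let ?g = "\<lambda>t. \<Sum>c<d. R $$ (a, c) * Y t $$ (c, b)"
    show "Y t $$ (a, b) - Y 0 $$ (a, b) = ?g t * (t - 0)" for t
      using expand[OF ab, of t] by (simp add: Y0[OF ab])
    show "isCont ?g 0" using cont ab by (intro continuous_intros) auto
    have "?g 0 = (\<Sum>c<d. if c = b then R $$ (a, c) else 0)"
      using ab by (intro sum.cong refl) (simp add: Y0)
    then show "?g 0 = R $$ (a, b)" using ab by simp
  qed
  define Q where "Q t = 2 \<cdot>\<^sub>m Y t - 1\<^sub>m d" for t
  have Q: "Q t \<in> carrier_mat d d" for t using Y by (auto simp: Q_def)
  have Qi: "Q t $$ (a, b) = 2 * Y t $$ (a, b) - 1\<^sub>m d $$ (a, b)" if "a < d" "b < d" for t a b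
    using that Y[of t] by (simp add: Q_def)
  show ?thesis
  proof (intro exI[of _ Q] conjI allI impI)
    fix t
    have "transpose_mat (Q t) * Q t = 1\<^sub>m d"
    proof (rule eq_matI)
      fix b c assume bc: "b < dim_row (1\<^sub>m d :: real mat)" "c < dim_col (1\<^sub>m d :: real mat)"
      then have bc: "b < d" "c < d" by auto
      have Qcol: "col (Q t) a = 2 \<cdot>\<^sub>v col (Y t) a - unit_vec d a" if "a < d" for a
        using that Y[of t] by (intro eq_vecI) (auto simp: Q_def unit_vec_def)
      have "(transpose_mat (Q t) * Q t) $$ (b, c) = col (Q t) b \<bullet> col (Q t) c" using bc Q[of t] by simp
      also have "\<dots> = 4 * (col (Y t) b \<bullet> col (Y t) c) - 2 * Y t $$ (c, b) - 2 * Y t $$ (b, c) + unit_vec d b \<bullet> unit_vec d c"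
        unfolding Qcol[OF bc(1)] Qcol[OF bc(2)] using cY[of t] bc Y[of t]
        by (simp add: scalar_prod_minus_distrib[of _ d] minus_scalar_prod_distrib[of _ d] algebra_simps)
      also have "\<dots> = 1\<^sub>m d $$ (b, c)" using gram2[OF bc, of t] bc by (cases "b = c") auto
      finally show "(transpose_mat (Q t) * Q t) $$ (b, c) = 1\<^sub>m d $$ (b, c)" .
    qed (use Q[of t] in auto)
    then show "Q t \<in> orthogonal_group d" using Q by (simp add: orthogonal_group_def)
  next
    show "Q 0 = 1\<^sub>m d" using Q[of 0] by (intro eq_matI) (auto simp: Qi Y0)
  next
    fix a b assume ab: "a < d" "b < d"
    have "((\<lambda>t. 2 * Y t $$ (a, b) - 1\<^sub>m d $$ (a, b)) has_real_derivative 2 * R $$ (a, b) - 0) (at 0)"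
      by (intro DERIV_diff DERIV_cmult deriv ab DERIV_const)
    then show "((\<lambda>t. Q t $$ (a, b)) has_real_derivative A $$ (a, b)) (at 0)"
      using ab A by (simp add: Qi R_def)
  qed
qed

subsection \<open>Tangent spaces of powers of the orthogonal group\<close>

text \<open>The tangent space of a power of the orthogonal group, by linear equations:
  differentiating the orthogonality of each block \<open>q_i\<close> makes \<open>q_i\<close>
  transposed times \<open>V_i\<close> skew.\<close>

definition tangent_blocks :: "nat \<Rightarrow> nat \<Rightarrow> real mat \<Rightarrow> real mat set" where
  "tangent_blocks d N q = {V \<in> carrier_mat (N * d) d. \<forall>i<N.
     transpose_mat (block d V i) * block d q i = - (transpose_mat (block d q i) * block d V i)}"

lemma orthogonal_powerD:
  assumes "q \<in> orthogonal_power d N"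
  shows "q \<in> carrier_mat (N * d) d" "i < N \<Longrightarrow> block d q i \<in> orthogonal_group d"
  using assms by (simp_all add: orthogonal_power_def)

lemma curve_throughD:
  assumes "curve_through (orthogonal_power d N) q V \<gamma>"
  shows "q \<in> orthogonal_power d N" "\<gamma> t \<in> orthogonal_power d N" "\<gamma> 0 = q" "V \<in> carrier_mat (N * d) d"
    "r < N * d \<Longrightarrow> b < d \<Longrightarrow> ((\<lambda>t. \<gamma> t $$ (r, b)) has_real_derivative V $$ (r, b)) (at 0)"
proof -
  have a: "\<forall>t. \<gamma> t \<in> orthogonal_power d N" "\<gamma> 0 = q" and h: "has_mat_derivative \<gamma> V 0"
    using assms by (simp_all add: curve_through_def)
  show q: "q \<in> orthogonal_power d N" "\<gamma> t \<in> orthogonal_power d N" "\<gamma> 0 = q" using a by auto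
  show V: "V \<in> carrier_mat (N * d) d" using h orthogonal_powerD(1)[OF q(1)] a(2) by (simp add: has_mat_derivative_def)
  show "r < N * d \<Longrightarrow> b < d \<Longrightarrow> ((\<lambda>t. \<gamma> t $$ (r, b)) has_real_derivative V $$ (r, b)) (at 0)"
    using h V by (simp add: has_mat_derivative_def)
qed

lemma curve_velocity_tangent:
  assumes c: "curve_through (orthogonal_power d N) q V \<gamma>"
  shows "V \<in> tangent_blocks d N q"
proof -
  note D = curve_throughD[OF c]
  have "transpose_mat (block d V i) * block d q i = - (transpose_mat (block d q i) * block d V i)"
    if i: "i < N" for i
  proof (rule eq_matI)
    fix b c
    assume "b < dim_row (- (transpose_mat (block d q i) * block d V i))"
      "c < dim_col (- (transpose_mat (block d q i) * block d V i))"
    then have bc: "b < d" "c < d" by simp_all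
    have r: "i * d + a < N * d" if "a < d" for a using block_index_less[OF i that] .
    have const: "(\<Sum>a<d. \<gamma> t $$ (i * d + a, b) * \<gamma> t $$ (i * d + a, c)) = 1\<^sub>m d $$ (b, c)" for t
    proof -
      have "(transpose_mat (block d (\<gamma> t) i) * block d (\<gamma> t) i) $$ (b, c) = 1\<^sub>m d $$ (b, c)"
        using orthogonal_group_transpose_mult[OF orthogonal_powerD(2)[OF D(2) i]] by simp
      then show ?thesis using bc by (simp add: scalar_prod_def atLeast0LessThan)
    qed
    have "((\<lambda>t. \<Sum>a<d. \<gamma> t $$ (i * d + a, b) * \<gamma> t $$ (i * d + a, c)) has_real_derivative
      (\<Sum>a<d. V $$ (i * d + a, b) * \<gamma> 0 $$ (i * d + a, c) + V $$ (i * d + a, c) * \<gamma> 0 $$ (i * d + a, b))) (at 0)"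
      using bc by (intro DERIV_sum DERIV_mult D(5) r) auto
    then have "(\<Sum>a<d. V $$ (i * d + a, b) * q $$ (i * d + a, c) + V $$ (i * d + a, c) * q $$ (i * d + a, b)) = 0"
      unfolding const D(3) using DERIV_unique DERIV_const by blast
    then show "(transpose_mat (block d V i) * block d q i) $$ (b, c)
      = (- (transpose_mat (block d q i) * block d V i)) $$ (b, c)"
      using bc by (simp add: scalar_prod_def atLeast0LessThan sum.distrib mult.commute)
  qed simp_all
  then show ?thesis using D(4) by (simp add: tangent_blocks_def)
qed

text \<open>In each block a Cayley curve at the identity, with velocity \<open>q_i\<close>
  transposed times \<open>V_i\<close>, is translated to \<open>q_i\<close> by left multiplication.
  The translated velocity is \<open>V_i\<close>, as \<open>q_i\<close> times its transpose is the
  identity.\<close>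

lemma tangent_blocks_curve:
  assumes q: "q \<in> orthogonal_power d N" and V: "V \<in> tangent_blocks d N q"
  shows "\<exists>\<gamma>. curve_through (orthogonal_power d N) q V \<gamma>"
proof -
  note qc = orthogonal_powerD(1)[OF q] and qo = orthogonal_powerD(2)[OF q]
  have Vc: "V \<in> carrier_mat (N * d) d" using V by (simp add: tangent_blocks_def)
  let ?A = "\<lambda>i. transpose_mat (block d q i) * block d V i"
  have "\<exists>Q. (\<forall>t. Q t \<in> orthogonal_group d) \<and> Q 0 = 1\<^sub>m d \<and>
    (\<forall>a<d. \<forall>b<d. ((\<lambda>t. Q t $$ (a, b)) has_real_derivative ?A i $$ (a, b)) (at (0::real)))" if "i < N" for i
  proof (rule skew_curve)
    show "?A i \<in> carrier_mat d d" by (rule mult_carrier_mat[of _ _ d]) simp_all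
    have "transpose_mat (?A i) = transpose_mat (block d V i) * block d q i"
      by (subst transpose_mult[of _ d d _ d]) simp_all
    then show "transpose_mat (?A i) = - ?A i" using V that by (simp add: tangent_blocks_def)
  qed
  then obtain Q where Q: "\<And>i t. i < N \<Longrightarrow> Q i t \<in> orthogonal_group d" "\<And>i. i < N \<Longrightarrow> Q i 0 = 1\<^sub>m d"
    "\<And>i a b. i < N \<Longrightarrow> a < d \<Longrightarrow> b < d \<Longrightarrow> ((\<lambda>t. Q i t $$ (a, b)) has_real_derivative ?A i $$ (a, b)) (at (0::real))"
    by metis
  define \<gamma> where "\<gamma> t = vstack d N (\<lambda>i. block d q i * Q i t)" for t :: real
  have orth: "block d q i * Q i t \<in> orthogonal_group d" if "i < N" for i t
    using orthogonal_group_mult[OF qo[OF that] Q(1)[OF that]] .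
  have \<gamma>b: "block d (\<gamma> t) i = block d q i * Q i t" if "i < N" for i t
    unfolding \<gamma>_def using that orthogonal_group_carrier[OF orth[OF that]] by (intro block_vstack)
  have \<gamma>c: "\<gamma> t \<in> carrier_mat (N * d) d" for t by (simp add: \<gamma>_def)
  have "\<gamma> t \<in> orthogonal_power d N" for t
    unfolding orthogonal_power_def using \<gamma>c \<gamma>b orth by auto
  moreover have "\<gamma> 0 = q"
  proof (rule stacked_eqI[OF \<gamma>c qc])
    fix i assume "i < N"
    then show "block d (\<gamma> 0) i = block d q i" using \<gamma>b Q(2) right_mult_one_mat[OF block_carrier] by simp
  qed
  moreover have "has_mat_derivative \<gamma> V 0" unfolding has_mat_derivative_def
  proof (intro conjI allI impI)
    show "V \<in> carrier_mat (dim_row (\<gamma> 0)) (dim_col (\<gamma> 0))" using \<gamma>c[of 0] Vc by simp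
    fix r b assume "r < dim_row V" "b < dim_col V"
    then obtain i a where i: "i < N" "a < d" "r = i * d + a" and b: "b < d"
      using Vc by (auto elim: stacked_index_cases)
    have Qc: "Q i t \<in> carrier_mat d d" for t using orthogonal_group_carrier Q(1) i by blast
    have "\<gamma> t $$ (r, b) = (\<Sum>c<d. block d q i $$ (a, c) * Q i t $$ (c, b))" for t
      unfolding \<gamma>_def i(3) vstack_index[OF i(1,2) b] using i b Qc[of t] by (simp add: scalar_prod_def atLeast0LessThan)
    moreover have "((\<lambda>t. \<Sum>c<d. block d q i $$ (a, c) * Q i t $$ (c, b)) has_real_derivative
      (\<Sum>c<d. block d q i $$ (a, c) * ?A i $$ (c, b))) (at 0)"
      using Q(3) i b by (intro DERIV_sum DERIV_cmult) auto
    moreover have "(\<Sum>c<d. block d q i $$ (a, c) * ?A i $$ (c, b)) = V $$ (r, b)"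
    proof -
      have "block d q i * ?A i = (block d q i * transpose_mat (block d q i)) * block d V i"
        by (rule assoc_mult_mat[of _ d d _ d _ d, symmetric]) simp_all
      also have "\<dots> = block d V i"
        unfolding orthogonal_group_mult_transpose[OF qo[OF i(1)]] by (rule left_mult_one_mat[of _ d d]) simp
      finally have "(block d q i * ?A i) $$ (a, b) = block d V i $$ (a, b)" by simp
      moreover have "?A i \<in> carrier_mat d d" by (rule mult_carrier_mat[of _ _ d]) simp_all
      ultimately show ?thesis using i b by (simp add: scalar_prod_def[of _ "col (_ * _) _"] atLeast0LessThan)
    qed
    ultimately show "((\<lambda>s. \<gamma> s $$ (r, b)) has_real_derivative V $$ (r, b)) (at 0)" by simp
  qed
  ultimately show ?thesis unfolding curve_through_def by blast
qed

lemma tangent_space_orthogonal_power: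
  assumes "q \<in> orthogonal_power d N"
  shows "tangent_space (orthogonal_power d N) q = tangent_blocks d N q"
  unfolding tangent_space_def using curve_velocity_tangent tangent_blocks_curve[OF assms] by blast

lemma block_minus:
  assumes "A \<in> carrier_mat (N * d) d" "B \<in> carrier_mat (N * d) d" "i < N"
  shows "block d (A - B) i = block d A i - block d B i"
  using assms block_index_less[OF assms(3)] by (intro eq_matI) auto

lemma tangent_blocks_minus:
  assumes "A \<in> tangent_blocks d N q" "B \<in> tangent_blocks d N q"
  shows "A - B \<in> tangent_blocks d N q"
proof -
  have A: "A \<in> carrier_mat (N * d) d" and B: "B \<in> carrier_mat (N * d) d" using assms by (auto simp: tangent_blocks_def)
  have "transpose_mat (block d (A - B) i) * block d q i = - (transpose_mat (block d q i) * block d (A - B) i)"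
    if i: "i < N" for i
  proof -
    let ?q = "block d q i" let ?a = "block d A i" let ?b = "block d B i"
    have "transpose_mat (?a - ?b) * ?q = transpose_mat ?a * ?q - transpose_mat ?b * ?q"
      by (simp add: transpose_minus[of _ d d] minus_mult_distrib_mat[of _ d d _ _ d])
    also have "transpose_mat ?a * ?q = - (transpose_mat ?q * ?a)" using assms(1) i by (simp add: tangent_blocks_def)
    also have "transpose_mat ?b * ?q = - (transpose_mat ?q * ?b)" using assms(2) i by (simp add: tangent_blocks_def)
    also have "- (transpose_mat ?q * ?a) - - (transpose_mat ?q * ?b) = - (transpose_mat ?q * ?a - transpose_mat ?q * ?b)"
      by (intro eq_matI) simp_all
    also have "transpose_mat ?q * ?a - transpose_mat ?q * ?b = transpose_mat ?q * (?a - ?b)"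
      by (rule mult_minus_distrib_mat[of _ d d _ d, symmetric]) simp_all
    finally show ?thesis using block_minus[OF A B i] by simp
  qed
  then show ?thesis using minus_carrier_mat[OF B] by (simp add: tangent_blocks_def)
qed

text \<open>It suffices to test against \<open>A - B\<close>, which is again tangent. This is the
  uniqueness half of the descriptions that define gradient and Hessian.\<close>

lemma tangent_blocks_eqI:
  assumes A: "A \<in> tangent_blocks d N q" and B: "B \<in> tangent_blocks d N q"
    and eq: "\<And>W. W \<in> tangent_blocks d N q \<Longrightarrow> frob_inner A W = frob_inner B W"
  shows "A = B"
proof -
  have AB: "A - B \<in> tangent_blocks d N q" using tangent_blocks_minus[OF A B] .
  have c: "A \<in> carrier_mat (N * d) d" "B \<in> carrier_mat (N * d) d" "A - B \<in> carrier_mat (N * d) d"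
    using A B AB by (auto simp: tangent_blocks_def)
  have "frob_inner (A - B) (A - B) = 0" using frob_inner_minus_left[OF c] eq[OF AB] by simp
  from frob_inner_self_zero[OF c(3) this] have z: "A - B = 0\<^sub>m (N * d) d" .
  show ?thesis
  proof (rule eq_matI)
    fix i j assume "i < dim_row B" "j < dim_col B"
    then show "A $$ (i, j) = B $$ (i, j)" using arg_cong[OF z, of "\<lambda>M. M $$ (i, j)"] c by simp
  qed (use c in auto)
qed

text \<open>Orthogonal projection onto the tangent space: block \<open>i\<close> is
  \<open>q_i\<close> times the skew part of \<open>q_i\<close> transposed times \<open>G_i\<close>,
  with the first product multiplied out.\<close>

definition tangent_proj :: "nat \<Rightarrow> nat \<Rightarrow> real mat \<Rightarrow> real mat \<Rightarrow> real mat" where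
  "tangent_proj d N q G = vstack d N (\<lambda>i. (1/2) \<cdot>\<^sub>m
     (block d G i - block d q i * (transpose_mat (block d G i) * block d q i)))"

lemma tangent_proj_carrier [simp]: "tangent_proj d N q G \<in> carrier_mat (N * d) d"
  by (simp add: tangent_proj_def)

lemma block_tangent_proj:
  "i < N \<Longrightarrow> block d (tangent_proj d N q G) i = (1/2) \<cdot>\<^sub>m
     (block d G i - block d q i * (transpose_mat (block d G i) * block d q i))"
  unfolding tangent_proj_def
  by (rule block_vstack) (auto intro!: minus_carrier_mat mult_carrier_mat[of _ _ d])

lemma tangent_proj_tangent:
  assumes q: "q \<in> orthogonal_power d N"
  shows "tangent_proj d N q G \<in> tangent_blocks d N q"
proof -
  have "transpose_mat (block d (tangent_proj d N q G) i) * block d q i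
    = - (transpose_mat (block d q i) * block d (tangent_proj d N q G) i)" if i: "i < N" for i
  proof -
    define Q where "Q = block d q i"
    define H where "H = block d G i"
    have Q [simp]: "Q \<in> carrier_mat d d" and H [simp]: "H \<in> carrier_mat d d" by (simp_all add: Q_def H_def)
    have QQ: "transpose_mat Q * Q = 1\<^sub>m d" unfolding Q_def
      using orthogonal_group_transpose_mult[OF orthogonal_powerD(2)[OF q i]] .
    have HQ [simp]: "transpose_mat H * Q \<in> carrier_mat d d" "transpose_mat Q * H \<in> carrier_mat d d"
      "Q * (transpose_mat H * Q) \<in> carrier_mat d d" "H - Q * (transpose_mat H * Q) \<in> carrier_mat d d"
      by (auto intro!: minus_carrier_mat mult_carrier_mat[of _ _ d])
    let ?T = "(1/2) \<cdot>\<^sub>m (H - Q * (transpose_mat H * Q))"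
    have T: "?T \<in> carrier_mat d d" by simp
    \<comment> \<open>Multiplied by \<open>Q\<close> transposed, the candidate becomes half the
      difference of a matrix and its transpose, which is skew.\<close>
    have *: "transpose_mat Q * ?T = (1/2) \<cdot>\<^sub>m (transpose_mat Q * H - transpose_mat H * Q)"
    proof -
      have "transpose_mat Q * ?T = (1/2) \<cdot>\<^sub>m (transpose_mat Q * (H - Q * (transpose_mat H * Q)))"
        by (rule mult_smult_distrib[of _ d d _ d]) simp_all
      also have "transpose_mat Q * (H - Q * (transpose_mat H * Q)) = transpose_mat Q * H - transpose_mat Q * (Q * (transpose_mat H * Q))"
        by (rule mult_minus_distrib_mat[of _ d d _ d]) simp_all
      also have "transpose_mat Q * (Q * (transpose_mat H * Q)) = (transpose_mat Q * Q) * (transpose_mat H * Q)"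
        by (rule assoc_mult_mat[of _ d d _ d _ d, symmetric]) simp_all
      also have "\<dots> = transpose_mat H * Q" unfolding QQ by (rule left_mult_one_mat[of _ d d]) simp
      finally show ?thesis .
    qed
    have "transpose_mat ?T * Q = transpose_mat (transpose_mat Q * ?T)"
      by (subst transpose_mult[of _ d d _ d]) simp_all
    also have "\<dots> = - (transpose_mat Q * ?T)" unfolding *
    proof (rule eq_matI)
      have t: "(transpose_mat H * Q) $$ (b, a) = (transpose_mat Q * H) $$ (a, b)" if "a < d" "b < d" for a b
        using that by (simp add: scalar_prod_def mult.commute carrier_matD[OF Q] carrier_matD[OF H])
      fix a b assume "a < dim_row (- ((1/2) \<cdot>\<^sub>m (transpose_mat Q * H - transpose_mat H * Q)))"
       "b < dim_col (- ((1/2) \<cdot>\<^sub>m (transpose_mat Q * H - transpose_mat H * Q)))"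
      then have ab: "a < d" "b < d" using carrier_matD[OF Q] carrier_matD[OF H] by simp_all
      define M where "M = transpose_mat H * Q"
      define M' where "M' = transpose_mat Q * H"
      have M: "M \<in> carrier_mat d d" "M' \<in> carrier_mat d d" unfolding M_def M'_def by simp_all
      show "transpose_mat ((1/2) \<cdot>\<^sub>m (transpose_mat Q * H - transpose_mat H * Q)) $$ (a, b)
        = (- ((1/2) \<cdot>\<^sub>m (transpose_mat Q * H - transpose_mat H * Q))) $$ (a, b)"
        using t[OF ab] t[OF ab(2,1)] ab M unfolding M_def[symmetric] M'_def[symmetric] by (simp add: field_simps)
    qed (use carrier_matD[OF Q] carrier_matD[OF H] in simp_all)
    finally show ?thesis using block_tangent_proj[OF i] by (simp add: Q_def H_def)
  qed
  then show ?thesis by (simp add: tangent_blocks_def)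
qed

text \<open>Against a tangent vector the subtracted term pairs to the negative of what
  \<open>G\<close> does: \<open>q_i\<close> is moved across, the inner product is transposed, and
  skewness flips the sign. Half of the resulting double is the pairing with
  \<open>G\<close>.\<close>

lemma frob_inner_tangent_proj:
  assumes q: "q \<in> orthogonal_power d N" and G: "G \<in> carrier_mat (N * d) d"
    and V: "V \<in> tangent_blocks d N q"
  shows "frob_inner (tangent_proj d N q G) V = frob_inner G V"
proof -
  have Vc: "V \<in> carrier_mat (N * d) d" using V by (simp add: tangent_blocks_def)
  have "frob_inner (block d (tangent_proj d N q G) i) (block d V i) = frob_inner (block d G i) (block d V i)"
    if i: "i < N" for i
  proof -
    define Q where "Q = block d q i"
    define H where "H = block d G i"
    define W where "W = block d V i"
    have Q [simp]: "Q \<in> carrier_mat d d" and H [simp]: "H \<in> carrier_mat d d" and W [simp]: "W \<in> carrier_mat d d"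
      by (simp_all add: Q_def H_def W_def)
    have [simp]: "transpose_mat H * Q \<in> carrier_mat d d" "transpose_mat Q * W \<in> carrier_mat d d"
      "transpose_mat Q * H \<in> carrier_mat d d"  "transpose_mat W * Q \<in> carrier_mat d d"
      "Q * (transpose_mat H * Q) \<in> carrier_mat d d" "H - Q * (transpose_mat H * Q) \<in> carrier_mat d d"
      by (auto intro!: minus_carrier_mat mult_carrier_mat[of _ _ d])
    have QQ: "Q * transpose_mat Q = 1\<^sub>m d" unfolding Q_def
      using orthogonal_group_mult_transpose[OF orthogonal_powerD(2)[OF q i]] .
    have skew: "transpose_mat W * Q = - (transpose_mat Q * W)"
      using V i by (simp add: tangent_blocks_def W_def Q_def)
    have "frob_inner (Q * (transpose_mat H * Q)) W = frob_inner (transpose_mat H * Q) (transpose_mat Q * W)"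
      by (rule frob_inner_mult[of _ d d _ d]) simp_all
    also have "\<dots> = frob_inner (transpose_mat (transpose_mat H * Q)) (transpose_mat (transpose_mat Q * W))"
      by (rule frob_inner_transpose[of _ d d, symmetric]) simp_all
    also have "transpose_mat (transpose_mat H * Q) = transpose_mat Q * H"
      by (subst transpose_mult[of _ d d _ d]) simp_all
    also have "transpose_mat (transpose_mat Q * W) = - (transpose_mat Q * W)"
      unfolding skew[symmetric] by (subst transpose_mult[of _ d d _ d]) simp_all
    also have "frob_inner (transpose_mat Q * H) (- (transpose_mat Q * W)) = - frob_inner (transpose_mat Q * H) (transpose_mat Q * W)"
      by (rule frob_inner_uminus_right[of _ d d]) simp_all
    also have "frob_inner (transpose_mat Q * H) (transpose_mat Q * W) = frob_inner H (transpose_mat (transpose_mat Q) * (transpose_mat Q * W))"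
      by (rule frob_inner_mult[of _ d d _ d]) simp_all
    also have "transpose_mat (transpose_mat Q) * (transpose_mat Q * W) = (Q * transpose_mat Q) * W"
      by (simp only: transpose_transpose) (rule assoc_mult_mat[of _ d d _ d _ d, symmetric], simp_all)
    also have "\<dots> = W" unfolding QQ by (rule left_mult_one_mat[of _ d d]) simp
    finally have *: "frob_inner (Q * (transpose_mat H * Q)) W = - frob_inner H W" .
    have "frob_inner ((1/2) \<cdot>\<^sub>m (H - Q * (transpose_mat H * Q))) W
      = 1/2 * (frob_inner H W - frob_inner (Q * (transpose_mat H * Q)) W)"
      by (subst frob_inner_smult_left[of _ d d], simp, simp, subst frob_inner_minus_left[of _ d d]) simp_all
    then show ?thesis unfolding * block_tangent_proj[OF i] by (simp add: Q_def H_def W_def)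
  qed
  then show ?thesis
    unfolding frob_inner_blocks[OF tangent_proj_carrier Vc] frob_inner_blocks[OF G Vc] by (intro sum.cong) auto
qed

subsection \<open>Riemannian gradient and Hessian\<close>

lemma tangent_proj_index:
  assumes "i < N" "a < d" "b < d"
  shows "tangent_proj d N q G $$ (i * d + a, b) = (1/2) * (G $$ (i * d + a, b)
    - (\<Sum>c<d. q $$ (i * d + a, c) * (\<Sum>e<d. G $$ (i * d + e, c) * q $$ (i * d + e, b))))"
proof -
  have "tangent_proj d N q G $$ (i * d + a, b) = block d (tangent_proj d N q G) i $$ (a, b)" using assms by simp
  then show ?thesis unfolding block_tangent_proj[OF assms(1)] using assms
    by (simp add: scalar_prod_def atLeast0LessThan)
qed

text \<open>In the product rule every term that differentiates the projection carries a factor from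
  \<open>g 0\<close>, which is zero. Only the derivative of \<open>g\<close> itself survives, and no
  curvature term appears.\<close>

lemma has_mat_derivative_tangent_proj:
  assumes c: "curve_through (orthogonal_power d N) q V \<gamma>"
    and g: "\<And>t. g t \<in> carrier_mat (N * d) d" "has_mat_derivative g H 0" "g 0 = 0\<^sub>m (N * d) d"
  shows "has_mat_derivative (\<lambda>t. tangent_proj d N (\<gamma> t) (g t)) (tangent_proj d N q H) 0"
  unfolding has_mat_derivative_def
proof (intro conjI allI impI)
  note D = curve_throughD[OF c]
  show "tangent_proj d N q H \<in> carrier_mat (dim_row (tangent_proj d N (\<gamma> 0) (g 0))) (dim_col (tangent_proj d N (\<gamma> 0) (g 0)))"
    by (simp add: tangent_proj_def vstack_def)
  have gd: "((\<lambda>t. g t $$ (r, b)) has_real_derivative H $$ (r, b)) (at 0)" if "r < N * d" "b < d" for r b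
    using g(2) that carrier_matD[OF g(1)[of 0]] carrier_matD[of H "N * d" d] by (auto simp: has_mat_derivative_def)
  fix r b assume "r < dim_row (tangent_proj d N q H)" "b < dim_col (tangent_proj d N q H)"
  then obtain i a where i: "i < N" "a < d" "r = i * d + a" and b: "b < d"
    by (auto simp: tangent_proj_def vstack_def elim: stacked_index_cases)
  have r: "i * d + e < N * d" if "e < d" for e using block_index_less[OF i(1) that] .
  have z: "g 0 $$ (i * d + e, c) = 0" if "e < d" "c < d" for e c using g(3) that r by simp
  have "((\<lambda>t. (1/2) * (g t $$ (i * d + a, b)
      - (\<Sum>c<d. \<gamma> t $$ (i * d + a, c) * (\<Sum>e<d. g t $$ (i * d + e, c) * \<gamma> t $$ (i * d + e, b)))))
     has_real_derivative (1/2) * (H $$ (i * d + a, b)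
      - (\<Sum>c<d. V $$ (i * d + a, c) * (\<Sum>e<d. g 0 $$ (i * d + e, c) * \<gamma> 0 $$ (i * d + e, b))
       + (\<Sum>e<d. H $$ (i * d + e, c) * \<gamma> 0 $$ (i * d + e, b) + V $$ (i * d + e, b) * g 0 $$ (i * d + e, c)) * \<gamma> 0 $$ (i * d + a, c)))) (at 0)"
    using b i(2) by (intro DERIV_cmult DERIV_diff DERIV_sum DERIV_mult D(5) gd r) auto
  also have "(1/2) * (H $$ (i * d + a, b)
      - (\<Sum>c<d. V $$ (i * d + a, c) * (\<Sum>e<d. g 0 $$ (i * d + e, c) * \<gamma> 0 $$ (i * d + e, b))
       + (\<Sum>e<d. H $$ (i * d + e, c) * \<gamma> 0 $$ (i * d + e, b) + V $$ (i * d + e, b) * g 0 $$ (i * d + e, c)) * \<gamma> 0 $$ (i * d + a, c)))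
    = tangent_proj d N q H $$ (i * d + a, b)"
    unfolding tangent_proj_index[OF i(1,2) b] D(3)
    by (intro arg_cong[of _ _ "(*) (1/2)"] arg_cong2[of _ _ _ _ minus] sum.cong refl)
      (simp add: z b mult.commute[of "q $$ (i * d + a, _)"])
  finally show "((\<lambda>s. tangent_proj d N (\<gamma> s) (g s) $$ (r, b)) has_real_derivative tangent_proj d N q H $$ (r, b)) (at 0)"
    unfolding i(3) tangent_proj_index[OF i(1,2) b] .
qed

text \<open>Projecting the Euclidean gradient does not change its pairing with velocities, whence
  existence. Uniqueness holds because every tangent vector is the velocity of some curve, along
  which \<open>f\<close> has only one derivative.\<close>

lemma riem_grad_orthogonal_power:
  assumes q: "q \<in> orthogonal_power d N" and G: "G \<in> carrier_mat (N * d) d"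
    and deriv: "\<And>V \<gamma>. curve_through (orthogonal_power d N) q V \<gamma> \<Longrightarrow>
      ((\<lambda>t. f (\<gamma> t)) has_real_derivative frob_inner G V) (at 0)"
  shows "riem_grad (orthogonal_power d N) f q = tangent_proj d N q G"
  unfolding riem_grad_def
proof (rule the_equality)
  note T = tangent_space_orthogonal_power[OF q]
  show "tangent_proj d N q G \<in> tangent_space (orthogonal_power d N) q \<and>
    (\<forall>V \<gamma>. curve_through (orthogonal_power d N) q V \<gamma> \<longrightarrow>
      ((\<lambda>t. f (\<gamma> t)) has_real_derivative frob_inner (tangent_proj d N q G) V) (at 0))"
    unfolding T using tangent_proj_tangent[OF q] deriv frob_inner_tangent_proj[OF q G curve_velocity_tangent]
    by metis
  fix G' assume G': "G' \<in> tangent_space (orthogonal_power d N) q \<and>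
    (\<forall>V \<gamma>. curve_through (orthogonal_power d N) q V \<gamma> \<longrightarrow>
      ((\<lambda>t. f (\<gamma> t)) has_real_derivative frob_inner G' V) (at 0))"
  show "G' = tangent_proj d N q G"
  proof (rule tangent_blocks_eqI[of _ d N q])
    fix W assume W: "W \<in> tangent_blocks d N q"
    obtain \<gamma> where \<gamma>: "curve_through (orthogonal_power d N) q W \<gamma>" using tangent_blocks_curve[OF q W] by blast
    have "frob_inner G' W = frob_inner G W" using DERIV_unique deriv[OF \<gamma>] G' \<gamma> by blast
    then show "frob_inner G' W = frob_inner (tangent_proj d N q G) W"
      by (simp add: frob_inner_tangent_proj[OF q G W])
  qed (use G' T tangent_proj_tangent[OF q] in auto)
qed

lemma has_mat_derivative_unique:
  assumes "has_mat_derivative \<gamma> V t" "has_mat_derivative \<gamma> W t"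
  shows "V = W"
proof (rule eq_matI)
  have V: "V \<in> carrier_mat (dim_row (\<gamma> t)) (dim_col (\<gamma> t))" and W: "W \<in> carrier_mat (dim_row (\<gamma> t)) (dim_col (\<gamma> t))"
    using assms by (simp_all add: has_mat_derivative_def)
  then show "dim_row V = dim_row W" "dim_col V = dim_col W" by auto
  fix a b assume ab: "a < dim_row W" "b < dim_col W"
  then have "((\<lambda>s. \<gamma> s $$ (a, b)) has_real_derivative V $$ (a, b)) (at t)"
    "((\<lambda>s. \<gamma> s $$ (a, b)) has_real_derivative W $$ (a, b)) (at t)"
    using assms V W by (auto simp: has_mat_derivative_def)
  then show "V $$ (a, b) = W $$ (a, b)" by (rule DERIV_unique)
qed

text \<open>At a point where the Euclidean gradient vanishes, the Riemannian Hessian is the projection of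
  the Euclidean one: the derivative of the projection itself does not contribute.\<close>
lemma nonsingular_hessian_orthogonal_power:
  assumes p: "p \<in> orthogonal_power d N"
    and G: "\<And>q. G q \<in> carrier_mat (N * d) d" and H: "\<And>V. H V \<in> carrier_mat (N * d) d"
    and deriv: "\<And>q V \<gamma>. curve_through (orthogonal_power d N) q V \<gamma> \<Longrightarrow>
      ((\<lambda>t. f (\<gamma> t)) has_real_derivative frob_inner (G q) V) (at 0)"
    and deriv2: "\<And>V \<gamma>. curve_through (orthogonal_power d N) p V \<gamma> \<Longrightarrow> has_mat_derivative (\<lambda>t. G (\<gamma> t)) (H V) 0"
    and critical: "G p = 0\<^sub>m (N * d) d"
    and definite: "\<And>V. V \<in> tangent_blocks d N p \<Longrightarrow> frob_inner (H V) V = 0 \<Longrightarrow> V = 0\<^sub>m (N * d) d"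
  shows "nonsingular_hessian (orthogonal_power d N) f p"
  unfolding nonsingular_hessian_def
proof (intro ballI impI)
  let ?M = "orthogonal_power d N"
  note T = tangent_space_orthogonal_power[OF p]
  have dims: "dim_row p = N * d" "dim_col p = d" using orthogonal_powerD(1)[OF p] by simp_all
  fix V assume "V \<in> tangent_space ?M p" and zero: "riem_hess ?M f p V = 0\<^sub>m (dim_row p) (dim_col p)"
  then have V: "V \<in> tangent_blocks d N p" by (simp add: T)
  have grad: "riem_grad ?M f q = tangent_proj d N q (G q)" if "q \<in> ?M" for q
    using riem_grad_orthogonal_power[OF that G deriv] .
  have dgrad: "has_mat_derivative (\<lambda>t. riem_grad ?M f (\<gamma> t)) (tangent_proj d N p (H V)) 0"
    if c: "curve_through ?M p V \<gamma>" for \<gamma>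
  proof -
    have "(\<lambda>t. riem_grad ?M f (\<gamma> t)) = (\<lambda>t. tangent_proj d N (\<gamma> t) (G (\<gamma> t)))"
      using grad curve_throughD(2)[OF c] by auto
    then show ?thesis
      using has_mat_derivative_tangent_proj[OF c, of "\<lambda>t. G (\<gamma> t)"] G deriv2[OF c] critical curve_throughD(3)[OF c] by simp
  qed
  \<comment> \<open>The description ranges over all curves with velocity \<open>V\<close>. They all
    yield the same derivative of the gradient, and since at least one such curve exists, this
    derivative determines the Hessian.\<close>
  have hess: "riem_hess ?M f p V = tangent_proj d N p (H V)"
    unfolding riem_hess_def T
  proof (rule the_equality)
    show "tangent_proj d N p (H V) \<in> tangent_blocks d N p \<and> (\<forall>\<gamma>. curve_through ?M p V \<gamma> \<longrightarrow>
        (\<exists>G'. has_mat_derivative (\<lambda>t. riem_grad ?M f (\<gamma> t)) G' 0 \<and>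
              (\<forall>W \<in> tangent_blocks d N p. frob_inner (tangent_proj d N p (H V)) W = frob_inner G' W)))"
      using tangent_proj_tangent[OF p] dgrad by blast
    fix K assume K: "K \<in> tangent_blocks d N p \<and> (\<forall>\<gamma>. curve_through ?M p V \<gamma> \<longrightarrow>
        (\<exists>G'. has_mat_derivative (\<lambda>t. riem_grad ?M f (\<gamma> t)) G' 0 \<and>
              (\<forall>W \<in> tangent_blocks d N p. frob_inner K W = frob_inner G' W)))"
    obtain \<gamma> where \<gamma>: "curve_through ?M p V \<gamma>" using tangent_blocks_curve[OF p V] by blast
    show "K = tangent_proj d N p (H V)"
      using K \<gamma> tangent_proj_tangent[OF p] has_mat_derivative_unique[OF _ dgrad[OF \<gamma>]]
      by (intro tangent_blocks_eqI[of _ d N p]) (blast, blast, metis)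
  qed
  \<comment> \<open>Pairing the vanishing Hessian image with \<open>V\<close> itself brings the
    question down to the Euclidean second variation.\<close>
  have "frob_inner (H V) V = frob_inner (riem_hess ?M f p V) V"
    unfolding hess using frob_inner_tangent_proj[OF p H V] by simp
  also have "\<dots> = 0" unfolding zero dims using V by (intro frob_inner_zero_left) (simp add: tangent_blocks_def)
  finally show "V = 0\<^sub>m (dim_row p) (dim_col p)" using definite[OF V] by (simp add: dims)
qed

subsection \<open>The reduced error\<close>

lemma append_rows_index:
  assumes "A \<in> carrier_mat r1 c" "B \<in> carrier_mat r2 c" "r < r1 + r2" "b < c"
  shows "(A @\<^sub>r B) $$ (r, b) = (if r < r1 then A $$ (r, b) else B $$ (r - r1, b))"
  using assms by (simp add: append_rows_def)

lemma block_append_rows: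
  assumes A: "A \<in> carrier_mat d d" and B: "B \<in> carrier_mat (N * d) d" and i: "i < Suc N"
  shows "block d (A @\<^sub>r B) i = (if i = 0 then A else block d B (i - 1))"
proof (cases i)
  case 0
  then show ?thesis using A B by (intro eq_matI) (auto simp: append_rows_index[OF A B])
next
  case (Suc j)
  have "j * d + a < N * d" if "a < d" for a using block_index_less[of j N a d] i Suc that by simp
  then show ?thesis unfolding Suc using A B by (intro eq_matI) (auto simp: append_rows_index[OF A B])
qed

lemma block_mult:
  assumes "S \<in> carrier_mat (N * d) d" "Q \<in> carrier_mat d d" "i < N"
  shows "block d (S * Q) i = block d S i * Q"
  using assms block_index_less[OF assms(3)] by (intro eq_matI) (auto simp: scalar_prod_def)

lemma orthogonal_group_transpose:
  "Q \<in> orthogonal_group d \<Longrightarrow> transpose_mat Q \<in> orthogonal_group d"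
  using orthogonal_group_mult_transpose[of Q d] by (simp add: orthogonal_group_def)

lemma sum_lessThan_add:
  fixes g :: "nat \<Rightarrow> real"
  shows "(\<Sum>a<j + k. g a) = (\<Sum>a<j. g a) + (\<Sum>r<k. g (j + r))"
  by (induction k) simp_all

lemma bilinear_form_sum:
  fixes C :: "real mat"
  assumes "C \<in> carrier_mat r r" "u \<in> carrier_vec r" "w \<in> carrier_vec r"
  shows "u \<bullet> (C *\<^sub>v w) = (\<Sum>a<r. \<Sum>s<r. C $$ (a, s) * (u $ a * w $ s))"
proof -
  have "u \<bullet> (C *\<^sub>v w) = (\<Sum>a<r. \<Sum>s<r. u $ a * (C $$ (a, s) * w $ s))"
    using assms by (simp add: scalar_prod_def atLeast0LessThan sum_distrib_left)
  then show ?thesis by (simp only: mult.left_commute[of "u $ _"])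
qed

lemma has_derivative_quadratic_form:
  assumes C: "C \<in> carrier_mat r r" and w: "\<And>t. w t \<in> carrier_vec r" and w': "w' \<in> carrier_vec r"
    and deriv: "\<And>a. a < r \<Longrightarrow> ((\<lambda>t. w t $ a) has_real_derivative w' $ a) (at 0)"
  shows "((\<lambda>t. w t \<bullet> (C *\<^sub>v w t)) has_real_derivative w' \<bullet> (C *\<^sub>v w 0) + w 0 \<bullet> (C *\<^sub>v w')) (at 0)"
proof -
  have "((\<lambda>t. \<Sum>a<r. \<Sum>s<r. C $$ (a, s) * (w t $ a * w t $ s)) has_real_derivative
    (\<Sum>a<r. \<Sum>s<r. C $$ (a, s) * (w' $ a * w 0 $ s + w' $ s * w 0 $ a))) (at 0)"
    by (intro DERIV_sum DERIV_cmult DERIV_mult deriv) auto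
  then show ?thesis unfolding bilinear_form_sum[OF C w w] bilinear_form_sum[OF C w' w] bilinear_form_sum[OF C w w']
    by (simp add: sum.distrib distrib_left mult.commute)
qed

section \<open>Alignments modulo a common orthogonal transformation\<close>

context connected_patch_framework
begin

lemma views_split: "d + (m - 1) * d = m * d"
  using pos(3) by (cases m) auto

lemma append_rows_carrier:
  "A \<in> carrier_mat d d \<Longrightarrow> B \<in> carrier_mat ((m - 1) * d) d \<Longrightarrow> A @\<^sub>r B \<in> carrier_mat (m * d) d"
  using carrier_append_rows[of A d d B "(m - 1) * d"] unfolding views_split .

lemma append_rows_index':
  assumes "A \<in> carrier_mat d d" "B \<in> carrier_mat ((m - 1) * d) d" "r < m * d" "b < d"
  shows "(A @\<^sub>r B) $$ (r, b) = (if r < d then A $$ (r, b) else B $$ (r - d, b))"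
  using append_rows_index[OF assms(1,2) _ assms(4), of r] assms(3) views_split by simp

lemma reduced_error_align_error: "reduced_error \<Theta> T = align_error \<Theta> (1\<^sub>m d @\<^sub>r T)"
  by (simp add: reduced_error_def align_error_def)

lemma alignmentD:
  assumes "alignment \<Theta> S"
  shows "S \<in> carrier_mat (m * d) d" "i < m \<Longrightarrow> block d S i \<in> orthogonal_group d"
  using assms by (simp_all add: alignment_def orthogonal_power_def)

lemma quotient_proj_orthogonal:
  assumes "alignment \<Theta> S"
  shows "quotient_proj \<Theta> S \<in> orthogonal_power d (m - 1)"
    and "i < m - 1 \<Longrightarrow> block d (quotient_proj \<Theta> S) i = block d S (i + 1) * transpose_mat (block d S 0)"
proof -
  have o: "block d S (i + 1) * transpose_mat (block d S 0) \<in> orthogonal_group d" if "i < m - 1" for i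
    using that pos(3) by (intro orthogonal_group_mult orthogonal_group_transpose alignmentD(2)[OF assms]) auto
  show b: "block d (quotient_proj \<Theta> S) i = block d S (i + 1) * transpose_mat (block d S 0)" if "i < m - 1" for i
    unfolding quotient_proj_def using that by (intro block_vstack) (auto intro!: mult_carrier_mat[of _ _ d])
  show "quotient_proj \<Theta> S \<in> orthogonal_power d (m - 1)"
    using o b by (auto simp: orthogonal_power_def quotient_proj_def)
qed

text \<open>The quotient map normalizes the first block to the identity; the stack it produces is
  the representative of the class of \<open>S\<close> obtained by multiplying with the transpose of
  the first block.\<close>

lemma append_quotient_proj:
  assumes S: "alignment \<Theta> S"
  shows "1\<^sub>m d @\<^sub>r quotient_proj \<Theta> S = S * transpose_mat (block d S 0)"
proof -
  note Sc = alignmentD(1)[OF S] and q = orthogonal_powerD(1)[OF quotient_proj_orthogonal(1)[OF S]]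
  show ?thesis
  proof (rule stacked_eqI[of _ m d])
    show "1\<^sub>m d @\<^sub>r quotient_proj \<Theta> S \<in> carrier_mat (m * d) d" using q by (intro append_rows_carrier) auto
    show "S * transpose_mat (block d S 0) \<in> carrier_mat (m * d) d" using Sc by (intro mult_carrier_mat[of _ _ d]) auto
    fix i assume i: "i < m"
    have "block d (1\<^sub>m d @\<^sub>r quotient_proj \<Theta> S) i = (if i = 0 then 1\<^sub>m d else block d (quotient_proj \<Theta> S) (i - 1))"
      using i q by (intro block_append_rows[of _ _ _ "m - 1"]) auto
    also have "\<dots> = block d S i * transpose_mat (block d S 0)"
      using i quotient_proj_orthogonal(2)[OF S, of "i - 1"] orthogonal_group_mult_transpose[OF alignmentD(2)[OF S]]
      by auto
    also have "\<dots> = block d (S * transpose_mat (block d S 0)) i"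
      using Sc i by (intro block_mult[symmetric]) auto
    finally show "block d (1\<^sub>m d @\<^sub>r quotient_proj \<Theta> S) i = block d (S * transpose_mat (block d S 0)) i" .
  qed
qed

lemma align_error_mult_orthogonal:
  assumes S: "S \<in> carrier_mat (m * d) d" and Q: "Q \<in> orthogonal_group d"
  shows "align_error \<Theta> (S * Q) = align_error \<Theta> S"
proof -
  have Qc: "Q \<in> carrier_mat d d" using orthogonal_group_carrier[OF Q] .
  have "S * Q * transpose_mat (S * Q) = S * Q * (transpose_mat Q * transpose_mat S)"
    using transpose_mult[OF S Qc] by simp
  also have "\<dots> = S * Q * transpose_mat Q * transpose_mat S"
    using S Qc by (intro assoc_mult_mat[of _ "m * d" d _ d _ "m * d", symmetric]) auto
  also have "S * Q * transpose_mat Q = S * (Q * transpose_mat Q)"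
    using S Qc by (intro assoc_mult_mat[of _ "m * d" d _ d _ d]) auto
  also have "\<dots> = S" using right_mult_one_mat[OF S] by (simp add: orthogonal_group_mult_transpose[OF Q])
  finally show ?thesis by (simp add: align_error_def)
qed

lemma perfect_quotient:
  assumes S: "perfect_alignment \<Theta> S"
  shows "reduced_error \<Theta> (quotient_proj \<Theta> S) = 0"
proof -
  have al: "alignment \<Theta> S" and 0: "align_error \<Theta> S = 0" using S by (simp_all add: perfect_alignment_def)
  show ?thesis unfolding reduced_error_align_error append_quotient_proj[OF al]
    using align_error_mult_orthogonal[OF alignmentD(1)[OF al] orthogonal_group_transpose[OF alignmentD(2)[OF al]]] 0 pos
    by simp
qed

lemma perfect_local_minimizer:
  assumes S: "perfect_alignment \<Theta> S"
  shows "local_minimizer (orthogonal_power d (m - 1)) (reduced_error \<Theta>) (quotient_proj \<Theta> S)"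
  unfolding local_minimizer_def
\<comment> \<open>The error is never negative and is 0 here, so the minimum is global; the radius 1
  is arbitrary.\<close>
proof (intro conjI exI[of _ 1] ballI impI)
  show "quotient_proj \<Theta> S \<in> orthogonal_power d (m - 1)"
    using S quotient_proj_orthogonal by (simp add: perfect_alignment_def)
  fix q assume "q \<in> orthogonal_power d (m - 1)"
  from orthogonal_powerD(1)[OF this] have "0 \<le> reduced_error \<Theta> q"
    unfolding reduced_error_align_error by (intro align_error_nonneg append_rows_carrier) auto
  then show "reduced_error \<Theta> (quotient_proj \<Theta> S) \<le> reduced_error \<Theta> q" by (simp add: perfect_quotient[OF S])
qed simp

text \<open>The reduced error is a quadratic form in \<open>[1; T]\<close>, so its Euclidean
  gradient consists of the lower rows of twice \<open>C [1; T]\<close>, and its Hessian sends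
  \<open>V\<close> to the lower rows of twice \<open>C [0; V]\<close>. Paired with \<open>V\<close>
  the latter is twice a sum over columns of non-negative forms, so a vanishing second variation
  makes every column of \<open>[0; V]\<close> isotropic.\<close>

lemma nondegenerate_alignmentI:
  assumes S: "perfect_alignment \<Theta> S"
    and kernel: "\<And>V. V \<in> tangent_blocks d (m - 1) (quotient_proj \<Theta> S) \<Longrightarrow>
      (\<And>b. b < d \<Longrightarrow> col (0\<^sub>m d d @\<^sub>r V) b \<bullet> (matC \<Theta> *\<^sub>v col (0\<^sub>m d d @\<^sub>r V) b) = 0) \<Longrightarrow> V = 0\<^sub>m ((m - 1) * d) d"
  shows "nondegenerate_alignment \<Theta> S"
proof -
  have al: "alignment \<Theta> S" using S by (simp add: perfect_alignment_def)
  let ?p = "quotient_proj \<Theta> S" and ?N = "m - 1"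
  note p = quotient_proj_orthogonal(1)[OF al]
  \<comment> \<open>One formula for both derivatives: at \<open>[1; q]\<close> it is the Euclidean
    gradient, at \<open>[0; V]\<close> the Euclidean Hessian. The offset \<open>d\<close> in the row
    index skips the fixed first block.\<close>
  define grad where "grad A = mat (?N * d) d (\<lambda>(r, b). 2 * (matC \<Theta> *\<^sub>v col A b) $ (d + r))" for A
  have gradc: "grad A \<in> carrier_mat (?N * d) d" for A by (simp add: grad_def)
  have sum_split: "(\<Sum>a<m * d. g a) = (\<Sum>a<d. g a) + (\<Sum>r<?N * d. g (d + r))" for g :: "nat \<Rightarrow> real"
    unfolding views_split[symmetric] by (rule sum_lessThan_add)
  have cc: "col (A @\<^sub>r B) b \<in> carrier_vec (m * d)" if "A \<in> carrier_mat d d" "B \<in> carrier_mat (?N * d) d" for A B b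
    using carrier_matD(1)[OF append_rows_carrier[OF that]] by (intro carrier_vecI) simp
  have inner_grad: "frob_inner (grad A) V = (\<Sum>b<d. 2 * (col (0\<^sub>m d d @\<^sub>r V) b \<bullet> (matC \<Theta> *\<^sub>v col A b)))"
    if A: "A \<in> carrier_mat (m * d) d" and V: "V \<in> carrier_mat (?N * d) d" for A V
    unfolding frob_inner_sum[OF gradc V]
  proof (intro sum.cong refl)
    fix b assume "b \<in> {..<d}"
    then have b: "b < d" by simp
    let ?v = "col (0\<^sub>m d d @\<^sub>r V) b" and ?c = "matC \<Theta> *\<^sub>v col A b"
    have lt: "d + r < m * d" if "r < ?N * d" for r using that views_split by simp
    have dimv: "dim_row (0\<^sub>m d d @\<^sub>r V) = m * d" "dim_col (0\<^sub>m d d @\<^sub>r V) = d"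
      using append_rows_carrier[OF _ V, of "0\<^sub>m d d"] by auto
    have v1: "?v $ a = 0" if "a < d" for a
      using that b append_rows_index'[OF _ V, of "0\<^sub>m d d" a b] dimv views_split by simp
    have v2: "?v $ (d + r) = V $$ (r, b)" if "r < ?N * d" for r
      using lt[OF that] b append_rows_index'[OF _ V, of "0\<^sub>m d d" "d + r" b] dimv by simp
    have "?v \<bullet> ?c = (\<Sum>a<m * d. ?v $ a * ?c $ a)"
      using A by (intro scalar_prod_sum cc V mult_mat_vec_carrier[OF matC_carrier] carrier_vecI) auto
    also have "\<dots> = (\<Sum>r<?N * d. V $$ (r, b) * ?c $ (d + r))"
      unfolding sum_split by (simp add: v1 v2)
    finally show "(\<Sum>a<?N * d. grad A $$ (a, b) * V $$ (a, b)) = 2 * (?v \<bullet> ?c)"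
      using b by (simp add: grad_def sum_distrib_left ac_simps)
  qed
  \<comment> \<open>The first block of \<open>[1; \<gamma> t]\<close> does not move, so the velocity
    of the stack is \<open>[0; V]\<close>.\<close>
  have entries: "((\<lambda>t. col (1\<^sub>m d @\<^sub>r \<gamma> t) b $ a) has_real_derivative col (0\<^sub>m d d @\<^sub>r V) b $ a) (at 0)"
    if c: "curve_through (orthogonal_power d ?N) q V \<gamma>" and b: "b < d" and a: "a < m * d" for q V \<gamma> b a
  proof -
    note D = curve_throughD[OF c]
    have \<gamma>c: "\<gamma> t \<in> carrier_mat (?N * d) d" for t using orthogonal_powerD(1)[OF D(2)] .
    have "col (1\<^sub>m d @\<^sub>r \<gamma> t) b $ a = (if a < d then 1\<^sub>m d $$ (a, b) else \<gamma> t $$ (a - d, b))" for t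
      using carrier_matD[OF append_rows_carrier[OF one_carrier_mat \<gamma>c[of t]]] a b
      by (simp add: append_rows_index'[OF _ \<gamma>c])
    moreover have "col (0\<^sub>m d d @\<^sub>r V) b $ a = (if a < d then 0 else V $$ (a - d, b))"
      using carrier_matD[OF append_rows_carrier[OF zero_carrier_mat D(4)]] a b
      by (simp add: append_rows_index'[OF _ D(4)])
    moreover have "a - d < ?N * d" if "\<not> a < d" using a that views_split by linarith
    ultimately show ?thesis using D(5)[of "a - d" b] b by auto
  qed
  have "nonsingular_hessian (orthogonal_power d ?N) (reduced_error \<Theta>) ?p"
  proof (rule nonsingular_hessian_orthogonal_power[OF p])
    show "grad (1\<^sub>m d @\<^sub>r q) \<in> carrier_mat (?N * d) d" for q by (rule gradc)
    show "grad (0\<^sub>m d d @\<^sub>r V) \<in> carrier_mat (?N * d) d" for V by (rule gradc)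
    show "((\<lambda>t. reduced_error \<Theta> (\<gamma> t)) has_real_derivative frob_inner (grad (1\<^sub>m d @\<^sub>r q)) V) (at 0)"
      if c: "curve_through (orthogonal_power d ?N) q V \<gamma>" for q V \<gamma>
    proof -
      note D = curve_throughD[OF c]
      have \<gamma>c: "\<gamma> t \<in> carrier_mat (?N * d) d" for t using orthogonal_powerD(1)[OF D(2)] .
      have "reduced_error \<Theta> (\<gamma> t) = (\<Sum>b<d. col (1\<^sub>m d @\<^sub>r \<gamma> t) b \<bullet> (matC \<Theta> *\<^sub>v col (1\<^sub>m d @\<^sub>r \<gamma> t) b))" for t
        unfolding reduced_error_align_error using append_rows_carrier[OF _ \<gamma>c] by (intro align_error_sum) auto
      moreover have "((\<lambda>t. \<Sum>b<d. col (1\<^sub>m d @\<^sub>r \<gamma> t) b \<bullet> (matC \<Theta> *\<^sub>v col (1\<^sub>m d @\<^sub>r \<gamma> t) b)) has_real_derivative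
        (\<Sum>b<d. col (0\<^sub>m d d @\<^sub>r V) b \<bullet> (matC \<Theta> *\<^sub>v col (1\<^sub>m d @\<^sub>r \<gamma> 0) b)
          + col (1\<^sub>m d @\<^sub>r \<gamma> 0) b \<bullet> (matC \<Theta> *\<^sub>v col (0\<^sub>m d d @\<^sub>r V) b))) (at 0)"
        by (intro DERIV_sum has_derivative_quadratic_form[OF matC_carrier] cc \<gamma>c D(4) entries[OF c]) auto
      moreover have "(\<Sum>b<d. col (0\<^sub>m d d @\<^sub>r V) b \<bullet> (matC \<Theta> *\<^sub>v col (1\<^sub>m d @\<^sub>r \<gamma> 0) b)
          + col (1\<^sub>m d @\<^sub>r \<gamma> 0) b \<bullet> (matC \<Theta> *\<^sub>v col (0\<^sub>m d d @\<^sub>r V) b)) = frob_inner (grad (1\<^sub>m d @\<^sub>r q)) V"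
      proof -
        have "(col (1\<^sub>m d @\<^sub>r \<gamma> 0) b \<bullet> (matC \<Theta> *\<^sub>v col (0\<^sub>m d d @\<^sub>r V) b)) = (col (0\<^sub>m d d @\<^sub>r V) b \<bullet> (matC \<Theta> *\<^sub>v col (1\<^sub>m d @\<^sub>r \<gamma> 0) b))" for b
          by (intro scalar_prod_matC_commute cc \<gamma>c D(4)) auto
        then show ?thesis using inner_grad[OF append_rows_carrier[OF one_carrier_mat \<gamma>c[of 0]] D(4)] by (simp add: D(3))
      qed
      ultimately show ?thesis by simp
    qed
    show "has_mat_derivative (\<lambda>t. grad (1\<^sub>m d @\<^sub>r \<gamma> t)) (grad (0\<^sub>m d d @\<^sub>r V)) 0"
      if c: "curve_through (orthogonal_power d ?N) ?p V \<gamma>" for V \<gamma>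
      unfolding has_mat_derivative_def
    proof (intro conjI allI impI)
      note D = curve_throughD[OF c]
      have \<gamma>c: "\<gamma> t \<in> carrier_mat (?N * d) d" for t using orthogonal_powerD(1)[OF D(2)] .
      show "grad (0\<^sub>m d d @\<^sub>r V) \<in> carrier_mat (dim_row (grad (1\<^sub>m d @\<^sub>r \<gamma> 0))) (dim_col (grad (1\<^sub>m d @\<^sub>r \<gamma> 0)))"
        by (simp add: grad_def)
      fix r b assume "r < dim_row (grad (0\<^sub>m d d @\<^sub>r V))" "b < dim_col (grad (0\<^sub>m d d @\<^sub>r V))"
      then have r: "r < ?N * d" and b: "b < d" by (simp_all add: grad_def)
      have dr: "d + r < m * d" using r views_split by simp
      have gr: "grad (A @\<^sub>r B) $$ (r, b) = 2 * (\<Sum>a<m * d. matC \<Theta> $$ (d + r, a) * col (A @\<^sub>r B) b $ a)"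
        if "A \<in> carrier_mat d d" "B \<in> carrier_mat (?N * d) d" for A B
      proof -
        have "(matC \<Theta> *\<^sub>v col (A @\<^sub>r B) b) $ (d + r) = row (matC \<Theta>) (d + r) \<bullet> col (A @\<^sub>r B) b"
          using dr carrier_matD(1)[OF matC_carrier] by simp
        also have "\<dots> = (\<Sum>a<m * d. row (matC \<Theta>) (d + r) $ a * col (A @\<^sub>r B) b $ a)"
          by (rule scalar_prod_sum[OF cc[OF that]]) (rule carrier_vecI, simp add: carrier_matD(2)[OF matC_carrier])
        finally show ?thesis using r b dr carrier_matD[OF matC_carrier] by (simp add: grad_def)
      qed
      show "((\<lambda>t. grad (1\<^sub>m d @\<^sub>r \<gamma> t) $$ (r, b)) has_real_derivative grad (0\<^sub>m d d @\<^sub>r V) $$ (r, b)) (at 0)"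
        unfolding gr[OF one_carrier_mat \<gamma>c] gr[OF zero_carrier_mat D(4)]
        by (intro DERIV_cmult DERIV_sum entries[OF c b]) auto
    qed
    \<comment> \<open>Criticality in the ambient space is more than being critical on the manifold.
      It holds because the columns of a perfect alignment lie in the kernel of
      \<open>C\<close>.\<close>
    show "grad (1\<^sub>m d @\<^sub>r ?p) = 0\<^sub>m (?N * d) d"
    proof (rule eq_matI)
      fix r b assume "r < dim_row (0\<^sub>m (?N * d) d :: real mat)" "b < dim_col (0\<^sub>m (?N * d) d :: real mat)"
      then have r: "r < ?N * d" and b: "b < d" by simp_all
      have U: "1\<^sub>m d @\<^sub>r ?p \<in> carrier_mat (m * d) d" using append_rows_carrier[OF one_carrier_mat orthogonal_powerD(1)[OF p]] .
      have "col (1\<^sub>m d @\<^sub>r ?p) b \<bullet> (matC \<Theta> *\<^sub>v col (1\<^sub>m d @\<^sub>r ?p) b) = 0"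
        using align_error_zero_col[OF U _ b] perfect_quotient[OF S] by (simp add: reduced_error_align_error)
      then have "matC \<Theta> *\<^sub>v col (1\<^sub>m d @\<^sub>r ?p) b = 0\<^sub>v (m * d)"
        by (intro matC_isotropic_kernel cc orthogonal_powerD(1)[OF p]) auto
      then show "grad (1\<^sub>m d @\<^sub>r ?p) $$ (r, b) = 0\<^sub>m (?N * d) d $$ (r, b)"
        using r b views_split by (simp add: grad_def)
    qed (simp_all add: grad_def)
    show "V = 0\<^sub>m (?N * d) d" if V: "V \<in> tangent_blocks d ?N ?p" and 0: "frob_inner (grad (0\<^sub>m d d @\<^sub>r V)) V = 0" for V
    proof (rule kernel[OF V])
      have Vc: "V \<in> carrier_mat (?N * d) d" using V by (simp add: tangent_blocks_def)
      have ge: "col (0\<^sub>m d d @\<^sub>r V) b \<bullet> (matC \<Theta> *\<^sub>v col (0\<^sub>m d d @\<^sub>r V) b) \<ge> 0" for b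
        by (intro matC_psd cc Vc) auto
      have "(\<Sum>b<d. 2 * (col (0\<^sub>m d d @\<^sub>r V) b \<bullet> (matC \<Theta> *\<^sub>v col (0\<^sub>m d d @\<^sub>r V) b))) = 0"
        using inner_grad[OF append_rows_carrier[OF zero_carrier_mat Vc] Vc] 0 by simp
      then show "b < d \<Longrightarrow> col (0\<^sub>m d d @\<^sub>r V) b \<bullet> (matC \<Theta> *\<^sub>v col (0\<^sub>m d d @\<^sub>r V) b) = 0" for b
        using ge by (subst (asm) sum_nonneg_eq_0_iff) auto
    qed
  qed
  then show ?thesis using al perfect_local_minimizer[OF S] by (simp add: nondegenerate_alignment_def)
qed

end

subsection \<open>Affine rigidity\<close>

lemma mult_mat_index_sum:
  assumes "A \<in> carrier_mat r k" "B \<in> carrier_mat k c" "i < r" "j < c"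
  shows "(A * B) $$ (i, j) = (\<Sum>s<k. A $$ (i, s) * B $$ (s, j))"
  using assms by (simp add: scalar_prod_def atLeast0LessThan)

context connected_patch_framework
begin

lemma isotropic_edge:
  assumes w: "w \<in> carrier_vec (m * d)" and "w \<bullet> (matC \<Theta> *\<^sub>v w) = 0" and e: "(k, i) \<in> E"
  shows "(\<Sum>a<d. x k i $ a * w $ (i * d + a)) = potential w $ k - potential w $ (n + i)"
  using matC_isotropic_edges[OF assms] lifted_coord_scalar_prod[OF e w] edge_vec_scalar_prod[OF e potential_carrier[OF w]]
  by simp

lemma nondegenerate_view_annihilator:
  assumes nd: "affinely_nondegenerate_view \<Theta> i"
    and const: "\<And>k. (k, i) \<in> E \<Longrightarrow> (\<Sum>a<d. u a * x k i $ a) = c0" and a: "a < d"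
  shows "u a = 0"
proof (rule affine_dim_full_annihilator[of "{x k i | k. (k, i) \<in> E}" d u c0 a])
  have "{k. (k, i) \<in> E} \<subseteq> {..<n}" using edgeD by auto
  then have fin: "finite {k. (k, i) \<in> E}" by (rule finite_subset) simp
  have eq: "{x k i | k. (k, i) \<in> E} = (\<lambda>k. x k i) ` {k. (k, i) \<in> E}" by auto
  show "finite {x k i | k. (k, i) \<in> E}" unfolding eq using fin by simp
  \<comment> \<open>The cardinality clause of non-degeneracy supplies a point in the view.\<close>
  have "card {k. (k, i) \<in> E} \<noteq> 0" using nd by (simp add: affinely_nondegenerate_view_def)
  then show "{x k i | k. (k, i) \<in> E} \<noteq> {}" unfolding eq by (metis card.empty image_is_empty)
  show "affine_dim d (affine_span d {x k i | k. (k, i) \<in> E}) = d"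
    using nd by (simp add: affinely_nondegenerate_view_def)
qed (use const a in auto)

text \<open>By symmetry of \<open>X\<close>, row \<open>b\<close> of the uncentred product is the
  potential of column \<open>b\<close> of \<open>S\<close>, restricted to the points. The last
  factor of the realization subtracts the mean over the points.\<close>

lemma realization_index:
  assumes S: "S \<in> carrier_mat (m * d) d" and b: "b < d" and k: "k < n"
  shows "realization \<Theta> S $$ (b, k) = potential (col S b) $ k - (\<Sum>l<n. potential (col S b) $ l) / n"
proof -
  define Z where "Z = transpose_mat S * matB \<Theta> * first_cols n X"
  have P: "transpose_mat S * matB \<Theta> \<in> carrier_mat d (n + m)" using S by (intro mult_carrier_mat[of _ _ "m * d"]) auto
  have F: "first_cols n X \<in> carrier_mat (n + m) n" using carrier_matD[OF X_carrier] by (simp add: first_cols_def)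
  have Zc: "Z \<in> carrier_mat d n" unfolding Z_def using P F by (rule mult_carrier_mat)
  have cS: "col S b \<in> carrier_vec (m * d)" using S by (intro carrier_vecI) simp
  have Z: "Z $$ (b, l) = potential (col S b) $ l" if l: "l < n" for l
  proof -
    have sym: "X $$ (j, l) = X $$ (l, j)" if "j < n + m" for j
      using arg_cong[OF transpose_X, of "\<lambda>M. M $$ (l, j)"] carrier_matD[OF X_carrier] that l by simp
    have y: "(transpose_mat (matB \<Theta>) *\<^sub>v col S b) $ j = (transpose_mat S * matB \<Theta>) $$ (b, j)" if "j < n + m" for j
      using that b S carrier_matD[OF matB_carrier] by (simp add: scalar_prod_def mult.commute)
    have "Z $$ (b, l) = (\<Sum>j<n + m. (transpose_mat S * matB \<Theta>) $$ (b, j) * X $$ (j, l))"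
      unfolding Z_def mult_mat_index_sum[OF P F b l]
      using l carrier_matD[OF X_carrier] by (intro sum.cong refl) (simp add: first_cols_def)
    also have "\<dots> = (\<Sum>j<n + m. X $$ (l, j) * (transpose_mat (matB \<Theta>) *\<^sub>v col S b) $ j)"
      by (intro sum.cong refl) (simp only: lessThan_iff sym y mult.commute)
    also have "\<dots> = potential (col S b) $ l"
      unfolding potential_def using l carrier_matD[OF X_carrier] carrier_matD[OF matB_carrier]
      by (simp add: scalar_prod_def[of "row X _"] atLeast0LessThan)
    finally show ?thesis .
  qed
  define K where "K = 1\<^sub>m n - (1 / real n) \<cdot>\<^sub>m outer (vec n (\<lambda>_. 1)) (vec n (\<lambda>_. 1))"
  have K: "K \<in> carrier_mat n n" "l < n \<Longrightarrow> K $$ (l, k) = (if l = k then 1 else 0) - 1 / n" for l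
    using k by (auto simp: K_def outer_def)
  have "realization \<Theta> S $$ (b, k) = (Z * K) $$ (b, k)" by (simp add: realization_def Z_def K_def)
  also have "\<dots> = (\<Sum>l<n. Z $$ (b, l) * K $$ (l, k))"
    using Zc K(1) b k by (simp add: scalar_prod_def atLeast0LessThan)
  also have "\<dots> = (\<Sum>l<n. (if l = k then potential (col S b) $ l else 0) - potential (col S b) $ l / n)"
    by (intro sum.cong refl) (auto simp: K(2) Z right_diff_distrib)
  also have "\<dots> = potential (col S b) $ k - (\<Sum>l<n. potential (col S b) $ l) / n"
    using k by (simp add: sum_subtractf sum_divide_distrib)
  finally show ?thesis .
qed

lemma realization_carrier: "S \<in> carrier_mat (m * d) d \<Longrightarrow> realization \<Theta> S \<in> carrier_mat d n"
  unfolding realization_def using carrier_matD[OF X_carrier]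
  by (intro mult_carrier_mat[of _ _ n] mult_carrier_mat[of _ _ "n + m"] mult_carrier_mat[of _ _ "m * d"])
    (auto simp: first_cols_def outer_def)

text \<open>Every matrix in the kernel of the error form induces a viewwise affine image of the
  realization; by rigidity that image is globally affine, and affine non-degeneracy of the views lets
  one read off its linear part on each block.\<close>
lemma rigid_isotropic_factor:
  assumes nd: "\<forall>i<m. affinely_nondegenerate_view \<Theta> i"
    and S: "perfect_alignment \<Theta> S" and rigid: "affinely_rigid \<Theta> (realization \<Theta> S)"
    and W: "W \<in> carrier_mat (m * d) d" and iso: "\<And>b. b < d \<Longrightarrow> col W b \<bullet> (matC \<Theta> *\<^sub>v col W b) = 0"
  shows "\<exists>M\<in>carrier_mat d d. W = S * M"
proof -
  have Sc: "S \<in> carrier_mat (m * d) d" using S alignmentD by (simp add: perfect_alignment_def)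
  have isoS: "col S b \<bullet> (matC \<Theta> *\<^sub>v col S b) = 0" if "b < d" for b
    using align_error_zero_col[OF Sc _ that] S by (simp add: perfect_alignment_def)
  have cc: "col W b \<in> carrier_vec (m * d)" "col S b \<in> carrier_vec (m * d)" for b
    using W Sc by (auto intro!: carrier_vecI)
  have edgeW: "potential (col W b) $ k = (\<Sum>a<d. W $$ (i * d + a, b) * x k i $ a) + potential (col W b) $ (n + i)"
    if "(k, i) \<in> E" "b < d" for k i b
  proof -
    have "(\<Sum>a<d. x k i $ a * col W b $ (i * d + a)) = (\<Sum>a<d. W $$ (i * d + a, b) * x k i $ a)"
      using W that block_index_less[OF edgeD(2)[OF that(1)]] by (intro sum.cong) auto
    then show ?thesis using isotropic_edge[OF cc(1) iso[OF that(2)] that(1)] by simp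
  qed
  have edgeS: "potential (col S b) $ k = (\<Sum>a<d. S $$ (i * d + a, b) * x k i $ a) + potential (col S b) $ (n + i)"
    if "(k, i) \<in> E" "b < d" for k i b
  proof -
    have "(\<Sum>a<d. x k i $ a * col S b $ (i * d + a)) = (\<Sum>a<d. S $$ (i * d + a, b) * x k i $ a)"
      using Sc that block_index_less[OF edgeD(2)[OF that(1)]] by (intro sum.cong) auto
    then show ?thesis using isotropic_edge[OF cc(2) isoS[OF that(2)] that(1)] by simp
  qed
  \<comment> \<open>The competitor for rigidity: the potentials of the columns of \<open>W\<close>,
    taken at the points, are used as coordinates of a configuration.\<close>
  define Y where "Y = mat d n (\<lambda>(b, k). potential (col W b) $ k)"
  have Y: "Y \<in> carrier_mat d n" by (simp add: Y_def)
  have viewwise: "\<exists>A. affine_transform d A \<and> (\<forall>k. (k, i) \<in> E \<longrightarrow> col Y k = A (x k i))" if i: "i < m" for i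
  proof -
    \<comment> \<open>By \<open>edgeW\<close>, view \<open>i\<close> carries its local coordinates
      to \<open>Y\<close> by the transposed block of \<open>W\<close>, followed by a translation
      whose entries are the potentials at the view vertex \<open>n + i\<close>.\<close>
    define L where "L = mat d d (\<lambda>(b, a). W $$ (i * d + a, b))"
    define t where "t = vec d (\<lambda>b. potential (col W b) $ (n + i))"
    have "affine_transform d (\<lambda>v. L *\<^sub>v v + t)"
      unfolding affine_transform_def by (intro bexI[of _ L] bexI[of _ t]) (auto simp: L_def t_def)
    moreover have "col Y k = L *\<^sub>v x k i + t" if e: "(k, i) \<in> E" for k
    proof (rule eq_vecI)
      fix b assume "b < dim_vec (L *\<^sub>v x k i + t)"
      then have b: "b < d" by (simp add: t_def)
      have "(L *\<^sub>v x k i) $ b = (\<Sum>a<d. W $$ (i * d + a, b) * x k i $ a)"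
        using b coords_carrier[OF e] by (simp add: L_def scalar_prod_def atLeast0LessThan)
      then show "col Y k $ b = (L *\<^sub>v x k i + t) $ b"
        using b edgeD(1)[OF e] edgeW[OF e b] by (simp add: Y_def t_def)
    qed (simp add: Y_def t_def)
    ultimately show ?thesis by blast
  qed
  obtain A where "affine_transform d A" and AY: "\<forall>k<n. col Y k = A (col (realization \<Theta> S) k)"
    using rigid Y viewwise unfolding affinely_rigid_def by blast
  then obtain M t where M: "M \<in> carrier_mat d d" and t: "t \<in> carrier_vec d"
    and A: "\<And>v. v \<in> carrier_vec d \<Longrightarrow> A v = M *\<^sub>v v + t"
    unfolding affine_transform_def by blast
  \<comment> \<open>The centroid that the realization subtracts; it will only contribute to a
    constant.\<close>
  define \<mu> where "\<mu> c = (\<Sum>l<n. potential (col S c) $ l) / n" for c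
  have glob: "potential (col W b) $ k = (\<Sum>c<d. M $$ (b, c) * (potential (col S c) $ k - \<mu> c)) + t $ b" if k: "k < n" and b: "b < d" for b k
  proof -
    note R = carrier_matD[OF realization_carrier[OF Sc]]
    have v: "col (realization \<Theta> S) k \<in> carrier_vec d" using R by (intro carrier_vecI) simp
    have "potential (col W b) $ k = col Y k $ b" using k b by (simp add: Y_def)
    also have "\<dots> = (M *\<^sub>v col (realization \<Theta> S) k + t) $ b" using AY k A[OF v] by simp
    also have "\<dots> = (\<Sum>c<d. M $$ (b, c) * realization \<Theta> S $$ (c, k)) + t $ b"
      using b k M t R by (simp add: scalar_prod_def atLeast0LessThan)
    finally show ?thesis using realization_index[OF Sc _ k] by (simp add: \<mu>_def)
  qed
  have entry: "W $$ (i * d + a, b) = (\<Sum>c<d. M $$ (b, c) * S $$ (i * d + a, c))"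
    if i: "i < m" and a: "a < d" and b: "b < d" for i a b
  proof -
    \<comment> \<open>The discrepancy between \<open>W\<close> and its prediction from
      \<open>S\<close>, along one row index of view \<open>i\<close>. Comparing the two expressions
      for the potential at a point shows that its pairing with the local coordinates is the same for
      all points of the view.\<close>
    define u where "u a = W $$ (i * d + a, b) - (\<Sum>c<d. M $$ (b, c) * S $$ (i * d + a, c))" for a
    have "u a = 0"
    proof (rule nondegenerate_view_annihilator[OF _ _ a, of i u])
      show "affinely_nondegenerate_view \<Theta> i" using nd i by simp
      fix k assume e: "(k, i) \<in> E"
      have "(\<Sum>a<d. W $$ (i * d + a, b) * x k i $ a) + potential (col W b) $ (n + i)
        = (\<Sum>c<d. M $$ (b, c) * (((\<Sum>a<d. S $$ (i * d + a, c) * x k i $ a) + potential (col S c) $ (n + i)) - \<mu> c)) + t $ b"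
        using edgeW[OF e b] glob[OF edgeD(1)[OF e] b] edgeS[OF e] by simp
      also have "(\<Sum>c<d. M $$ (b, c) * (((\<Sum>a<d. S $$ (i * d + a, c) * x k i $ a) + potential (col S c) $ (n + i)) - \<mu> c))
        = (\<Sum>c<d. M $$ (b, c) * (\<Sum>a<d. S $$ (i * d + a, c) * x k i $ a)) + (\<Sum>c<d. M $$ (b, c) * (potential (col S c) $ (n + i) - \<mu> c))"
        by (simp add: sum.distrib[symmetric] algebra_simps)
      also have "(\<Sum>c<d. M $$ (b, c) * (\<Sum>a<d. S $$ (i * d + a, c) * x k i $ a)) = (\<Sum>a<d. (\<Sum>c<d. M $$ (b, c) * S $$ (i * d + a, c)) * x k i $ a)"
        unfolding sum_distrib_left sum_distrib_right by (subst sum.swap) (simp add: mult.assoc)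
      finally show "(\<Sum>a<d. u a * x k i $ a) = (\<Sum>c<d. M $$ (b, c) * (potential (col S c) $ (n + i) - \<mu> c)) + t $ b - potential (col W b) $ (n + i)"
        by (simp add: u_def left_diff_distrib sum_subtractf)
    qed
    then show ?thesis by (simp add: u_def)
  qed
  \<comment> \<open>\<open>M\<close> acts on configurations from the left and alignments are stacked
    by rows, hence the transpose.\<close>
  have "W = S * transpose_mat M"
  proof (rule eq_matI)
    fix r b assume "r < dim_row (S * transpose_mat M)" "b < dim_col (S * transpose_mat M)"
    then have r: "r < m * d" and b: "b < d" using Sc M by auto
    from r obtain i a where i: "i < m" "a < d" "r = i * d + a" by (rule stacked_index_cases)
    show "W $$ (r, b) = (S * transpose_mat M) $$ (r, b)"
      using r b Sc M entry[OF i(1,2) b] unfolding i(3) by (simp add: scalar_prod_def atLeast0LessThan mult.commute)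
  qed (use W Sc M in auto)
  then show ?thesis using M by (intro bexI[of _ "transpose_mat M"]) auto
qed

section \<open>Uniqueness and non-degeneracy from rigidity\<close>

lemma perfect_optimal:
  assumes "perfect_alignment \<Theta> S"
  shows "optimal_alignment \<Theta> S"
  using assms align_error_nonneg alignmentD(1) by (auto simp: perfect_alignment_def optimal_alignment_def)

lemma optimal_isotropic:
  assumes S: "perfect_alignment \<Theta> S" and T: "optimal_alignment \<Theta> T" and b: "b < d"
  shows "col T b \<bullet> (matC \<Theta> *\<^sub>v col T b) = 0"
proof (rule align_error_zero_col[OF _ _ b])
  show "T \<in> carrier_mat (m * d) d" using T alignmentD(1) by (simp add: optimal_alignment_def)
  show "align_error \<Theta> T \<le> 0" using S T by (auto simp: optimal_alignment_def perfect_alignment_def)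
qed

lemma rigid_unique:
  assumes nd: "\<forall>i<m. affinely_nondegenerate_view \<Theta> i"
    and S: "perfect_alignment \<Theta> S" and rigid: "affinely_rigid \<Theta> (realization \<Theta> S)"
  shows "unique_alignment \<Theta> S"
  unfolding unique_alignment_def
proof (intro conjI allI impI perfect_optimal[OF S])
  fix T assume T: "optimal_alignment \<Theta> T"
  have Ta: "alignment \<Theta> T" using T by (simp add: optimal_alignment_def)
  have Sa: "alignment \<Theta> S" using S by (simp add: perfect_alignment_def)
  obtain M where M: "M \<in> carrier_mat d d" and TM: "T = S * M"
    using rigid_isotropic_factor[OF nd S rigid alignmentD(1)[OF Ta] optimal_isotropic[OF S T]] by blast
  have m0: "0 < m" using pos by simp
  let ?S0 = "block d S 0"
  \<comment> \<open>The factorization yields an arbitrary matrix \<open>M\<close>. Comparing first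
    blocks exhibits it as a product of two orthogonal matrices.\<close>
  have "transpose_mat ?S0 * block d T 0 = transpose_mat ?S0 * (?S0 * M)"
    unfolding TM using block_mult[OF alignmentD(1)[OF Sa] M m0] by simp
  also have "\<dots> = (transpose_mat ?S0 * ?S0) * M" using M by (intro assoc_mult_mat[of _ d d _ d _ d, symmetric]) auto
  also have "\<dots> = M" using M by (simp add: orthogonal_group_transpose_mult[OF alignmentD(2)[OF Sa m0]])
  finally have "M \<in> orthogonal_group d"
    using orthogonal_group_mult[OF orthogonal_group_transpose[OF alignmentD(2)[OF Sa m0]] alignmentD(2)[OF Ta m0]] by simp
  then show "\<exists>Q\<in>orthogonal_group d. T = S * Q" using TM by blast
qed

lemma rigid_nondegenerate:
  assumes nd: "\<forall>i<m. affinely_nondegenerate_view \<Theta> i"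
    and S: "perfect_alignment \<Theta> S" and rigid: "affinely_rigid \<Theta> (realization \<Theta> S)"
  shows "nondegenerate_alignment \<Theta> S"
proof (rule nondegenerate_alignmentI[OF S])
  have Sa: "alignment \<Theta> S" using S by (simp add: perfect_alignment_def)
  have m0: "0 < m" using pos by simp
  fix V assume V: "V \<in> tangent_blocks d (m - 1) (quotient_proj \<Theta> S)"
    and iso: "\<And>b. b < d \<Longrightarrow> col (0\<^sub>m d d @\<^sub>r V) b \<bullet> (matC \<Theta> *\<^sub>v col (0\<^sub>m d d @\<^sub>r V) b) = 0"
  have Vc: "V \<in> carrier_mat ((m - 1) * d) d" using V by (simp add: tangent_blocks_def)
  obtain M where M: "M \<in> carrier_mat d d" and VM: "0\<^sub>m d d @\<^sub>r V = S * M"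
    using rigid_isotropic_factor[OF nd S rigid append_rows_carrier[OF zero_carrier_mat Vc] iso] by blast
  let ?S0 = "block d S 0"
  have "?S0 * M = 0\<^sub>m d d"
    using block_mult[OF alignmentD(1)[OF Sa] M m0] block_append_rows[OF zero_carrier_mat Vc, of 0] by (simp add: VM[symmetric])
  then have "0\<^sub>m d d = transpose_mat ?S0 * (?S0 * M)" by (simp add: right_mult_zero_mat[of _ d d])
  also have "\<dots> = (transpose_mat ?S0 * ?S0) * M" using M by (intro assoc_mult_mat[of _ d d _ d _ d, symmetric]) auto
  also have "\<dots> = M" using M by (simp add: orthogonal_group_transpose_mult[OF alignmentD(2)[OF Sa m0]])
  finally have "M = 0\<^sub>m d d" by simp
  then have Z: "0\<^sub>m d d @\<^sub>r V = 0\<^sub>m (m * d) d" using VM right_mult_zero_mat[OF alignmentD(1)[OF Sa]] by simp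
  show "V = 0\<^sub>m ((m - 1) * d) d"
  proof (rule eq_matI)
    fix r b assume "r < dim_row (0\<^sub>m ((m - 1) * d) d :: real mat)" "b < dim_col (0\<^sub>m ((m - 1) * d) d :: real mat)"
    then have r: "r < (m - 1) * d" "b < d" by simp_all
    have lt: "d + r < m * d" using r(1) views_split by linarith
    show "V $$ (r, b) = 0\<^sub>m ((m - 1) * d) d $$ (r, b)"
      using append_rows_index'[OF zero_carrier_mat Vc lt r(2)] r lt unfolding Z by simp
  qed (use Vc in auto)
qed

end

subsection \<open>The counterexample to the converse\<close>

text \<open>For \<open>1 \<times> 1\<close> blocks the tangency equation reads
  \<open>v q = - (q v)\<close>, so \<open>v q = 0\<close>, and \<open>q\<close> is a sign.\<close>

lemma tangent_blocks_dim1: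
  assumes q: "q \<in> orthogonal_power 1 N" and V: "V \<in> tangent_blocks 1 N q"
  shows "V = 0\<^sub>m (N * 1) 1"
proof (rule eq_matI)
  fix r b assume "r < dim_row (0\<^sub>m (N * 1) 1 :: real mat)" "b < dim_col (0\<^sub>m (N * 1) 1 :: real mat)"
  then have r: "r < N" and b: "b = 0" by auto
  have "(transpose_mat (block 1 V r) * block 1 q r) $$ (0, 0) = (- (transpose_mat (block 1 q r) * block 1 V r)) $$ (0, 0)"
    using V r by (simp add: tangent_blocks_def)
  then have "V $$ (r, 0) * q $$ (r, 0) = 0" by (simp add: scalar_prod_def)
  moreover have "(transpose_mat (block 1 q r) * block 1 q r) $$ (0, 0) = 1\<^sub>m 1 $$ (0, 0)"
    using orthogonal_group_transpose_mult[OF orthogonal_powerD(2)[OF q r]] by simp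
  then have "q $$ (r, 0) * q $$ (r, 0) = 1" by (simp add: scalar_prod_def)
  ultimately show "V $$ (r, b) = 0\<^sub>m (N * 1) 1 $$ (r, b)" using r b by auto
qed (use V in \<open>auto simp: tangent_blocks_def\<close>)

text \<open>Three points on a line, each pair of them seen by one view. Any map of the points is affine on
  every view, whereas \<open>\<plusminus>1 \<plusminus> 1 = \<plusminus>2\<close> forces the three signs of an alignment to agree.\<close>
definition collinear_triangle :: patch_frame where
  "collinear_triangle = \<lparr>pf_dim = 1, pf_points = 3, pf_views = 3,
     pf_edges = {(0, 0), (1, 0), (1, 1), (2, 1), (0, 2), (2, 2)}, pf_coords = (\<lambda>k i. vec 1 (\<lambda>_. real k))\<rparr>"

lemma collinear_triangle_simps [simp]:
  "pf_dim collinear_triangle = 1" "pf_points collinear_triangle = 3" "pf_views collinear_triangle = 3"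
  "pf_edges collinear_triangle = {(0, 0), (1, 0), (1, 1), (2, 1), (0, 2), (2, 2)}"
  "pf_coords collinear_triangle k i = vec 1 (\<lambda>_. real k)"
  by (simp_all add: collinear_triangle_def)

lemma collinear_triangle_framework: "patch_framework collinear_triangle"
  by (simp add: patch_framework_def)

lemma collinear_triangle_connected: "pf_connected collinear_triangle"
proof -
  define R where "R = pf_arcs collinear_triangle \<union> (pf_arcs collinear_triangle)\<inverse>"
  have s: "sym (R\<^sup>*)" unfolding R_def by (intro sym_rtrancl sym_Un_converse)
  have arc: "(k, 3 + i) \<in> R" "(3 + i, k) \<in> R" if "(k, i) \<in> {(0, 0), (1, 0), (1, 1), (2, 1), (0, 2), (2, 2)}" for k i
    using that by (auto simp: R_def pf_arcs_def)
  \<comment> \<open>The walk 0, 3, 1, 4, 2, 5 visits all vertices; 3, 4 and 5 are the views.\<close>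
  have 3: "(0, 3) \<in> R\<^sup>*" using arc(1)[of 0 0] by auto
  have 1: "(0, 1) \<in> R\<^sup>*" using 3 arc(2)[of 1 0] by (auto intro: rtrancl_into_rtrancl)
  have 4: "(0, 4) \<in> R\<^sup>*" using 1 arc(1)[of 1 1] by (auto intro: rtrancl_into_rtrancl)
  have 2: "(0, 2) \<in> R\<^sup>*" using 4 arc(2)[of 2 1] by (auto intro: rtrancl_into_rtrancl)
  have 5: "(0, 5) \<in> R\<^sup>*" using 2 arc(1)[of 2 2] by (auto intro: rtrancl_into_rtrancl)
  have "(0, u) \<in> R\<^sup>*" if "u < 6" for u
  proof -
    have "u = 0 \<or> u = 1 \<or> u = 2 \<or> u = 3 \<or> u = 4 \<or> u = 5" using that by linarith
    then show ?thesis using 1 2 3 4 5 by auto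
  qed
  then have "(u, v) \<in> R\<^sup>*" if "u < 6" "v < 6" for u v using that symD[OF s] by (meson rtrancl_trans)
  then show ?thesis unfolding pf_connected_def R_def by simp
qed

interpretation triangle: connected_patch_framework collinear_triangle
  using collinear_triangle_framework collinear_triangle_connected by unfold_locales

lemma collinear_triangle_nondegenerate_view:
  assumes "i < 3"
  shows "affinely_nondegenerate_view collinear_triangle i"
proof -
  have "\<exists>k l. k \<noteq> l \<and> {k. (k, i) \<in> pf_edges collinear_triangle} = {k, l}"
  proof -
    have "i = 0 \<or> i = 1 \<or> i = 2" using assms by linarith
    then consider "i = 0" | "i = 1" | "i = 2" by blast
    then show ?thesis
    proof cases
      case 1 then show ?thesis by (intro exI[of _ 0] exI[of _ 1]) auto
    next
      case 2 then show ?thesis by (intro exI[of _ 1] exI[of _ 2]) auto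
    next
      case 3 then show ?thesis by (intro exI[of _ 0] exI[of _ 2]) auto
    qed
  qed
  then obtain k l where kl: "k \<noteq> l" and eq: "{k. (k, i) \<in> pf_edges collinear_triangle} = {k, l}" by blast
  have "{pf_coords collinear_triangle k i | k. (k, i) \<in> pf_edges collinear_triangle} = (\<lambda>k. vec 1 (\<lambda>_. real k)) ` {k, l}"
    unfolding eq[symmetric] by auto
  then have "affine_dim 1 (affine_span 1 {pf_coords collinear_triangle k i | k. (k, i) \<in> pf_edges collinear_triangle}) = 1"
    using kl by (intro affine_dim_line[of _ "vec 1 (\<lambda>_. real k)" "vec 1 (\<lambda>_. real l)"]) auto
  then show ?thesis using kl unfolding affinely_nondegenerate_view_def eq by simp
qed

section \<open>The all-ones alignment of the triangle\<close>

definition triangle_alignment :: "real mat" where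
  "triangle_alignment = mat 3 1 (\<lambda>_. 1)"

lemma triangle_alignment_perfect: "perfect_alignment collinear_triangle triangle_alignment"
proof -
  have al: "alignment collinear_triangle triangle_alignment"
    unfolding alignment_def orthogonal_power_def orthogonal_group_def
    by (auto simp: triangle_alignment_def scalar_prod_def intro!: eq_matI)
  have c: "triangle_alignment \<in> carrier_mat 3 1" by (simp add: triangle_alignment_def)
  have "col triangle_alignment 0 \<bullet> (matC collinear_triangle *\<^sub>v col triangle_alignment 0) = 0"
  \<comment> \<open>The witness places point \<open>k\<close> at height \<open>k\<close> and gives
    every view translation 0, since the local coordinates already are the global positions.\<close>
  proof (rule triangle.matC_isotropicI[of _ "vec 6 (\<lambda>j. if j < 3 then real j else 0)"])
    show w: "col triangle_alignment 0 \<in> carrier_vec (pf_views collinear_triangle * pf_dim collinear_triangle)"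
      using c by (intro carrier_vecI) simp
    show z: "vec 6 (\<lambda>j. if j < 3 then real j else 0) \<in> carrier_vec (pf_points collinear_triangle + pf_views collinear_triangle)" by simp
    fix k i assume e: "(k, i) \<in> pf_edges collinear_triangle"
    show "lifted_coord collinear_triangle k i \<bullet> col triangle_alignment 0
      = edge_vec collinear_triangle k i \<bullet> vec 6 (\<lambda>j. if j < 3 then real j else 0)"
      unfolding triangle.lifted_coord_scalar_prod[OF e w] triangle.edge_vec_scalar_prod[OF e z]
      using e by (auto simp: triangle_alignment_def)
  qed
  then have "align_error collinear_triangle triangle_alignment = 0"
    using c by (subst triangle.align_error_sum) auto
  then show ?thesis using al by (simp add: perfect_alignment_def)
qed

lemma triangle_alignment_nondegenerate: "nondegenerate_alignment collinear_triangle triangle_alignment"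
proof (rule triangle.nondegenerate_alignmentI[OF triangle_alignment_perfect])
  have al: "alignment collinear_triangle triangle_alignment"
    using triangle_alignment_perfect by (simp add: perfect_alignment_def)
  fix V assume "V \<in> tangent_blocks (pf_dim collinear_triangle) (pf_views collinear_triangle - 1)
    (quotient_proj collinear_triangle triangle_alignment)"
  then show "V = 0\<^sub>m ((pf_views collinear_triangle - 1) * pf_dim collinear_triangle) (pf_dim collinear_triangle)"
    using tangent_blocks_dim1 triangle.quotient_proj_orthogonal(1)[OF al] by simp
qed

lemma triangle_alignment_unique: "unique_alignment collinear_triangle triangle_alignment"
  unfolding unique_alignment_def
proof (intro conjI allI impI triangle.perfect_optimal[OF triangle_alignment_perfect])
  fix T assume T: "optimal_alignment collinear_triangle T"
  have al: "alignment collinear_triangle T" using T by (simp add: optimal_alignment_def)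
  have Tc: "T \<in> carrier_mat 3 1" using triangle.alignmentD(1)[OF al] by simp
  have sq: "T $$ (i, 0) * T $$ (i, 0) = 1" if "i < 3" for i
  proof -
    have "(transpose_mat (block 1 T i) * block 1 T i) $$ (0, 0) = 1\<^sub>m 1 $$ (0, 0)"
      using orthogonal_group_transpose_mult[OF triangle.alignmentD(2)[OF al, of i]] that by simp
    then show ?thesis by (simp add: scalar_prod_def)
  qed
  define p where "p = triangle.potential (col T 0)"
  have w: "col T 0 \<in> carrier_vec (pf_views collinear_triangle * pf_dim collinear_triangle)"
    using Tc by (intro carrier_vecI) simp
  have edge: "real k * T $$ (i, 0) = p $ k - p $ (3 + i)" if "(k, i) \<in> pf_edges collinear_triangle" for k i
  proof -
    have "i < 3" using triangle.edgeD(2)[OF that] by simp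
    then show ?thesis
      using triangle.isotropic_edge[OF w triangle.optimal_isotropic[OF triangle_alignment_perfect T] that] Tc
      by (simp add: p_def)
  qed
  \<comment> \<open>Within a view the potentials of the two points differ by the sign times their
    distance, so views 0, 1 and 2 give \<open>p $ 1 - p $ 0\<close>, \<open>p $ 2 - p $ 1\<close>
    and \<open>p $ 2 - p $ 0\<close>. The last is the sum of the other two.\<close>
  have "2 * T $$ (2, 0) = T $$ (0, 0) + T $$ (1, 0)"
    using edge[of 0 0] edge[of 1 0] edge[of 1 1] edge[of 2 1] edge[of 0 2] edge[of 2 2] by simp
  moreover have "T $$ (i, 0) = 1 \<or> T $$ (i, 0) = -1" if "i < 3" for i
    using sq[OF that] square_eq_1_iff by blast
  from this[of 0] this[of 1] this[of 2]
  have "T $$ (0, 0) = 1 \<or> T $$ (0, 0) = -1" "T $$ (1, 0) = 1 \<or> T $$ (1, 0) = -1" "T $$ (2, 0) = 1 \<or> T $$ (2, 0) = -1"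
    by simp_all
  ultimately have eq: "T $$ (1, 0) = T $$ (0, 0)" "T $$ (2, 0) = T $$ (0, 0)" by auto
  define Q where "Q = mat 1 1 (\<lambda>_. T $$ (0, 0))"
  have "Q \<in> orthogonal_group 1" unfolding orthogonal_group_def using sq[of 0]
    by (auto simp: Q_def scalar_prod_def intro!: eq_matI)
  moreover have "T = triangle_alignment * Q"
  proof (rule eq_matI)
    fix i b assume "i < dim_row (triangle_alignment * Q)" "b < dim_col (triangle_alignment * Q)"
    then have i: "i < 3" and b: "b = 0" by (simp_all add: triangle_alignment_def Q_def)
    have "i = 0 \<or> i = 1 \<or> i = 2" using i by linarith
    then have "T $$ (i, 0) = T $$ (0, 0)" using eq by auto
    then show "T $$ (i, b) = (triangle_alignment * Q) $$ (i, b)"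
      using i by (simp add: b triangle_alignment_def Q_def scalar_prod_def)
  qed (use Tc in \<open>auto simp: triangle_alignment_def Q_def\<close>)
  ultimately show "\<exists>Q\<in>orthogonal_group (pf_dim collinear_triangle). T = triangle_alignment * Q" by auto
qed

text \<open>A view contains only two points, at distinct coordinates, and a line interpolates any
  two prescribed values there.\<close>

lemma collinear_triangle_viewwise_affine:
  assumes Y: "Y \<in> carrier_mat 1 3" and i: "i < 3"
  shows "\<exists>A. affine_transform 1 A \<and> (\<forall>k. (k, i) \<in> pf_edges collinear_triangle \<longrightarrow> col Y k = A (pf_coords collinear_triangle k i))"
proof -
  have line: "\<exists>A. affine_transform 1 A \<and> col Y k = A (vec 1 (\<lambda>_. real k)) \<and> col Y l = A (vec 1 (\<lambda>_. real l))"
    if kl: "k < 3" "l < 3" "k \<noteq> l" for k l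
  proof -
    define s where "s = (Y $$ (0, k) - Y $$ (0, l)) / (real k - real l)"
    define L where "L = mat 1 1 (\<lambda>_. s)"
    define t where "t = vec 1 (\<lambda>_. Y $$ (0, k) - s * real k)"
    have sl: "s * (real k - real l) = Y $$ (0, k) - Y $$ (0, l)" using kl by (simp add: s_def)
    have "affine_transform 1 (\<lambda>v. L *\<^sub>v v + t)"
      unfolding affine_transform_def by (intro bexI[of _ L] bexI[of _ t]) (auto simp: L_def t_def)
    moreover have "col Y k = L *\<^sub>v vec 1 (\<lambda>_. real k) + t"
      using Y kl by (intro eq_vecI) (auto simp: L_def t_def scalar_prod_def)
    moreover have "col Y l = L *\<^sub>v vec 1 (\<lambda>_. real l) + t"
      using Y kl sl by (intro eq_vecI) (auto simp: L_def t_def scalar_prod_def algebra_simps)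
    ultimately show ?thesis by blast
  qed
  have "i = 0 \<or> i = 1 \<or> i = 2" using i by linarith
  then consider "i = 0" | "i = 1" | "i = 2" by blast
  then show ?thesis
  proof cases
    case 1 then show ?thesis using line[of 0 1] by auto
  next
    case 2 then show ?thesis using line[of 1 2] by auto
  next
    case 3 then show ?thesis using line[of 0 2] by auto
  qed
qed

text \<open>The affine functions of the single coordinate row of \<open>X\<close> form a space of
  dimension at most 2, whereas all functions on three points are viewwise affine. This holds for
  every \<open>X\<close>, so the realization need not be computed.\<close>

lemma collinear_triangle_not_rigid:
  assumes X: "X \<in> carrier_mat 1 3"
  shows "\<not> affinely_rigid collinear_triangle X"
proof
  assume rigid: "affinely_rigid collinear_triangle X"
  have ex: "\<exists>s t. \<forall>k<3. Y $$ (0, k) = s * X $$ (0, k) + t" if Yc: "Y \<in> carrier_mat 1 3" for Y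
  proof -
    obtain A where "affine_transform 1 A" and AY: "\<forall>k<3. col Y k = A (col X k)"
      using rigid Yc collinear_triangle_viewwise_affine[OF Yc] unfolding affinely_rigid_def by auto
    then obtain M t where M: "M \<in> carrier_mat 1 1" and t: "t \<in> carrier_vec 1"
      and A: "\<And>v. v \<in> carrier_vec 1 \<Longrightarrow> A v = M *\<^sub>v v + t"
      unfolding affine_transform_def by blast
    have "Y $$ (0, k) = M $$ (0, 0) * X $$ (0, k) + t $ 0" if k: "k < 3" for k
    proof -
      have v: "col X k \<in> carrier_vec 1" using X by (intro carrier_vecI) simp
      have "Y $$ (0, k) = col Y k $ 0" using Yc k by simp
      also have "\<dots> = (M *\<^sub>v col X k + t) $ 0" using AY k A[OF v] by simp
      also have "\<dots> = M $$ (0, 0) * X $$ (0, k) + t $ 0" using M t X k by (simp add: scalar_prod_def)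
      finally show ?thesis .
    qed
    then show ?thesis by blast
  qed
  \<comment> \<open>Indicators of single points. That of point 0 takes equal values at points 1 and
    2 but is not constant, which forces \<open>X\<close> to agree there; that of point 1 separates
    the two.\<close>
  define Y where "Y j = mat 1 3 (\<lambda>(b, k). if k = j then 1 else 0 :: real)" for j
  have Y: "Y j \<in> carrier_mat 1 3" for j by (simp add: Y_def)
  obtain s t where 0: "\<forall>k<3. Y 0 $$ (0, k) = s * X $$ (0, k) + t" using ex[OF Y] by blast
  obtain s' t' where 1: "\<forall>k<3. Y 1 $$ (0, k) = s' * X $$ (0, k) + t'" using ex[OF Y] by blast
  have "s * X $$ (0, 1) + t = 0" "s * X $$ (0, 2) + t = 0" "s * X $$ (0, 0) + t = 1"
    using 0[rule_format, of 0] 0[rule_format, of 1] 0[rule_format, of 2] by (simp_all add: Y_def)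
  then have "s * X $$ (0, 1) = s * X $$ (0, 2)" and "s \<noteq> 0" by (linarith, auto)
  then have "X $$ (0, 1) = X $$ (0, 2)" by simp
  moreover have "s' * X $$ (0, 1) + t' = 1" "s' * X $$ (0, 2) + t' = 0"
    using 1[rule_format, of 1] 1[rule_format, of 2] by (simp_all add: Y_def)
  ultimately show False by simp
qed


theorem proposition4p4:
  shows "(\<forall>\<Theta> S. patch_framework \<Theta> \<and> pf_connected \<Theta> \<and>
            (\<forall>i < pf_views \<Theta>. affinely_nondegenerate_view \<Theta> i) \<and>
            perfect_alignment \<Theta> S \<and> affinely_rigid \<Theta> (realization \<Theta> S)
          \<longrightarrow> nondegenerate_alignment \<Theta> S \<and> unique_alignment \<Theta> S)
       \<and> (\<exists>\<Theta> S. patch_framework \<Theta> \<and> pf_connected \<Theta> \<and>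
            (\<forall>i < pf_views \<Theta>. affinely_nondegenerate_view \<Theta> i) \<and>
            perfect_alignment \<Theta> S \<and> nondegenerate_alignment \<Theta> S \<and> unique_alignment \<Theta> S \<and>
            \<not> affinely_rigid \<Theta> (realization \<Theta> S))"
proof (rule conjI)
  show "\<forall>\<Theta> S. patch_framework \<Theta> \<and> pf_connected \<Theta> \<and>
            (\<forall>i < pf_views \<Theta>. affinely_nondegenerate_view \<Theta> i) \<and>
            perfect_alignment \<Theta> S \<and> affinely_rigid \<Theta> (realization \<Theta> S)
          \<longrightarrow> nondegenerate_alignment \<Theta> S \<and> unique_alignment \<Theta> S"
  proof (intro allI impI; elim conjE)
    fix \<Theta> S
    assume "patch_framework \<Theta>" "pf_connected \<Theta>"
      and *: "\<forall>i < pf_views \<Theta>. affinely_nondegenerate_view \<Theta> i" "perfect_alignment \<Theta> S"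
        "affinely_rigid \<Theta> (realization \<Theta> S)"
    then interpret connected_patch_framework \<Theta> by unfold_locales
    show "nondegenerate_alignment \<Theta> S \<and> unique_alignment \<Theta> S"
      using rigid_nondegenerate[OF *] rigid_unique[OF *] by blast
  qed
  have "triangle_alignment \<in> carrier_mat (pf_views collinear_triangle * pf_dim collinear_triangle) (pf_dim collinear_triangle)"
    by (simp add: triangle_alignment_def)
  from triangle.realization_carrier[OF this]
  have "\<not> affinely_rigid collinear_triangle (realization collinear_triangle triangle_alignment)"
    by (intro collinear_triangle_not_rigid) simp
  then show "\<exists>\<Theta> S. patch_framework \<Theta> \<and> pf_connected \<Theta> \<and>
            (\<forall>i < pf_views \<Theta>. affinely_nondegenerate_view \<Theta> i) \<and>
            perfect_alignment \<Theta> S \<and> nondegenerate_alignment \<Theta> S \<and> unique_alignment \<Theta> S \<and>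
            \<not> affinely_rigid \<Theta> (realization \<Theta> S)"
    using collinear_triangle_framework collinear_triangle_connected collinear_triangle_nondegenerate_view
      triangle_alignment_perfect triangle_alignment_nondegenerate triangle_alignment_unique
    by (intro exI[of _ collinear_triangle] exI[of _ triangle_alignment]) simp
qed

end
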